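(* Let $m\in\mathbb N$, let $Q,B$ be real $m\times m$ matrices with $Q=Q^\star\ge 0$, and suppose that $Q(t)=\int_0^t e^{sB}Qe^{sB^\star}\,ds$ is positive definite for every $t>0$. Let $\{\mathcal T(t)\}_{t\ge0}$ be the family of linear operators on $\mathscr S(\mathbb R^m)$ given by $\mathcal T(0)\varphi=\varphi$ and, for $t>0$, $$\mathcal T(t)\varphi(x)=(4\pi)^{-\frac m2}\,\frac{e^{-\frac{i\pi m}{4}}}{\sqrt{\det Q(t)}}\int_{\mathbb R^m}e^{\,i\,\frac{\langle Q(t)^{-1}(y-e^{tB}x),\,y-e^{tB}x\rangle}{4}}\varphi(y)\,dy .$$ Then $\{\mathcal T(t)\}_{t\ge0}$ can be uniquely extended to a strongly continuous semigroup on $L^2(\mathbb R^m)$. Denote by $\mathscr L_2$ and $D_2$ the infinitesimal generator of this semigroup and its domain, i.e. $$D_2=\Big\{f\in L^2(\mathbb R^m)\ :\ \mathscr L_2 f:=\lim_{t\to0^+}\frac{\mathcal T(t)f-f}{t}\ \text{ exists in } L^2(\mathbb R^m)\Big\}.$$ Then $\mathscr S(\mathbb R^m)$ is a core for $\mathscr L_2$, and on this core $\mathscr L_2$ is given by $$\mathscr L_2\varphi(x)=i\operatorname{tr}(Q\nabla^2\varphi)(x)+\langle Bx,\nabla\varphi(x)\rangle,\qquad \varphi\in\mathscr S(\mathbb R^m).$$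
   Context: $\mathscr S(\mathbb R^m)$ is the Schwartz space of complex-valued functions on $\mathbb R^m$; $^\star$ denotes transpose; $\nabla$, $\nabla^2$ are the gradient and Hessian; $\langle\cdot,\cdot\rangle$ is the (bilinear) Euclidean product; $i^2=-1$. The operators $\mathcal T(t)$ map $\mathscr S(\mathbb R^m)$ into itself. The extension is by bounded linear operators on $L^2(\mathbb R^m)$. *)

theory Defs
  imports "HOL-Analysis.Analysis"
begin

section \<open>The Hilbert space of square-integrable functions\<close>

definition square_integrable :: "('a::euclidean_space \<Rightarrow> complex) \<Rightarrow> bool"
  where "square_integrable f \<longleftrightarrow>
    f \<in> borel_measurable lborel \<and> integrable lborel (\<lambda>x. (norm (f x))\<^sup>2)"

definition L2_rel :: "('a::euclidean_space \<Rightarrow> complex) \<Rightarrow> ('a \<Rightarrow> complex) \<Rightarrow> bool"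
  where "L2_rel f g \<longleftrightarrow>
    square_integrable f \<and> square_integrable g \<and> (AE x in lborel. f x = g x)"

lemma square_integrable_zero: "square_integrable (\<lambda>_. 0)"
  by (simp add: square_integrable_def)

lemma square_integrable_cmult:
  assumes "square_integrable f"
  shows "square_integrable (\<lambda>x. c * f x)"
  using assms by (auto simp: square_integrable_def norm_mult power_mult_distrib)

lemma square_integrable_scaleR:
  assumes "square_integrable f"
  shows "square_integrable (\<lambda>x. r *\<^sub>R f x)"
  using square_integrable_cmult[OF assms, of "of_real r"] by (simp add: scaleR_conv_of_real)

lemma square_integrable_uminus:
  assumes "square_integrable f"
  shows "square_integrable (\<lambda>x. - f x)"
  using square_integrable_cmult[OF assms, of "-1"] by simp

lemma square_integrable_add:
  assumes "square_integrable f" "square_integrable g"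
  shows "square_integrable (\<lambda>x. f x + g x)"
proof -
  have [measurable]: "f \<in> borel_measurable borel" "g \<in> borel_measurable borel"
    using assms by (auto simp: square_integrable_def)
  have "integrable lborel (\<lambda>x. 2 * (norm (f x))\<^sup>2 + 2 * (norm (g x))\<^sup>2)"
    using assms by (auto simp: square_integrable_def)
  moreover have "(norm (f x + g x))\<^sup>2 \<le> 2 * (norm (f x))\<^sup>2 + 2 * (norm (g x))\<^sup>2" for x
  proof -
    have "(norm (f x + g x))\<^sup>2 \<le> (norm (f x) + norm (g x))\<^sup>2"
      by (simp add: norm_triangle_ineq power_mono)
    also have "\<dots> \<le> 2 * (norm (f x))\<^sup>2 + 2 * (norm (g x))\<^sup>2"
      using sum_squares_bound[of "norm (f x)" "norm (g x)"] by (simp add: power2_sum)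
    finally show ?thesis .
  qed
  ultimately have "integrable lborel (\<lambda>x. (norm (f x + g x))\<^sup>2)"
    by - (rule Bochner_Integration.integrable_bound, auto)
  then show ?thesis
    by (simp add: square_integrable_def)
qed

lemma square_integrable_diff:
  assumes "square_integrable f" "square_integrable g"
  shows "square_integrable (\<lambda>x. f x - g x)"
  using square_integrable_add[OF assms(1) square_integrable_uminus[OF assms(2)]] by simp

lemma square_integrable_inner:
  assumes "square_integrable f" "square_integrable g"
  shows "integrable lborel (\<lambda>x. f x \<bullet> g x)"
proof -
  have [measurable]: "f \<in> borel_measurable borel" "g \<in> borel_measurable borel"
    using assms by (auto simp: square_integrable_def)
  have "integrable lborel (\<lambda>x. (norm (f x))\<^sup>2 + (norm (g x))\<^sup>2)"
    using assms by (auto simp: square_integrable_def)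
  moreover have "\<bar>f x \<bullet> g x\<bar> \<le> (norm (f x))\<^sup>2 + (norm (g x))\<^sup>2" for x
  proof -
    have "\<bar>f x \<bullet> g x\<bar> \<le> norm (f x) * norm (g x)"
      by (rule Cauchy_Schwarz_ineq2)
    also have "\<dots> \<le> (norm (f x))\<^sup>2 + (norm (g x))\<^sup>2"
      using sum_squares_bound[of "norm (f x)" "norm (g x)"]
        mult_nonneg_nonneg[of "norm (f x)" "norm (g x)"] by (simp del: mult_nonneg_nonneg)
    finally show ?thesis .
  qed
  ultimately show ?thesis
    by - (rule Bochner_Integration.integrable_bound, auto)
qed

text \<open>
  \<open>L2_of f\<close> is the class of \<open>f\<close> modulo equality almost everywhere; it is meaningful for
  square-integrable \<open>f\<close> only. Borel measurable representatives suffice, since every Lebesgue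
  measurable function agrees almost everywhere with a Borel measurable one.
\<close>

quotient_type (overloaded) 'a L2 = "'a::euclidean_space \<Rightarrow> complex" / partial: L2_rel
  morphisms rep_L2 L2_of
proof (rule part_equivpI)
  show "\<exists>f. L2_rel f (f::'a \<Rightarrow> complex)"
    by (rule exI[of _ "\<lambda>_. 0"]) (simp add: L2_rel_def square_integrable_zero)
  show "symp (L2_rel :: ('a \<Rightarrow> complex) \<Rightarrow> _)"
    unfolding L2_rel_def by (rule sympI) (simp add: eq_commute)
  show "transp (L2_rel :: ('a \<Rightarrow> complex) \<Rightarrow> _)"
  proof (rule transpI)
    fix f g h :: "'a \<Rightarrow> complex"
    assume "L2_rel f g" "L2_rel g h"
    then have "square_integrable f" "square_integrable h"
      and "AE x in lborel. f x = g x" "AE x in lborel. g x = h x"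
      by (simp_all add: L2_rel_def)
    moreover from this(3,4) have "AE x in lborel. f x = h x"
      by eventually_elim simp
    ultimately show "L2_rel f h"
      by (simp add: L2_rel_def)
  qed
qed

text \<open>
  The real inner product below is the real part of the usual Hermitian one,
  \<open>\<integral> f \<cdot> cnj g\<close>; both induce the same norm.
\<close>

instantiation L2 :: (euclidean_space) real_inner
begin

lift_definition zero_L2 :: "'a L2" is "\<lambda>_. 0"
  by (simp add: L2_rel_def square_integrable_zero)

lift_definition plus_L2 :: "'a L2 \<Rightarrow> 'a L2 \<Rightarrow> 'a L2" is "\<lambda>f g x. f x + g x"
  by (auto simp: L2_rel_def square_integrable_add)

lift_definition minus_L2 :: "'a L2 \<Rightarrow> 'a L2 \<Rightarrow> 'a L2" is "\<lambda>f g x. f x - g x"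
  by (auto simp: L2_rel_def square_integrable_diff)

lift_definition uminus_L2 :: "'a L2 \<Rightarrow> 'a L2" is "\<lambda>f x. - f x"
  by (auto simp: L2_rel_def square_integrable_uminus)

lift_definition scaleR_L2 :: "real \<Rightarrow> 'a L2 \<Rightarrow> 'a L2" is "\<lambda>r f x. r *\<^sub>R f x"
  by (auto simp: L2_rel_def square_integrable_scaleR simp del: scaleR_scaleR)

lift_definition inner_L2 :: "'a L2 \<Rightarrow> 'a L2 \<Rightarrow> real" is "\<lambda>f g. LINT x|lborel. f x \<bullet> g x"
proof -
  fix f f' g g' :: "'a \<Rightarrow> complex"
  assume *: "L2_rel f f'" "L2_rel g g'"
  then have [measurable]: "f \<in> borel_measurable borel" "f' \<in> borel_measurable borel"
    "g \<in> borel_measurable borel" "g' \<in> borel_measurable borel"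
    by (auto simp: L2_rel_def square_integrable_def)
  from * have "AE x in lborel. f x = f' x" "AE x in lborel. g x = g' x"
    by (auto simp: L2_rel_def)
  then have "AE x in lborel. f x \<bullet> g x = f' x \<bullet> g' x"
    by eventually_elim simp
  then show "(LINT x|lborel. f x \<bullet> g x) = (LINT x|lborel. f' x \<bullet> g' x)"
    by (intro integral_cong_AE) auto
qed

definition norm_L2 :: "'a L2 \<Rightarrow> real"
  where "norm_L2 f = sqrt (f \<bullet> f)"

definition sgn_L2 :: "'a L2 \<Rightarrow> 'a L2"
  where "sgn_L2 f = scaleR (inverse (norm f)) f"

definition dist_L2 :: "'a L2 \<Rightarrow> 'a L2 \<Rightarrow> real"
  where "dist_L2 f g = norm (f - g)"

definition uniformity_L2 :: "('a L2 \<times> 'a L2) filter"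
  where "uniformity_L2 = (INF e\<in>{0 <..}. principal {(x, y). dist x y < e})"

definition open_L2 :: "'a L2 set \<Rightarrow> bool"
  where "open_L2 S = (\<forall>x\<in>S. \<forall>\<^sub>F (x', y) in uniformity. x' = x \<longrightarrow> y \<in> S)"

instance
proof
  fix f g h :: "'a L2" and r s :: real
  show "f + g + h = f + (g + h)"
    by transfer (auto simp: L2_rel_def square_integrable_add algebra_simps)
  show "f + g = g + f"
    by transfer (auto simp: L2_rel_def square_integrable_add algebra_simps)
  show "0 + f = f"
    by transfer (auto simp: L2_rel_def)
  show "- f + f = 0"
    by transfer (auto simp: L2_rel_def square_integrable_zero)
  show "f - g = f + - g"
    by transfer (auto simp: L2_rel_def square_integrable_diff)
  show "r *\<^sub>R (f + g) = r *\<^sub>R f + r *\<^sub>R g"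
    by transfer (auto simp: L2_rel_def square_integrable_add square_integrable_scaleR scaleR_add_right)
  show "(r + s) *\<^sub>R f = r *\<^sub>R f + s *\<^sub>R f"
    by transfer (auto simp: L2_rel_def square_integrable_add square_integrable_scaleR scaleR_add_left)
  show "r *\<^sub>R s *\<^sub>R f = (r * s) *\<^sub>R f"
    by transfer (auto simp: L2_rel_def square_integrable_scaleR)
  show "1 *\<^sub>R f = f"
    by transfer (auto simp: L2_rel_def)
  show "dist f g = norm (f - g)"
    by (rule dist_L2_def)
  show "sgn f = scaleR (inverse (norm f)) f"
    by (rule sgn_L2_def)
  show "(uniformity :: ('a L2 \<times> 'a L2) filter) = (INF e\<in>{0 <..}. principal {(x, y). dist x y < e})"
    by (rule uniformity_L2_def)
  show "open S = (\<forall>x\<in>S. \<forall>\<^sub>F (x', y) in uniformity. x' = x \<longrightarrow> y \<in> S)" for S :: "'a L2 set"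
    by (rule open_L2_def)
  show "f \<bullet> g = g \<bullet> f"
    by transfer (simp add: inner_commute)
  show "(f + g) \<bullet> h = f \<bullet> h + g \<bullet> h"
    by transfer (simp add: L2_rel_def inner_add_left square_integrable_inner)
  show "r *\<^sub>R f \<bullet> g = r * (f \<bullet> g)"
    by transfer (simp add: L2_rel_def square_integrable_inner)
  show "0 \<le> f \<bullet> f"
    by transfer simp
  show "f \<bullet> f = 0 \<longleftrightarrow> f = 0"
    by transfer
      (simp add: L2_rel_def square_integrable_zero square_integrable_inner
        integral_nonneg_eq_0_iff_AE)
  show "norm f = sqrt (f \<bullet> f)"
    by (rule norm_L2_def)
qed

end

lemma norm_L2_of:
  assumes "square_integrable f"
  shows "norm (L2_of f) = sqrt (LINT x|lborel. (norm (f x))\<^sup>2)"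
proof -
  have "L2_rel f f"
    using assms by (simp add: L2_rel_def)
  then show ?thesis
    by (simp add: norm_L2_def inner_L2.abs_eq power2_norm_eq_inner)
qed

lift_definition scaleC_L2 :: "complex \<Rightarrow> 'a::euclidean_space L2 \<Rightarrow> 'a L2" (infixr \<open>*\<^sub>C\<close> 75)
  is "\<lambda>c f x. c * f x"
  by (auto simp: L2_rel_def square_integrable_cmult)


section \<open>Strongly continuous semigroups, generators and cores\<close>

definition C0_semigroup :: "(real \<Rightarrow> 'a::euclidean_space L2 \<Rightarrow> 'a L2) \<Rightarrow> bool"
  where "C0_semigroup T \<longleftrightarrow>
    (\<forall>t\<ge>0. bounded_linear (T t) \<and> (\<forall>c f. T t (c *\<^sub>C f) = c *\<^sub>C T t f)) \<and>
    T 0 = id \<and>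
    (\<forall>s\<ge>0. \<forall>t\<ge>0. T (s + t) = T s \<circ> T t) \<and>
    (\<forall>f. continuous_on {0..} (\<lambda>t. T t f))"

definition generator_domain :: "(real \<Rightarrow> 'a::real_normed_vector \<Rightarrow> 'a) \<Rightarrow> 'a set"
  where "generator_domain T = {f. \<exists>g. ((\<lambda>t. (T t f - f) /\<^sub>R t) \<longlongrightarrow> g) (at_right 0)}"

definition generator :: "(real \<Rightarrow> 'a::real_normed_vector \<Rightarrow> 'a) \<Rightarrow> 'a \<Rightarrow> 'a"
  where "generator T f = Lim (at_right 0) (\<lambda>t. (T t f - f) /\<^sub>R t)"

text \<open>\<open>C\<close> is a core for the operator \<open>A\<close> with domain \<open>D\<close>: a complex linear subspace of \<open>D\<close> that
  is dense in \<open>D\<close> for the graph norm.\<close>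

definition is_core :: "'a::euclidean_space L2 set \<Rightarrow> 'a L2 set \<Rightarrow> ('a L2 \<Rightarrow> 'a L2) \<Rightarrow> bool"
  where "is_core C D A \<longleftrightarrow>
    subspace C \<and> (\<forall>c. \<forall>f\<in>C. c *\<^sub>C f \<in> C) \<and> C \<subseteq> D \<and>
    (\<forall>f\<in>D. \<forall>\<epsilon>>0. \<exists>g\<in>C. norm (f - g) + norm (A f - A g) < \<epsilon>)"


section \<open>Partial derivatives and Schwartz functions\<close>

definition partial_deriv :: "'n::finite \<Rightarrow> (real^'n \<Rightarrow> complex) \<Rightarrow> real^'n \<Rightarrow> complex"
  where "partial_deriv i f x = vector_derivative (\<lambda>s. f (x + s *\<^sub>R axis i 1)) (at 0)"

definition gradient :: "(real^'n \<Rightarrow> complex) \<Rightarrow> real^'n \<Rightarrow> complex^'n::finite"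
  where "gradient f x = (\<chi> i. partial_deriv i f x)"

definition hessian :: "(real^'n \<Rightarrow> complex) \<Rightarrow> real^'n \<Rightarrow> complex^'n^'n::finite"
  where "hessian f x = (\<chi> i j. partial_deriv i (partial_deriv j f) x)"

primrec iterated_partial_deriv ::
  "'n::finite list \<Rightarrow> (real^'n \<Rightarrow> complex) \<Rightarrow> real^'n \<Rightarrow> complex"
where
  "iterated_partial_deriv [] f = f"
| "iterated_partial_deriv (i # is) f = partial_deriv i (iterated_partial_deriv is f)"

text \<open>A function is smooth iff all its iterated partial derivatives exist and are (Frechet)
  differentiable everywhere. A list of indices plays the role of a multi-index.\<close>

definition schwartz :: "(real^'n::finite \<Rightarrow> complex) set"
  where "schwartz = {\<phi>.
    (\<forall>is x. iterated_partial_deriv is \<phi> differentiable (at x)) \<and>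
    (\<forall>is. \<forall>k::nat. bounded (range (\<lambda>x. norm x ^ k *\<^sub>R iterated_partial_deriv is \<phi> x)))}"


section \<open>Matrices and the integral operators\<close>

definition pos_semidefinite :: "real^'n^'n::finite \<Rightarrow> bool"
  where "pos_semidefinite A \<longleftrightarrow> transpose A = A \<and> (\<forall>x. 0 \<le> (A *v x) \<bullet> x)"

definition pos_definite :: "real^'n^'n::finite \<Rightarrow> bool"
  where "pos_definite A \<longleftrightarrow> transpose A = A \<and> (\<forall>x. x \<noteq> 0 \<longrightarrow> 0 < (A *v x) \<bullet> x)"

text \<open>The type of square matrices carries componentwise multiplication, so neither \<open>exp\<close>
  nor \<open>(^)\<close> is the matrix operation.\<close>

definition matrix_power :: "real^'n^'n::finite \<Rightarrow> nat \<Rightarrow> real^'n^'n"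
  where "matrix_power A k = (((**) A) ^^ k) (mat 1)"

definition matrix_exp :: "real^'n^'n::finite \<Rightarrow> real^'n^'n"
  where "matrix_exp A = (\<Sum>k. matrix_power A k /\<^sub>R fact k)"

definition Qt :: "real^'n^'n::finite \<Rightarrow> real^'n^'n \<Rightarrow> real \<Rightarrow> real^'n^'n"
  where "Qt Q B t =
    integral {0..t} (\<lambda>s. matrix_exp (s *\<^sub>R B) ** Q ** matrix_exp (s *\<^sub>R transpose B))"

definition schroedinger_op ::
  "real^'n^'n::finite \<Rightarrow> real^'n^'n \<Rightarrow> real \<Rightarrow> (real^'n \<Rightarrow> complex) \<Rightarrow> real^'n \<Rightarrow> complex"
where
  "schroedinger_op Q B t \<phi> =
    (if t = 0 then \<phi>
     else (\<lambda>x.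
       complex_of_real ((4 * pi) powr (- real CARD('n) / 2)) *
       (exp (- (\<i> * pi * CARD('n) / 4)) / complex_of_real (sqrt (det (Qt Q B t)))) *
       (LINT y|lborel.
          exp (\<i> * complex_of_real
            ((matrix_inv (Qt Q B t) *v (y - matrix_exp (t *\<^sub>R B) *v x)) \<bullet>
              (y - matrix_exp (t *\<^sub>R B) *v x)) / 4) * \<phi> y)))"

definition schroedinger_diff_op ::
  "real^'n^'n::finite \<Rightarrow> real^'n^'n \<Rightarrow> (real^'n \<Rightarrow> complex) \<Rightarrow> real^'n \<Rightarrow> complex"
where
  "schroedinger_diff_op Q B \<phi> x =
    \<i> * trace (map_matrix complex_of_real Q ** hessian \<phi> x) +
    (\<Sum>j\<in>UNIV. complex_of_real ((B *v x) $ j) * gradient \<phi> x $ j)"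

definition extends_to_L2 ::
  "(real \<Rightarrow> (real^'n \<Rightarrow> complex) \<Rightarrow> real^'n \<Rightarrow> complex) \<Rightarrow>
   (real \<Rightarrow> (real^'n::finite) L2 \<Rightarrow> (real^'n) L2) \<Rightarrow> bool"
where
  "extends_to_L2 S T \<longleftrightarrow> (\<forall>t\<ge>0. \<forall>\<phi>\<in>schwartz. T t (L2_of \<phi>) = L2_of (S t \<phi>))"

end

theory Submission
  imports Defs "HOL-Probability.Characteristic_Functions"
begin

text \<open>
  On the Fourier side the kernel disappears.  With
  \<open>\<F>\<phi>(\<xi>) = (2\<pi>)\<^sup>-\<^sup>m\<^sup>/\<^sup>2 \<integral> exp (i \<langle>\<xi>, x\<rangle>) \<phi>(x) dx\<close> the operators of the family are
    \<open>T(t)\<phi> (x) = \<F> (exp (- i \<langle>Q(t)\<xi>, \<xi>\<rangle>) \<F>\<phi>) (- exp(tB) x)\<close>: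
  a Fourier multiplier of modulus one followed by a linear change of variables
  (\<open>schroedinger_op_fourier\<close>).  For a Gaussian with \<open>Re a > 0\<close> in place of the oscillating factor,
  Fubini's theorem and the transform of a Gaussian give an exact identity (\<open>regularised_inversion\<close>).
  The limit \<open>a \<longrightarrow> 0\<close> is Fourier inversion, and the limit \<open>a \<longrightarrow> i\<close> is the kernel with its phase
  \<open>exp (- i \<pi> m / 4)\<close>; the matrix \<open>Q(t)\<close> enters through a factorisation \<open>Q(t) = M\<^sup>T M\<close>, for which
  \<open>\<bar>det M\<bar> = sqrt (det Q(t))\<close>.

  Everything else is read off from this formula.  The transform, multiplication by
  \<open>exp (- i \<langle>P\<xi>, \<xi>\<rangle>)\<close> and invertible linear substitutions preserve the Schwartz space.  By
  Plancherel's theorem \<open>T(t)\<close> multiplies the norm by \<open>\<bar>det exp(tB)\<bar>\<close> to the power \<open>-1/2\<close>, which is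
  bounded on compact time intervals.  The identity \<open>Q(t+s) = Q(t) + exp(tB) Q(s) exp(tB)\<^sup>T\<close> makes
  the phases add up, so that \<open>T(s) T(t) = T(s+t)\<close> (\<open>schroedinger_op_semigroup\<close>).  Since the
  Schwartz functions are dense in a complete space (\<open>schwartz_dense_L2\<close>), each \<open>T(t)\<close> has exactly one
  bounded extension, and the extensions inherit linearity, the norm bound and the semigroup law.

  The difference quotient at time zero splits into a multiplier part and a transport part
  (\<open>difference_quotient_eq\<close>).  As \<open>Q(t)/t \<longrightarrow> Q\<close>, dominated convergence on the Fourier side shows
  that the first tends to \<open>i tr(Q \<nabla>\<^sup>2\<phi>)\<close>; dominated convergence along the flow \<open>exp(tB) x\<close> shows that
  the second tends to \<open>\<langle>Bx, \<nabla>\<phi>\<rangle>\<close>.  In particular \<open>T(t)\<phi> \<longrightarrow> \<phi>\<close>, which together with local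
  boundedness yields strong continuity (\<open>semigroup_strongly_continuous\<close>).

  Finally, the Schwartz functions form a dense subspace of the domain of the generator that the
  semigroup maps into itself, and every such subspace is a core: time averages of orbits are limits
  of Riemann sums in the graph norm (\<open>invariant_dense_subspace_is_core\<close>).
\<close>

section \<open>The space of square-integrable functions\<close>

lemma L2_rel_refl [simp]: "L2_rel f f \<longleftrightarrow> square_integrable f"
  by (simp add: L2_rel_def)

lemma L2_of_cases:
  obtains f where "square_integrable f" "F = L2_of f"
proof -
  have "L2_rel (rep_L2 F) (rep_L2 F)" and "L2_of (rep_L2 F) = F"
    using Quotient3_L2 by (auto simp: Quotient3_def)
  then show thesis
    by (metis L2_rel_refl that)
qed

lemma L2_of_add: "square_integrable f \<Longrightarrow> square_integrable g \<Longrightarrow> L2_of f + L2_of g = L2_of (\<lambda>x. f x + g x)"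
  by (simp add: plus_L2.abs_eq)

lemma L2_of_diff: "square_integrable f \<Longrightarrow> square_integrable g \<Longrightarrow> L2_of f - L2_of g = L2_of (\<lambda>x. f x - g x)"
  by (simp add: minus_L2.abs_eq)

lemma L2_of_scaleC: "square_integrable f \<Longrightarrow> c *\<^sub>C L2_of f = L2_of (\<lambda>x. c * f x)"
  by (simp add: scaleC_L2.abs_eq)

lemma L2_of_scaleR: "square_integrable f \<Longrightarrow> r *\<^sub>R L2_of f = L2_of (\<lambda>x. r *\<^sub>R f x)"
  by (simp add: scaleR_L2.abs_eq)

lemma scaleR_eq_scaleC_L2: "r *\<^sub>R F = complex_of_real r *\<^sub>C (F :: 'a::euclidean_space L2)"
  by (rule L2_of_cases[of F]) (simp add: L2_of_scaleR L2_of_scaleC scaleR_conv_of_real)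

lemma scaleC_diff_L2: "c *\<^sub>C (F - G) = c *\<^sub>C F - c *\<^sub>C (G :: 'a::euclidean_space L2)"
  by (rule L2_of_cases[of F], rule L2_of_cases[of G])
    (simp add: L2_of_diff L2_of_scaleC square_integrable_diff square_integrable_cmult algebra_simps)

lemma norm_scaleC_L2: "norm (c *\<^sub>C F) = cmod c * norm (F :: 'a::euclidean_space L2)"
proof (rule L2_of_cases[of F])
  fix f :: "'a \<Rightarrow> complex" assume f: "square_integrable f" "F = L2_of f"
  have "(LINT x|lborel. (norm (c * f x))\<^sup>2) = (cmod c)\<^sup>2 * (LINT x|lborel. (norm (f x))\<^sup>2)"
    by (simp add: norm_mult power_mult_distrib)
  then show ?thesis
    using f by (simp add: L2_of_scaleC norm_L2_of square_integrable_cmult real_sqrt_mult)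
qed

lemma tendsto_scaleC_L2:
  fixes X :: "'b \<Rightarrow> 'a::euclidean_space L2"
  assumes "(X \<longlongrightarrow> F) A"
  shows "((\<lambda>n. c *\<^sub>C X n) \<longlongrightarrow> c *\<^sub>C F) A"
proof -
  have "((\<lambda>n. cmod c * norm (X n - F)) \<longlongrightarrow> cmod c * 0) A"
    by (intro tendsto_intros) (use assms in \<open>simp add: LIM_zero tendsto_norm_zero\<close>)
  then show ?thesis
    by (simp add: tendsto_iff dist_norm scaleC_diff_L2[symmetric] norm_scaleC_L2)
qed

text \<open>If \<open>w\<close> dominates all \<open>\<bar>f n\<bar>\<close>, then it dominates the limit, and \<open>4 w\<^sup>2\<close> is an integrable majorant of
  \<open>\<bar>f n - g\<bar>\<^sup>2\<close>.\<close>

lemma L2_dominated_convergence: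
  fixes f :: "nat \<Rightarrow> 'a::euclidean_space \<Rightarrow> complex"
  assumes [measurable]: "\<And>n. f n \<in> borel_measurable borel" "g \<in> borel_measurable borel"
    and w: "integrable lborel (\<lambda>x. (w x)\<^sup>2)"
    and lim: "AE x in lborel. (\<lambda>n. f n x) \<longlonglongrightarrow> g x"
    and bound: "\<And>n. AE x in lborel. norm (f n x) \<le> w x"
  shows "\<And>n. square_integrable (f n)" "square_integrable g" "(\<lambda>n. L2_of (f n)) \<longlonglongrightarrow> L2_of g"
proof -
  show sf: "square_integrable (f n)" for n
    unfolding square_integrable_def
  proof (intro conjI)
    show "integrable lborel (\<lambda>x. (norm (f n x))\<^sup>2)"
      by (rule Bochner_Integration.integrable_bound[OF w])
        (use bound[of n] in \<open>auto elim!: eventually_mono intro!: power_mono\<close>)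
  qed simp
  have AEb: "AE x in lborel. \<forall>n. norm (f n x) \<le> w x"
    using bound by (simp add: AE_all_countable)
  have gb: "AE x in lborel. norm (g x) \<le> w x"
    using AEb lim
    by eventually_elim (rule Lim_bounded[OF tendsto_norm], auto)
  show sg: "square_integrable g"
    unfolding square_integrable_def
  proof (intro conjI)
    show "integrable lborel (\<lambda>x. (norm (g x))\<^sup>2)"
      by (rule Bochner_Integration.integrable_bound[OF w])
        (use gb in \<open>auto elim!: eventually_mono intro!: power_mono\<close>)
  qed simp
  have "(\<lambda>n. LINT x|lborel. (norm (f n x - g x))\<^sup>2) \<longlonglongrightarrow> (LINT x|(lborel :: 'a measure). (0::real))"
  proof (rule integral_dominated_convergence[where w="\<lambda>x. 4 * (w x)\<^sup>2"])
    show "AE x in lborel. (\<lambda>n. (norm (f n x - g x))\<^sup>2) \<longlonglongrightarrow> 0"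
      using lim
    proof eventually_elim
      case (elim x)
      then have "(\<lambda>n. (norm (f n x - g x))\<^sup>2) \<longlonglongrightarrow> 0\<^sup>2"
        by (intro tendsto_power tendsto_norm_zero LIM_zero)
      then show ?case by simp
    qed
    show "AE x in lborel. norm ((norm (f n x - g x))\<^sup>2) \<le> 4 * (w x)\<^sup>2" for n
      using AEb gb
    proof eventually_elim
      case (elim x)
      have "norm (f n x - g x) \<le> 2 * w x"
        using elim norm_triangle_ineq4[of "f n x" "g x"] by (smt (verit))
      then have "(norm (f n x - g x))\<^sup>2 \<le> (2 * w x)\<^sup>2"
        by (intro power_mono) auto
      then show ?case by (simp add: power_mult_distrib)
    qed
  qed (use w in auto)
  then have "(\<lambda>n. sqrt (LINT x|lborel. (norm (f n x - g x))\<^sup>2)) \<longlonglongrightarrow> sqrt 0"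
    by (intro tendsto_real_sqrt) simp
  then have "(\<lambda>n. norm (L2_of (f n) - L2_of g)) \<longlonglongrightarrow> 0"
    using sf sg by (simp add: L2_of_diff norm_L2_of square_integrable_diff)
  then show "(\<lambda>n. L2_of (f n)) \<longlonglongrightarrow> L2_of g"
    by (simp add: tendsto_norm_zero_iff LIM_zero_iff)
qed

text \<open>Riesz and Fischer: along a subsequence with successive distances at most \<open>4\<^sup>-\<^sup>k\<close> the sum of
  \<open>4\<^sup>k \<bar>d k\<bar>\<^sup>2\<close> is integrable, where \<open>d k\<close> denotes the successive differences.  It is therefore finite
  almost everywhere, which forces \<open>\<bar>d k\<bar> = O(2\<^sup>-\<^sup>k)\<close> pointwise, so that the subsequence converges
  almost everywhere.\<close>

instance L2 :: (euclidean_space) banach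
proof
  fix X :: "nat \<Rightarrow> 'a L2" assume X: "Cauchy X"
  have "\<exists>f. square_integrable f \<and> X n = L2_of f" for n
    by (metis L2_of_cases)
  then obtain f where f: "\<And>n. square_integrable (f n)" and Xf: "\<And>n. X n = L2_of (f n)"
    by metis
  have [measurable]: "f n \<in> borel_measurable borel" for n
    using f by (simp add: square_integrable_def)
  have "\<forall>k. \<exists>N. \<forall>m\<ge>N. \<forall>n\<ge>N. norm (X m - X n) < (1 / 2) ^ (2 * k)"
    using X by (auto simp: Cauchy_def dist_norm)
  then obtain N where N: "\<And>k m n. m \<ge> N k \<Longrightarrow> n \<ge> N k \<Longrightarrow> norm (X m - X n) < (1 / 2) ^ (2 * k)"
    by metis
  define r where "r = rec_nat (N 0) (\<lambda>k p. max (Suc p) (N (Suc k)))"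
  have r_Suc: "r (Suc k) = max (Suc (r k)) (N (Suc k))" for k
    by (simp add: r_def)
  have "strict_mono r"
    unfolding strict_mono_Suc_iff r_Suc by auto
  have rN: "r k \<ge> N k" for k
    by (cases k) (simp_all add: r_Suc, simp add: r_def)
  have sq: "integrable lborel (\<lambda>x. (norm (f i x - f j x))\<^sup>2)" for i j
    using square_integrable_diff[OF f f] by (simp add: square_integrable_def)
  have normX: "(norm (X i - X j))\<^sup>2 = (LINT x|lborel. (norm (f i x - f j x))\<^sup>2)" for i j
    by (simp add: Xf L2_of_diff f norm_L2_of square_integrable_diff)
  define d where "d k x = f (r (Suc k)) x - f (r k) x" for k x
  have [measurable]: "d k \<in> borel_measurable borel" for k
    unfolding d_def[abs_def] by measurable
  have dk: "(\<integral>\<^sup>+x. ennreal (4 ^ k * (norm (d k x))\<^sup>2) \<partial>lborel) \<le> ennreal ((1 / 2) ^ k)" for k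
  proof -
    have "norm (X (r (Suc k)) - X (r k)) < (1 / 2) ^ (2 * k)"
      using N[of k "r (Suc k)" "r k"] rN[of k] by (simp add: r_Suc)
    then have "(norm (X (r (Suc k)) - X (r k)))\<^sup>2 \<le> ((1 / 2) ^ (2 * k))\<^sup>2"
      by (intro power_mono) auto
    then have "4 ^ k * (norm (X (r (Suc k)) - X (r k)))\<^sup>2 \<le> 4 ^ k * ((1 / 2) ^ (2 * k))\<^sup>2"
      by simp
    also have "\<dots> = (1 / 4) ^ k"
    proof -
      have "(1 / 2 :: real) ^ (2 * k) = (1 / 4) ^ k"
        by (simp add: power_mult power2_eq_square)
      then have "4 ^ k * ((1 / 2 :: real) ^ (2 * k))\<^sup>2 = (4 * (1 / 4)) ^ k * (1 / 4) ^ k"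
        by (simp add: power2_eq_square power_divide)
      then show ?thesis by simp
    qed
    also have "\<dots> \<le> (1 / 2) ^ k"
      by (intro power_mono) auto
    finally have *: "4 ^ k * (norm (X (r (Suc k)) - X (r k)))\<^sup>2 \<le> (1 / 2) ^ k" .
    have "(\<integral>\<^sup>+x. ennreal (4 ^ k * (norm (d k x))\<^sup>2) \<partial>lborel) = ennreal (LINT x|lborel. 4 ^ k * (norm (d k x))\<^sup>2)"
      unfolding d_def by (rule nn_integral_eq_integral) (auto intro!: sq)
    also have "\<dots> = ennreal (4 ^ k * (norm (X (r (Suc k)) - X (r k)))\<^sup>2)"
      by (simp add: normX d_def)
    finally show ?thesis
      using * by (simp add: ennreal_leI)
  qed
  have "(\<integral>\<^sup>+x. (\<Sum>k. ennreal (4 ^ k * (norm (d k x))\<^sup>2)) \<partial>lborel)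
      = (\<Sum>k. \<integral>\<^sup>+x. ennreal (4 ^ k * (norm (d k x))\<^sup>2) \<partial>lborel)"
    by (rule nn_integral_suminf) simp
  also have "\<dots> \<le> (\<Sum>k. ennreal ((1 / 2) ^ k))"
    by (intro suminf_le dk) auto
  also have "\<dots> < \<infinity>"
    by (subst suminf_ennreal2) (auto simp: summable_geometric)
  finally have "AE x in lborel. (\<Sum>k. ennreal (4 ^ k * (norm (d k x))\<^sup>2)) \<noteq> \<infinity>"
    by (intro nn_integral_PInf_AE) auto
  then have AEs: "AE x in lborel. convergent (\<lambda>k. f (r k) x)"
  proof eventually_elim
    case (elim x)
    then have "summable (\<lambda>k. 4 ^ k * (norm (d k x))\<^sup>2)"
      by (intro summable_suminf_not_top) (auto simp: top_unique)
    then have "Bseq (\<lambda>k. 4 ^ k * (norm (d k x))\<^sup>2)"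
      using summable_LIMSEQ_zero convergentI convergent_imp_Bseq by blast
    then obtain C where C: "\<And>k. norm (4 ^ k * (norm (d k x))\<^sup>2) \<le> C" "C > 0"
      by (rule BseqE) blast
    have "norm (d k x) \<le> sqrt C * (1 / 2) ^ k" for k
    proof (rule power2_le_imp_le)
      have "(norm (d k x))\<^sup>2 \<le> C / 4 ^ k"
        using C(1)[of k] by (simp add: field_simps norm_mult norm_power)
      also have "\<dots> = (sqrt C * (1 / 2) ^ k)\<^sup>2"
        using C(2) by (simp add: power_mult_distrib power_divide power2_eq_square flip: power_mult_distrib)
      finally show "(norm (d k x))\<^sup>2 \<le> (sqrt C * (1 / 2) ^ k)\<^sup>2" .
    qed (use C(2) in auto)
    moreover have "summable (\<lambda>k. sqrt C * (1 / 2 :: real) ^ k)"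
      by (intro summable_mult summable_geometric) auto
    ultimately have "summable (\<lambda>k. d k x)"
      using summable_comparison_test'[of "\<lambda>k. sqrt C * (1 / 2) ^ k" 0 "\<lambda>k. d k x"] by blast
    then have "convergent (\<lambda>n. \<Sum>k<n. d k x)"
      by (simp add: summable_iff_convergent)
    then have "convergent (\<lambda>n. f (r n) x - f (r 0) x)"
      unfolding d_def by (subst (asm) sum_lessThan_telescope)
    then show ?case
      using convergent_add[OF _ convergent_const[of "f (r 0) x"]] by force
  qed
  define g where "g x = lim (\<lambda>k. f (r k) x)" for x
  have [measurable]: "g \<in> borel_measurable borel"
    unfolding g_def[abs_def] by measurable
  have AEg: "AE x in lborel. (\<lambda>k. f (r k) x) \<longlonglongrightarrow> g x"
    using AEs by eventually_elim (simp add: g_def convergent_LIMSEQ_iff)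
  \<comment> \<open>Fatou's lemma turns the almost everywhere limit into a limit in mean square.\<close>
  have fatou: "(\<integral>\<^sup>+x. ennreal ((norm (f (r k) x - g x))\<^sup>2) \<partial>lborel) \<le> ennreal (((1 / 2) ^ (2 * k))\<^sup>2)" for k
  proof -
    have "(\<integral>\<^sup>+x. ennreal ((norm (f (r k) x - g x))\<^sup>2) \<partial>lborel)
        = (\<integral>\<^sup>+x. liminf (\<lambda>j. ennreal ((norm (f (r k) x - f (r j) x))\<^sup>2)) \<partial>lborel)"
    proof (rule nn_integral_cong_AE)
      show "AE x in lborel. ennreal ((norm (f (r k) x - g x))\<^sup>2)
          = liminf (\<lambda>j. ennreal ((norm (f (r k) x - f (r j) x))\<^sup>2))"
        using AEg
      proof eventually_elim
        case (elim x)
        then have "(\<lambda>j. ennreal ((norm (f (r k) x - f (r j) x))\<^sup>2)) \<longlonglongrightarrow> ennreal ((norm (f (r k) x - g x))\<^sup>2)"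
          by (intro tendsto_intros)
        then show ?case
          using lim_imp_Liminf trivial_limit_sequentially by metis
      qed
    qed
    also have "\<dots> \<le> liminf (\<lambda>j. \<integral>\<^sup>+x. ennreal ((norm (f (r k) x - f (r j) x))\<^sup>2) \<partial>lborel)"
      by (rule nn_integral_liminf) simp
    also have "\<dots> \<le> limsup (\<lambda>j. \<integral>\<^sup>+x. ennreal ((norm (f (r k) x - f (r j) x))\<^sup>2) \<partial>lborel)"
      by (rule Liminf_le_Limsup) simp
    also have "\<dots> \<le> ennreal (((1 / 2) ^ (2 * k))\<^sup>2)"
    proof (rule Limsup_bounded, rule eventually_sequentiallyI)
      fix j assume "j \<ge> k"
      then have "r j \<ge> r k"
        using \<open>strict_mono r\<close> by (simp add: strict_mono_less_eq)
      then have "norm (X (r k) - X (r j)) \<le> (1 / 2) ^ (2 * k)"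
        using N[of k "r k" "r j"] rN[of k] by linarith
      then have "(norm (X (r k) - X (r j)))\<^sup>2 \<le> ((1 / 2) ^ (2 * k))\<^sup>2"
        by (intro power_mono) auto
      moreover have "(\<integral>\<^sup>+x. ennreal ((norm (f (r k) x - f (r j) x))\<^sup>2) \<partial>lborel)
          = ennreal ((norm (X (r k) - X (r j)))\<^sup>2)"
        unfolding normX by (rule nn_integral_eq_integral) (auto intro!: sq)
      ultimately show "(\<integral>\<^sup>+x. ennreal ((norm (f (r k) x - f (r j) x))\<^sup>2) \<partial>lborel) \<le> ennreal (((1 / 2) ^ (2 * k))\<^sup>2)"
        by (simp add: ennreal_leI)
    qed
    finally show ?thesis .
  qed
  have sq_fg: "square_integrable (\<lambda>x. f (r k) x - g x)" for k
    unfolding square_integrable_def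
    using le_less_trans[OF fatou[of k], of \<infinity>] by (auto intro!: integrableI_bounded)
  have "square_integrable g"
    using square_integrable_diff[OF f[of "r 0"] sq_fg[of 0]] by simp
  have le: "norm (X (r k) - L2_of g) \<le> (1 / 2) ^ (2 * k)" for k
  proof (rule power2_le_imp_le)
    have "ennreal ((norm (X (r k) - L2_of g))\<^sup>2) = (\<integral>\<^sup>+x. ennreal ((norm (f (r k) x - g x))\<^sup>2) \<partial>lborel)"
      using sq_fg[of k] \<open>square_integrable g\<close> f
      by (subst nn_integral_eq_integral) (auto simp: Xf L2_of_diff norm_L2_of square_integrable_def)
    with fatou[of k] have "ennreal ((norm (X (r k) - L2_of g))\<^sup>2) \<le> ennreal (((1 / 2) ^ (2 * k))\<^sup>2)"
      by (simp only:)
    then show "(norm (X (r k) - L2_of g))\<^sup>2 \<le> ((1 / 2) ^ (2 * k))\<^sup>2"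
      by (subst (asm) ennreal_le_iff) auto
  qed simp
  have "(\<lambda>k. (1 / 4 :: real) ^ k) \<longlonglongrightarrow> 0"
    by (rule LIMSEQ_power_zero) simp
  then have "(\<lambda>k. X (r k) - L2_of g) \<longlonglongrightarrow> 0"
    by (rule Lim_null_comparison[rotated])
      (use le in \<open>simp add: power_mult power2_eq_square\<close>)
  then have "(X \<circ> r) \<longlonglongrightarrow> L2_of g"
    by (simp add: LIM_zero_iff o_def)
  then have "X \<longlonglongrightarrow> L2_of g"
    using X \<open>strict_mono r\<close> Cauchy_converges_subseq by blast
  then show "convergent X"
    by (rule convergentI)
qed

section \<open>Linear changes of variables\<close>

lemma lborel_distr_shift: "distr lborel borel (\<lambda>x. x + a) = (lborel :: 'a::euclidean_space measure)"
proof -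
  have "(\<lambda>x. x + a) = (+) a" by (auto simp: add.commute)
  then show ?thesis by (simp add: lborel_distr_plus)
qed

lemma nn_integral_lborel_shift:
  fixes a :: "'a::euclidean_space"
  assumes "h \<in> borel_measurable borel"
  shows "(\<integral>\<^sup>+x. h (x + a) \<partial>lborel) = (\<integral>\<^sup>+x. h x \<partial>lborel)"
proof -
  have "(\<integral>\<^sup>+x. h x \<partial>lborel) = (\<integral>\<^sup>+x. h x \<partial>distr lborel borel (\<lambda>x. x + a))"
    by (simp only: lborel_distr_shift)
  also have "\<dots> = (\<integral>\<^sup>+x. h (x + a) \<partial>lborel)"
    by (rule nn_integral_distr) (use assms in auto)
  finally show ?thesis by simp
qed

text \<open>Comparing both sides of Fubini's theorem for the product with Lebesgue measure shows that a
  translation invariant measure is determined by the mass that it gives to one box.\<close>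

lemma nn_integral_translation_invariant:
  fixes \<mu> :: "'a::euclidean_space measure" and f :: "'a \<Rightarrow> ennreal"
  assumes "sigma_finite_measure \<mu>" and sets_mu: "sets \<mu> = sets borel"
    and inv: "\<And>g a. g \<in> borel_measurable borel \<Longrightarrow> (\<integral>\<^sup>+x. g (x + a) \<partial>\<mu>) = (\<integral>\<^sup>+x. g x \<partial>\<mu>)"
    and f: "f \<in> borel_measurable borel"
  shows "(\<integral>\<^sup>+x. f x \<partial>\<mu>) = (\<integral>\<^sup>+x. indicator (box 0 One) (- x) \<partial>\<mu>) * (\<integral>\<^sup>+x. f x \<partial>lborel)"
proof -
  interpret mu: sigma_finite_measure \<mu> by fact
  interpret P: pair_sigma_finite \<mu> "lborel :: 'a measure" ..
  interpret P': pair_sigma_finite "lborel :: 'a measure" \<mu> ..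
  have [measurable_cong]: "sets \<mu> = sets borel" by fact
  have [measurable]: "f \<in> borel_measurable borel" by fact
  let ?g = "indicator (box 0 (One::'a)) :: 'a \<Rightarrow> ennreal"
  have linv: "(\<integral>\<^sup>+x. h (x + a) \<partial>lborel) = (\<integral>\<^sup>+x. h x \<partial>lborel)" if "h \<in> borel_measurable borel" for h :: "'a \<Rightarrow> ennreal" and a
    using that by (rule nn_integral_lborel_shift)
  have "(\<integral>\<^sup>+x. f x \<partial>\<mu>) = (\<integral>\<^sup>+y. ?g y \<partial>lborel) * (\<integral>\<^sup>+x. f x \<partial>\<mu>)"
    by simp
  also have "\<dots> = (\<integral>\<^sup>+y. ?g y * (\<integral>\<^sup>+x. f (x + y) \<partial>\<mu>) \<partial>lborel)"
    by (simp add: inv nn_integral_multc)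
  also have "\<dots> = (\<integral>\<^sup>+y. (\<integral>\<^sup>+x. ?g y * f (x + y) \<partial>\<mu>) \<partial>lborel)"
    by (simp add: nn_integral_cmult)
  also have "\<dots> = (\<integral>\<^sup>+x. (\<integral>\<^sup>+y. ?g y * f (x + y) \<partial>lborel) \<partial>\<mu>)"
    by (rule P.Fubini') measurable
  also have "\<dots> = (\<integral>\<^sup>+x. (\<integral>\<^sup>+y. ?g (y - x) * f y \<partial>lborel) \<partial>\<mu>)"
  proof (rule nn_integral_cong)
    fix x
    show "(\<integral>\<^sup>+y. ?g y * f (x + y) \<partial>lborel) = (\<integral>\<^sup>+y. ?g (y - x) * f y \<partial>lborel)"
      using linv[of "\<lambda>y. ?g (y - x) * f y" x] by (simp add: add.commute)
  qed
  also have "\<dots> = (\<integral>\<^sup>+y. (\<integral>\<^sup>+x. ?g (y - x) * f y \<partial>\<mu>) \<partial>lborel)"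
    by (rule P'.Fubini') measurable
  also have "\<dots> = (\<integral>\<^sup>+y. (\<integral>\<^sup>+x. ?g (- x) \<partial>\<mu>) * f y \<partial>lborel)"
  proof (rule nn_integral_cong)
    fix y
    have "(\<integral>\<^sup>+x. ?g (y - x) * f y \<partial>\<mu>) = (\<integral>\<^sup>+x. ?g (y - x) \<partial>\<mu>) * f y"
      by (simp add: nn_integral_multc)
    also have "(\<integral>\<^sup>+x. ?g (y - x) \<partial>\<mu>) = (\<integral>\<^sup>+x. ?g (- x) \<partial>\<mu>)"
      using inv[of "\<lambda>x. ?g (- x)" "- y"] by simp
    finally show "(\<integral>\<^sup>+x. ?g (y - x) * f y \<partial>\<mu>) = (\<integral>\<^sup>+x. ?g (- x) \<partial>\<mu>) * f y" .
  qed
  also have "\<dots> = (\<integral>\<^sup>+x. ?g (- x) \<partial>\<mu>) * (\<integral>\<^sup>+x. f x \<partial>lborel)"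
    by (simp add: nn_integral_cmult)
  finally show ?thesis .
qed

lemma continuous_on_matrix_vector_mult: "continuous_on X ((*v) A)" for A :: "real^'n^'m"
  by (intro linear_continuous_on matrix_vector_mul_bounded_linear)

lemma measurable_matrix_vector_mult [measurable]: "(*v) A \<in> borel \<rightarrow>\<^sub>M borel" for A :: "real^'n^'m"
  by (intro borel_measurable_continuous_onI continuous_on_matrix_vector_mult)

text \<open>The image of Lebesgue measure under an invertible matrix is translation invariant and finite on
  compact sets, hence a multiple of Lebesgue measure.  Invariance holds because a translation by \<open>a\<close> of
  the image comes from the translation by the preimage of \<open>a\<close>.\<close>

lemma nn_integral_invertible_matrix:
  fixes A :: "real^'n^'n"
  assumes "invertible A"
  shows "\<exists>c>0. \<forall>f\<in>borel_measurable borel. (\<integral>\<^sup>+x. f (A *v x) \<partial>lborel) = ennreal c * (\<integral>\<^sup>+x. f x \<partial>lborel)"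
proof -
  obtain A' where A': "A ** A' = mat 1" "A' ** A = mat 1"
    using assms by (auto simp: invertible_def)
  have scale: "\<exists>c. c \<noteq> \<infinity> \<and> (\<forall>f :: real^'n \<Rightarrow> ennreal. f \<in> borel_measurable borel \<longrightarrow> (\<integral>\<^sup>+x. f (M *v x) \<partial>lborel) = c * (\<integral>\<^sup>+x. f x \<partial>lborel))"
    if M: "M ** M' = mat 1" "M' ** M = mat 1" for M M' :: "real^'n^'n"
  proof -
    have [simp]: "M' *v (M *v x) = x" "M *v (M' *v x) = x" for x
      using M by (simp_all add: matrix_vector_mul_assoc)
    let ?\<mu> = "distr lborel borel ((*v) M)"
    have sf: "sigma_finite_measure ?\<mu>"
    proof (rule sigma_finite_measure.intro, intro exI conjI ballI)
      let ?C = "range (\<lambda>k::nat. cball (0::real^'n) k)"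
      show "countable ?C" "?C \<subseteq> sets ?\<mu>" "\<Union> ?C = space ?\<mu>"
        using real_arch_simple by (auto simp: mem_cball_0)
      fix a assume "a \<in> ?C"
      then obtain k :: nat where a: "a = cball 0 k" by auto
      have "(*v) M -` cball 0 (real k) = (*v) M' ` cball 0 (real k)"
        by (force simp: image_iff)
      moreover have "compact ((*v) M' ` cball 0 (real k))"
        by (intro compact_continuous_image continuous_on_matrix_vector_mult) auto
      ultimately show "emeasure ?\<mu> a \<noteq> \<infinity>"
        using emeasure_compact_finite[of "(*v) M' ` cball 0 (real k)"] by (auto simp: a emeasure_distr)
    qed
    define c where "c = (\<integral>\<^sup>+x. indicator (box 0 (One::real^'n)) (- x) \<partial>?\<mu>)"
    have "c = emeasure lborel {x. - (M *v x) \<in> box 0 (One::real^'n)}"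
      unfolding c_def by (subst nn_integral_distr) (simp_all add: nn_integral_indicator[symmetric] indicator_def)
    also have "{x. - (M *v x) \<in> box 0 (One::real^'n)} \<subseteq> (*v) M' ` (uminus ` cbox 0 One)"
    proof
      fix x assume "x \<in> {x. - (M *v x) \<in> box 0 (One::real^'n)}"
      then have "- (M *v x) \<in> cbox 0 One" using box_subset_cbox by blast
      then show "x \<in> (*v) M' ` (uminus ` cbox 0 One)"
        by (intro image_eqI[of _ _ "M *v x"] image_eqI[of _ _ "- (M *v x)"]) auto
    qed
    then have "emeasure lborel {x. - (M *v x) \<in> box 0 (One::real^'n)} \<le> emeasure lborel ((*v) M' ` (uminus ` cbox 0 (One::real^'n)))"
      by (intro emeasure_mono) (auto intro!: borel_compact compact_continuous_image continuous_on_matrix_vector_mult continuous_intros)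
    also have "\<dots> < \<infinity>"
      by (intro emeasure_compact_finite) (auto intro!: compact_continuous_image continuous_on_matrix_vector_mult continuous_intros)
    finally have "c \<noteq> \<infinity>" by simp
    moreover have "(\<integral>\<^sup>+x. f (M *v x) \<partial>lborel) = c * (\<integral>\<^sup>+x. f x \<partial>lborel)" if [measurable]: "f \<in> borel_measurable borel" for f :: "real^'n \<Rightarrow> ennreal"
    proof -
      have "(\<integral>\<^sup>+x. f x \<partial>?\<mu>) = c * (\<integral>\<^sup>+x. f x \<partial>lborel)"
        unfolding c_def
      proof (rule nn_integral_translation_invariant[OF sf])
        fix g :: "real^'n \<Rightarrow> ennreal" and a assume [measurable]: "g \<in> borel_measurable borel"
        have "(\<integral>\<^sup>+x. g (M *v (x + M' *v a)) \<partial>lborel) = (\<integral>\<^sup>+x. g (M *v x) \<partial>lborel)"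
          by (rule nn_integral_lborel_shift[of "\<lambda>x. g (M *v x)"]) measurable
        then show "(\<integral>\<^sup>+x. g (x + a) \<partial>?\<mu>) = (\<integral>\<^sup>+x. g x \<partial>?\<mu>)"
          by (simp add: nn_integral_distr matrix_vector_right_distrib)
      qed simp_all
      then show ?thesis by (simp add: nn_integral_distr)
    qed
    ultimately show ?thesis by blast
  qed
  obtain c where c: "c \<noteq> \<infinity>" "\<And>f :: real^'n \<Rightarrow> ennreal. f \<in> borel_measurable borel \<Longrightarrow> (\<integral>\<^sup>+x. f (A *v x) \<partial>lborel) = c * (\<integral>\<^sup>+x. f x \<partial>lborel)"
    using scale[OF A'] by blast
  have "c \<noteq> 0"
  proof
    assume "c = 0"
    then have "(\<integral>\<^sup>+x. 1 \<partial>(lborel :: (real^'n) measure)) = 0"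
      using c(2)[of "\<lambda>_. 1"] by simp
    then show False by simp
  qed
  then show ?thesis
    using c by (intro exI[of _ "enn2real c"]) (auto simp: enn2real_positive_iff less_top zero_less_iff_neq_zero)
qed

text \<open>The scaling factor of a permutation or shear matrix is found without computing any volume:
  a swap is its own inverse, and a shear is conjugate to its inverse by a diagonal matrix.
  Elementary matrices of these kinds and diagonal matrices generate all matrices.\<close>

lemma nn_integral_linear:
  fixes A :: "real^'n^'n" and f :: "real^'n \<Rightarrow> ennreal"
  assumes "det A \<noteq> 0" "f \<in> borel_measurable borel"
  shows "ennreal \<bar>det A\<bar> * (\<integral>\<^sup>+x. f (A *v x) \<partial>lborel) = (\<integral>\<^sup>+x. f x \<partial>lborel)"
proof -
  define P where "P A \<longleftrightarrow> (det A \<noteq> 0 \<longrightarrow> (\<forall>f \<in> borel_measurable borel.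
      ennreal \<bar>det A\<bar> * (\<integral>\<^sup>+x. f (A *v x) \<partial>lborel) = (\<integral>\<^sup>+x. f x \<partial>lborel)))" for A :: "real^'n^'n"
  have mult: "P (A ** B)" if "P A" "P B" for A B
    unfolding P_def
  proof (intro impI ballI)
    fix f :: "real^'n \<Rightarrow> ennreal"
    assume det: "det (A ** B) \<noteq> 0" and [measurable]: "f \<in> borel_measurable borel"
    have "ennreal \<bar>det (A ** B)\<bar> * (\<integral>\<^sup>+x. f ((A ** B) *v x) \<partial>lborel)
        = ennreal \<bar>det A\<bar> * (ennreal \<bar>det B\<bar> * (\<integral>\<^sup>+x. f (A *v (B *v x)) \<partial>lborel))"
      by (simp add: det_mul abs_mult ennreal_mult matrix_vector_mul_assoc mult.assoc)
    also have "ennreal \<bar>det B\<bar> * (\<integral>\<^sup>+x. f (A *v (B *v x)) \<partial>lborel) = (\<integral>\<^sup>+x. f (A *v x) \<partial>lborel)"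
      using that(2) det unfolding P_def det_mul by (intro bspec[where P="\<lambda>f. _ * (\<integral>\<^sup>+x. f (B *v x) \<partial>lborel) = (\<integral>\<^sup>+x. f x \<partial>lborel)"]) auto
    finally show "ennreal \<bar>det (A ** B)\<bar> * (\<integral>\<^sup>+x. f ((A ** B) *v x) \<partial>lborel) = (\<integral>\<^sup>+x. f x \<partial>lborel)"
      using that(1) det by (auto simp: P_def det_mul)
  qed
  have diagonal: "P A" if A: "\<And>i j. i \<noteq> j \<Longrightarrow> A$i$j = 0" for A
    unfolding P_def
  proof (intro impI ballI)
    fix f :: "real^'n \<Rightarrow> ennreal"
    assume det: "det A \<noteq> 0" and [measurable]: "f \<in> borel_measurable borel"
    have detA: "det A = (\<Prod>i\<in>UNIV. A$i$i)"
      using A by (rule det_diagonal)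
    define c where "c b = A $ axis_index b $ axis_index b" for b :: "real^'n"
    have c_axis: "c (axis i 1) = A $ i $ i" for i
      by (simp add: c_def axis_index_axis)
    have Basis: "(Basis :: (real^'n) set) = (\<lambda>i. axis i 1) ` UNIV"
      by (auto simp: Basis_vec_def)
    have inj: "inj_on (\<lambda>i. axis i 1 :: real^'n) UNIV"
      by (auto simp: inj_on_def axis_eq_axis)
    have "(\<Sum>j\<in>Basis. (c j * (x \<bullet> j)) *\<^sub>R j) = A *v x" for x
    proof -
      have "(\<Sum>j\<in>Basis. (c j * (x \<bullet> j)) *\<^sub>R j) = (\<Sum>i\<in>UNIV. (A $ i $ i * x $ i) *\<^sub>R axis i 1)"
        unfolding Basis by (subst sum.reindex[OF inj]) (simp add: c_axis inner_axis)
      also have "\<dots> = A *v x"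
      proof (rule vec_eq_iff[THEN iffD2], rule allI)
        fix k
        have "(A *v x) $ k = (\<Sum>j\<in>UNIV. A $ k $ j * x $ j)"
          by (simp add: matrix_vector_mult_def)
        also have "\<dots> = (\<Sum>j\<in>UNIV. ((A $ j $ j * x $ j) *\<^sub>R axis j 1) $ k)"
          by (rule sum.cong) (use A in \<open>auto simp: axis_def\<close>)
        finally show "(\<Sum>i\<in>UNIV. (A $ i $ i * x $ i) *\<^sub>R axis i 1) $ k = (A *v x) $ k"
          by simp
      qed
      finally show ?thesis .
    qed
    moreover have "(\<Prod>j\<in>Basis. \<bar>c j\<bar>) = \<bar>det A\<bar>"
      unfolding Basis detA by (subst prod.reindex[OF inj]) (simp add: c_axis abs_prod)
    moreover have "c j \<noteq> 0" if "j \<in> Basis" for j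
      using det that by (auto simp: Basis detA c_axis)
    ultimately have "lborel = density (distr lborel borel ((*v) A)) (\<lambda>_. ennreal \<bar>det A\<bar>)"
      using lborel_affine_euclidean[of c 0] by simp
    then have "(\<integral>\<^sup>+x. f x \<partial>lborel) = (\<integral>\<^sup>+x. f x \<partial>density (distr lborel borel ((*v) A)) (\<lambda>_. ennreal \<bar>det A\<bar>))"
      by simp
    also have "\<dots> = ennreal \<bar>det A\<bar> * (\<integral>\<^sup>+x. f (A *v x) \<partial>lborel)"
      by (simp add: nn_integral_density nn_integral_cmult nn_integral_distr)
    finally show "ennreal \<bar>det A\<bar> * (\<integral>\<^sup>+x. f (A *v x) \<partial>lborel) = (\<integral>\<^sup>+x. f x \<partial>lborel)" by simp
  qed
  have unimodular: "P A" if "P D" and D: "\<bar>det D\<bar> = 1" and A: "A ** (D ** A ** D) = mat 1" and detA: "\<bar>det A\<bar> = 1" for A D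
    unfolding P_def
  proof (intro impI ballI)
    fix f :: "real^'n \<Rightarrow> ennreal"
    assume [measurable]: "f \<in> borel_measurable borel"
    have "invertible A"
      using detA unfolding invertible_det_nz by linarith
    then obtain c where "c > 0" and c: "\<And>f :: real^'n \<Rightarrow> ennreal. f \<in> borel_measurable borel \<Longrightarrow> (\<integral>\<^sup>+x. f (A *v x) \<partial>lborel) = ennreal c * (\<integral>\<^sup>+x. f x \<partial>lborel)"
      using nn_integral_invertible_matrix by blast
    have Dinv: "(\<integral>\<^sup>+x. g (D *v x) \<partial>lborel) = (\<integral>\<^sup>+x. g x \<partial>lborel)" if "g \<in> borel_measurable borel" for g :: "real^'n \<Rightarrow> ennreal"
      using \<open>P D\<close> D that by (auto simp: P_def)
    define b where "b = (indicator (box 0 One) :: real^'n \<Rightarrow> ennreal)"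
    have [measurable]: "b \<in> borel_measurable borel"
      by (simp add: b_def)
    have b: "(\<integral>\<^sup>+x. b x \<partial>lborel) = 1"
      by (simp add: b_def)
    have "1 = (\<integral>\<^sup>+x. b ((A ** (D ** A ** D)) *v x) \<partial>lborel)"
      by (simp add: A b)
    also have "\<dots> = (\<integral>\<^sup>+x. b (A *v (D *v (A *v (D *v x)))) \<partial>lborel)"
      by (simp add: matrix_vector_mul_assoc matrix_mul_assoc)
    also have "\<dots> = (\<integral>\<^sup>+x. b (A *v (D *v (A *v x))) \<partial>lborel)"
      by (rule Dinv[of "\<lambda>x. b (A *v (D *v (A *v x)))"]) measurable
    also have "\<dots> = c * (\<integral>\<^sup>+x. b (A *v (D *v x)) \<partial>lborel)"
      by (rule c[of "\<lambda>x. b (A *v (D *v x))"]) measurable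
    also have "\<dots> = c * (\<integral>\<^sup>+x. b (A *v x) \<partial>lborel)"
      by (subst Dinv[of "\<lambda>x. b (A *v x)"]) simp_all
    also have "\<dots> = c * (c * (\<integral>\<^sup>+x. b x \<partial>lborel))"
      by (subst c[of b]) simp_all
    finally have "ennreal 1 = ennreal (c * c)"
      using \<open>c > 0\<close> by (simp add: ennreal_mult b)
    then have "c * c = 1"
      using \<open>c > 0\<close> by (subst (asm) ennreal_inj) auto
    then have "c = 1"
      using \<open>c > 0\<close> using abs_square_eq_1[of c] by (simp add: power2_eq_square)
    then show "ennreal \<bar>det A\<bar> * (\<integral>\<^sup>+x. f (A *v x) \<partial>lborel) = (\<integral>\<^sup>+x. f x \<partial>lborel)"
      using c[of f] detA by simp
  qed
  have "P A"
  proof (rule induct_matrix_elementary_alt)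
    show "P A" if "row i A = 0" for A i
      using that det_zero_row(1) by (auto simp: P_def)
    show "P (\<chi> i j. mat 1 $ i $ Transposition.transpose m n j)" (is "P ?W") if "m \<noteq> n" for m n
    proof (rule unimodular[of "mat 1"])
      show "P (mat 1)" by (rule diagonal) (simp add: mat_def)
      have "?W ** ?W = mat 1"
      proof -
        have "mat 1 $ i $ Transposition.transpose m n j * y = (if j = Transposition.transpose m n i then y else 0)" for i j and y :: real
          by (auto simp: mat_def Transposition.transpose_def)
        then have "?W *v x = (\<chi> i. x $ Transposition.transpose m n i)" for x
          by (simp add: matrix_vector_mult_def)
        then show ?thesis
          unfolding matrix_eq by (simp add: matrix_vector_mul_assoc[symmetric] vec_eq_iff)
      qed
      then show "?W ** (mat 1 ** ?W ** mat 1) = mat 1" by simp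
      then have "det (?W ** (mat 1 ** ?W ** mat 1)) = det (mat 1 :: real^'n^'n)" by (rule arg_cong)
      then have "det ?W * det ?W = 1" by (simp add: det_mul)
      then show "\<bar>det ?W\<bar> = 1" by (simp add: power2_eq_square flip: abs_square_eq_1)
    qed simp
    show "P (\<chi> i j. of_bool (i = m \<and> j = n \<or> i = j))" (is "P ?S") if "m \<noteq> n" for m n
    proof (rule unimodular)
      let ?D = "(\<chi> i j. if i = j then (if i = n then -1 else 1) else 0) :: real^'n^'n"
      show "P ?D" by (rule diagonal) simp
      have "det ?D = (\<Prod>i\<in>UNIV. ?D $ i $ i)" by (rule det_diagonal) simp
      then show D: "\<bar>det ?D\<bar> = 1" by (simp add: abs_prod prod.delta)
      have S: "?S *v x = (\<chi> i. if i = m then x $ m + x $ n else x $ i)" for x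
      proof -
        have "of_bool (i = m \<and> j = n \<or> i = j) * x $ j = (if j = i then x $ j else 0) + (if j = n then (if i = m then x $ j else 0) else 0)" for i j
          using that by auto
        then show ?thesis
          by (auto simp: matrix_vector_mult_def vec_eq_iff sum.distrib)
      qed
      have Dv: "?D *v x = (\<chi> i. if i = n then - x $ n else x $ i)" for x
        by (auto simp: matrix_vector_mult_def vec_eq_iff if_distrib[of "\<lambda>x. x * y" for y] cong: if_cong)
      show "?S ** (?D ** ?S ** ?D) = mat 1"
        unfolding matrix_eq matrix_vector_mul_assoc[symmetric] S Dv using that
        by (auto simp: vec_eq_iff)
      then have "det (?S ** (?D ** ?S ** ?D)) = det (mat 1 :: real^'n^'n)" by (rule arg_cong)
      then have "(det ?S * det ?D) * (det ?S * det ?D) = 1" by (simp add: det_mul mult_ac)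
      then have "\<bar>det ?S * det ?D\<bar> = 1" by (simp add: power2_eq_square flip: abs_square_eq_1)
      with D show "\<bar>det ?S\<bar> = 1" by (simp add: abs_mult)
    qed
  qed (fact mult diagonal)+
  then show ?thesis
    using assms by (auto simp: P_def)
qed

lemma lborel_eq_density_linear:
  fixes A :: "real^'n^'n"
  assumes "det A \<noteq> 0"
  shows "lborel = density (distr lborel borel ((*v) A)) (\<lambda>_. ennreal \<bar>det A\<bar>)"
proof (rule measure_eqI)
  fix X :: "(real^'n) set" assume "X \<in> sets lborel"
  then have [measurable]: "X \<in> sets borel" by simp
  have "emeasure (density (distr lborel borel ((*v) A)) (\<lambda>_. ennreal \<bar>det A\<bar>)) X
      = ennreal \<bar>det A\<bar> * (\<integral>\<^sup>+x. indicator X (A *v x) \<partial>lborel)"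
    by (simp add: emeasure_density nn_integral_cmult nn_integral_distr del: nn_integral_indicator)
  also have "\<dots> = emeasure lborel X"
    using nn_integral_linear[OF assms, of "indicator X"] by simp
  finally show "emeasure lborel X = emeasure (density (distr lborel borel ((*v) A)) (\<lambda>_. ennreal \<bar>det A\<bar>)) X"
    by simp
qed simp

lemma
  fixes A :: "real^'n^'n" and f :: "real^'n \<Rightarrow> 'b::{banach, second_countable_topology}"
  assumes det: "det A \<noteq> 0" and [measurable]: "f \<in> borel_measurable borel"
  shows integrable_linear_iff: "integrable lborel (\<lambda>x. f (A *v x)) \<longleftrightarrow> integrable lborel f"
    and lborel_integral_linear: "(LINT x|lborel. f (A *v x)) = (LINT x|lborel. f x) /\<^sub>R \<bar>det A\<bar>"
proof -
  have [measurable]: "(\<lambda>x. f (A *v x)) \<in> borel_measurable borel"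
    by measurable
  have "integrable lborel f \<longleftrightarrow> integrable (density (distr lborel borel ((*v) A)) (\<lambda>_. ennreal \<bar>det A\<bar>)) f"
    using lborel_eq_density_linear[OF det] by simp
  also have "\<dots> \<longleftrightarrow> integrable lborel (\<lambda>x. \<bar>det A\<bar> *\<^sub>R f (A *v x))"
    by (simp add: integrable_density integrable_distr_eq)
  also have "\<dots> \<longleftrightarrow> integrable lborel (\<lambda>x. f (A *v x))"
    using det integrable_scaleR_right[of "inverse \<bar>det A\<bar>" lborel "\<lambda>x. \<bar>det A\<bar> *\<^sub>R f (A *v x)"]
    by auto
  finally show "integrable lborel (\<lambda>x. f (A *v x)) \<longleftrightarrow> integrable lborel f" by simp
  have "(LINT x|lborel. f x) = (LINT x|density (distr lborel borel ((*v) A)) (\<lambda>_. ennreal \<bar>det A\<bar>). f x)"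
    using lborel_eq_density_linear[OF det] by simp
  also have "\<dots> = \<bar>det A\<bar> *\<^sub>R (LINT x|lborel. f (A *v x))"
    by (simp add: integral_density integral_distr)
  finally show "(LINT x|lborel. f (A *v x)) = (LINT x|lborel. f x) /\<^sub>R \<bar>det A\<bar>"
    using det by simp
qed

lemma
  fixes a :: "'a::euclidean_space" and f :: "'a \<Rightarrow> 'b::{banach, second_countable_topology}"
  assumes [measurable]: "f \<in> borel_measurable borel"
  shows integrable_lborel_shift: "integrable lborel (\<lambda>x. f (x + a)) \<longleftrightarrow> integrable lborel f"
    and integral_lborel_shift: "(LINT x|lborel. f (x + a)) = (LINT x|lborel. f x)"
proof -
  have "integrable (distr lborel borel (\<lambda>x. x + a)) f \<longleftrightarrow> integrable lborel (\<lambda>x. f (x + a))"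
    by (rule integrable_distr_eq) auto
  then show "integrable lborel (\<lambda>x. f (x + a)) \<longleftrightarrow> integrable lborel f"
    by (simp add: lborel_distr_shift)
  have "(LINT x|distr lborel borel (\<lambda>x. x + a). f x) = (LINT x|lborel. f (x + a))"
    by (rule integral_distr) auto
  then show "(LINT x|lborel. f (x + a)) = (LINT x|lborel. f x)"
    by (simp add: lborel_distr_shift)
qed

lemma integral_lborel_scale:
  fixes f :: "'a::euclidean_space \<Rightarrow> 'b::{banach, second_countable_topology}"
  assumes "c > 0" and [measurable]: "f \<in> borel_measurable borel"
  shows "(LINT x|lborel. f x) = c ^ DIM('a) *\<^sub>R (LINT x|lborel. f (c *\<^sub>R x))"
proof -
  have "(LINT x|lborel. f x) = (LINT x|density (distr lborel borel (\<lambda>x. 0 + c *\<^sub>R x)) (\<lambda>_. ennreal (\<bar>c\<bar> ^ DIM('a))). f x)"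
    using lborel_affine[of c "0::'a"] \<open>c > 0\<close> by simp
  also have "\<dots> = c ^ DIM('a) *\<^sub>R (LINT x|lborel. f (c *\<^sub>R x))"
    using \<open>c > 0\<close> by (simp add: integral_density integral_distr)
  finally show ?thesis .
qed

text \<open>The space is covered by balls of integer radius, whose volume grows like the power
  \<open>DIM('a)\<close> of the radius.\<close>

lemma integrable_inverse_power:
  "integrable lborel (\<lambda>x::'a::euclidean_space. 1 / (1 + norm x) ^ (DIM('a) + 2))"
proof (rule integrableI_bounded)
  let ?m = "DIM('a)"
  let ?v = "unit_ball_vol (real ?m)"
  let ?g = "\<lambda>k x. ennreal (1 / (1 + real k) ^ (?m + 2)) * indicator (cball (0::'a) (1 + real k)) x"
  have le: "h k \<le> (\<Sum>k. h k)" for h :: "nat \<Rightarrow> ennreal" and k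
    using sum_le_suminf[of h "{k}"] by simp
  show "(\<lambda>x::'a. 1 / (1 + norm x) ^ (?m + 2)) \<in> borel_measurable lborel"
    by measurable
  have "(\<integral>\<^sup>+x. ennreal (norm (1 / (1 + norm (x::'a)) ^ (?m + 2))) \<partial>lborel) \<le> (\<integral>\<^sup>+x. (\<Sum>k. ?g k x) \<partial>lborel)"
  proof (rule nn_integral_mono)
    fix x :: 'a
    define k where "k = nat \<lfloor>norm x\<rfloor>"
    have k: "real k \<le> norm x" "norm x \<le> 1 + real k"
      by (simp_all add: k_def) linarith
    have "(1 + real k) ^ (?m + 2) \<le> (1 + norm x) ^ (?m + 2)"
      using k by (intro power_mono) auto
    then have "1 / (1 + norm x) ^ (?m + 2) \<le> 1 / (1 + real k) ^ (?m + 2)"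
      by (intro frac_le zero_less_power) auto
    moreover have "norm (1 / (1 + norm x) ^ (?m + 2)) = 1 / (1 + norm x) ^ (?m + 2)"
      by (simp add: norm_divide norm_power)
    moreover have "x \<in> cball 0 (1 + real k)"
      using k by simp
    ultimately have "ennreal (norm (1 / (1 + norm x) ^ (?m + 2))) \<le> ?g k x"
      by (simp only: indicator_simps mult_1_right ennreal_leI)
    also have "\<dots> \<le> (\<Sum>k. ?g k x)"
      by (rule le)
    finally show "ennreal (norm (1 / (1 + norm x) ^ (?m + 2))) \<le> (\<Sum>k. ?g k x)" .
  qed
  also have "\<dots> = (\<Sum>k. \<integral>\<^sup>+x. ?g k x \<partial>lborel)"
    by (rule nn_integral_suminf) (intro borel_measurable_times_ennreal borel_measurable_const borel_measurable_indicator, simp)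
  also have "\<dots> = (\<Sum>k. ennreal (?v * (1 / real (Suc k) ^ 2)))"
  proof (rule suminf_cong)
    fix k
    have "(\<integral>\<^sup>+x. ?g k x \<partial>lborel) = ennreal (1 / (1 + real k) ^ (?m + 2)) * ennreal (?v * (1 + real k) ^ ?m)"
      by (subst nn_integral_cmult_indicator) (auto simp: emeasure_cball)
    also have "\<dots> = ennreal (1 / (1 + real k) ^ (?m + 2) * (?v * (1 + real k) ^ ?m))"
      by (rule ennreal_mult[symmetric]) auto
    also have "1 / (1 + real k) ^ (?m + 2) * (?v * (1 + real k) ^ ?m) = ?v * (1 / real (Suc k) ^ 2)"
      by (simp add: power_add power2_eq_square)
    finally show "(\<integral>\<^sup>+x. ?g k x \<partial>lborel) = ennreal (?v * (1 / real (Suc k) ^ 2))" .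
  qed
  also have "\<dots> < \<infinity>"
  proof -
    have "summable (\<lambda>k. 1 / real (Suc k) ^ 2)"
      using inverse_power_summable[of 2, where 'a=real] by (subst summable_Suc_iff) (simp add: inverse_eq_divide)
    then have "summable (\<lambda>k. ?v * (1 / real (Suc k) ^ 2))"
      by (rule summable_mult)
    then show ?thesis
      by (subst suminf_ennreal2) (auto intro!: mult_nonneg_nonneg simp del: of_nat_Suc)
  qed
  finally show "(\<integral>\<^sup>+x. ennreal (norm (1 / (1 + norm (x::'a)) ^ (?m + 2))) \<partial>lborel) < \<infinity>" .
qed

section \<open>Schwartz functions\<close>

lemma partial_deriv_eq:
  assumes "(f has_derivative f') (at x)"
  shows "partial_deriv i f x = f' (axis i 1)"
proof -
  have "((\<lambda>s. f (x + s *\<^sub>R axis i 1)) has_derivative (\<lambda>s. f' (s *\<^sub>R axis i 1))) (at 0)"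
    by (rule has_derivative_compose[of "\<lambda>s. x + s *\<^sub>R axis i 1", where g=f])
      (use assms in \<open>auto intro!: derivative_eq_intros\<close>)
  then have "((\<lambda>s. f (x + s *\<^sub>R axis i 1)) has_vector_derivative f' (axis i 1)) (at 0)"
    using linear_cmul[OF has_derivative_linear[OF assms]] by (simp add: has_vector_derivative_def)
  then show ?thesis
    unfolding partial_deriv_def by (rule vector_derivative_at)
qed

text \<open>All closure properties of the Schwartz space are instances of this coinduction principle: it
  suffices to exhibit a class that is closed under partial derivatives.\<close>

lemma schwartz_coinduct:
  assumes "f \<in> C"
    and diff: "\<And>f x. f \<in> C \<Longrightarrow> f differentiable (at x)"
    and part: "\<And>f i. f \<in> C \<Longrightarrow> partial_deriv i f \<in> C"
    and decay: "\<And>f k. f \<in> C \<Longrightarrow> \<exists>M. \<forall>x. norm x ^ k * norm (f x) \<le> M"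
  shows "f \<in> schwartz"
proof -
  have "iterated_partial_deriv is f \<in> C" for "is"
    by (induction "is") (use \<open>f \<in> C\<close> part in auto)
  then show ?thesis
    using diff decay unfolding schwartz_def bounded_iff by fastforce
qed

lemma schwartz_differentiable: "\<phi> \<in> schwartz \<Longrightarrow> \<phi> differentiable (at x)"
  unfolding schwartz_def by (auto dest: spec[of _ "[]"])

lemma iterated_partial_deriv_snoc:
  "iterated_partial_deriv (is @ [i]) f = iterated_partial_deriv is (partial_deriv i f)"
  by (induction "is") auto

lemma schwartz_partial_deriv: "\<phi> \<in> schwartz \<Longrightarrow> partial_deriv i \<phi> \<in> schwartz"
  unfolding schwartz_def by (auto simp flip: iterated_partial_deriv_snoc)

lemma schwartz_decay_power:
  assumes "\<phi> \<in> schwartz" shows "\<exists>M. \<forall>x. norm x ^ k * norm (\<phi> x) \<le> M"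
proof -
  have "bounded (range (\<lambda>x. norm x ^ k *\<^sub>R iterated_partial_deriv [] \<phi> x))"
    using assms unfolding schwartz_def by blast
  then show ?thesis
    by (auto simp: bounded_iff)
qed

lemma schwartz_decay:
  assumes "\<phi> \<in> schwartz"
  obtains M where "M > 0" "\<And>x. norm (\<phi> x) \<le> M / (1 + norm x) ^ k"
proof -
  obtain M0 where M0: "\<And>x. norm x ^ 0 * norm (\<phi> x) \<le> M0"
    using schwartz_decay_power[OF assms, of 0] by blast
  obtain Mk where Mk: "\<And>x. norm x ^ k * norm (\<phi> x) \<le> Mk"
    using schwartz_decay_power[OF assms, of k] by blast
  have "norm (\<phi> x) \<le> (2 ^ k * (\<bar>M0\<bar> + \<bar>Mk\<bar>) + 1) / (1 + norm x) ^ k" for x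
  proof -
    have "(1 + norm x) ^ k \<le> 2 ^ k * (1 + norm x ^ k)"
    proof (cases "norm x \<le> 1")
      case True
      then have "(1 + norm x) ^ k \<le> 2 ^ k" by (intro power_mono) auto
      also have "\<dots> \<le> 2 ^ k * (1 + norm x ^ k)" by simp
      finally show ?thesis .
    next
      case False
      then have "(1 + norm x) ^ k \<le> (2 * norm x) ^ k" by (intro power_mono) auto
      also have "\<dots> \<le> 2 ^ k * (1 + norm x ^ k)" by (simp add: power_mult_distrib)
      finally show ?thesis .
    qed
    then have "(1 + norm x) ^ k * norm (\<phi> x) \<le> 2 ^ k * (1 + norm x ^ k) * norm (\<phi> x)"
      by (intro mult_right_mono) auto
    also have "\<dots> = 2 ^ k * (norm (\<phi> x) + norm x ^ k * norm (\<phi> x))"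
      by (simp add: algebra_simps)
    also have "\<dots> \<le> 2 ^ k * (\<bar>M0\<bar> + \<bar>Mk\<bar>)"
      using M0[of x] Mk[of x] by (intro mult_left_mono) auto
    finally have "(1 + norm x) ^ k * norm (\<phi> x) \<le> 2 ^ k * (\<bar>M0\<bar> + \<bar>Mk\<bar>) + 1" by simp
    moreover have "0 < (1 + norm x) ^ k"
      by (intro zero_less_power) (auto intro: add_pos_nonneg)
    ultimately show ?thesis
      by (simp add: pos_le_divide_eq mult.commute)
  qed
  then show thesis
    by (intro that[of "2 ^ k * (\<bar>M0\<bar> + \<bar>Mk\<bar>) + 1"]) (auto intro: add_nonneg_pos)
qed

lemma schwartz_has_derivative:
  assumes "\<phi> \<in> schwartz"
  shows "(\<phi> has_derivative (\<lambda>h. \<Sum>i\<in>UNIV. of_real (h $ i) * partial_deriv i \<phi> x)) (at x)"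
proof -
  obtain \<phi>' where *: "(\<phi> has_derivative \<phi>') (at x)"
    using schwartz_differentiable[OF assms] by (auto simp: differentiable_def)
  have lin: "linear \<phi>'" using * by (rule has_derivative_linear)
  have "\<phi>' h = (\<Sum>i\<in>UNIV. of_real (h $ i) * partial_deriv i \<phi> x)" for h
  proof -
    have "h = (\<Sum>i\<in>UNIV. h $ i *\<^sub>R axis i 1)"
      by (simp add: vec_eq_iff axis_def if_distrib cong: if_cong)
    then have "\<phi>' h = \<phi>' (\<Sum>i\<in>UNIV. h $ i *\<^sub>R axis i 1)"
      by simp
    also have "\<dots> = (\<Sum>i\<in>UNIV. h $ i *\<^sub>R \<phi>' (axis i 1))"
      by (simp add: linear_sum[OF lin] linear_cmul[OF lin])
    finally show ?thesis
      by (simp add: partial_deriv_eq[OF *] scaleR_conv_of_real)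
  qed
  then have "\<phi>' = (\<lambda>h. \<Sum>i\<in>UNIV. of_real (h $ i) * partial_deriv i \<phi> x)"
    by (rule ext)
  with * show ?thesis by simp
qed

lemma schwartz_continuous_on: "\<phi> \<in> schwartz \<Longrightarrow> continuous_on X \<phi>"
  by (meson continuous_at_imp_continuous_on differentiable_imp_continuous_within schwartz_differentiable)

lemma schwartz_measurable [measurable_dest]: "\<phi> \<in> schwartz \<Longrightarrow> \<phi> \<in> borel_measurable borel"
  by (intro borel_measurable_continuous_onI schwartz_continuous_on)

lemma integrable_of_decay:
  fixes f :: "'a::euclidean_space \<Rightarrow> 'b::{banach, second_countable_topology}"
  assumes "f \<in> borel_measurable borel" and "\<And>x. norm (f x) \<le> M / (1 + norm x) ^ (DIM('a) + 2)"
  shows "integrable lborel f"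
proof (rule Bochner_Integration.integrable_bound)
  show "integrable lborel (\<lambda>x::'a. M / (1 + norm x) ^ (DIM('a) + 2))"
    using integrable_mult_right[OF integrable_inverse_power, of M] by simp
  show "AE x in lborel. norm (f x) \<le> norm (M / (1 + norm x) ^ (DIM('a) + 2))"
    unfolding real_norm_def by (intro AE_I2 order_trans[OF assms(2) abs_ge_self])
qed (use assms in simp)

lemma integrable_schwartz:
  assumes "\<phi> \<in> schwartz" shows "integrable lborel \<phi>"
proof -
  obtain M where "\<And>x. norm (\<phi> x) \<le> M / (1 + norm x) ^ (CARD('a) + 2)"
    using schwartz_decay[OF assms] by metis
  then show ?thesis
    using assms by (intro integrable_of_decay[of \<phi> M]) auto
qed

lemma square_integrable_of_decay:
  fixes f :: "'a::euclidean_space \<Rightarrow> complex"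
  assumes "f \<in> borel_measurable borel" and le: "\<And>x. norm (f x) \<le> M / (1 + norm x) ^ (DIM('a) + 2)"
  shows "square_integrable f"
  unfolding square_integrable_def
proof (intro conjI)
  show "integrable lborel (\<lambda>x. (norm (f x))\<^sup>2)"
  proof (rule integrable_of_decay)
    fix x :: 'a
    let ?d = "(1 + norm x) ^ (DIM('a) + 2)"
    have d: "?d \<ge> 1" by (rule one_le_power) simp
    have "0 \<le> M / ?d" using le[of x] norm_ge_zero order_trans by blast
    then have "M \<ge> 0" using d by (simp add: zero_le_divide_iff)
    have "(norm (f x))\<^sup>2 \<le> (M / ?d)\<^sup>2"
      by (intro power_mono le) simp
    also have "\<dots> = M\<^sup>2 / (?d * ?d)" by (simp add: power2_eq_square)
    also have "\<dots> \<le> M\<^sup>2 / ?d"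
      using d mult_left_mono[OF d, of ?d] by (intro divide_left_mono mult_pos_pos) auto
    finally show "norm ((norm (f x))\<^sup>2) \<le> M\<^sup>2 / ?d" by simp
  qed (use assms in simp)
qed (use assms in simp)

lemma integrable_decay_square:
  assumes "M \<ge> 0"
  shows "integrable lborel (\<lambda>x::'a::euclidean_space. (M / (1 + norm x) ^ (DIM('a) + 2))\<^sup>2)"
proof -
  have "square_integrable (\<lambda>x::'a. complex_of_real (M / (1 + norm x) ^ (DIM('a) + 2)))"
    using assms by (intro square_integrable_of_decay[where M=M]) (measurable, simp only: norm_of_real, simp)
  then show ?thesis
    by (simp only: square_integrable_def norm_of_real power2_abs)
qed

lemma square_integrable_schwartz:
  assumes "\<phi> \<in> schwartz" shows "square_integrable \<phi>"
proof -
  obtain M where "\<And>x. norm (\<phi> x) \<le> M / (1 + norm x) ^ (CARD('a) + 2)"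
    using schwartz_decay[OF assms] by metis
  then show ?thesis
    using assms by (intro square_integrable_of_decay[of \<phi> M]) auto
qed

lemma sum_axis [simp]: "(\<Sum>i\<in>UNIV. complex_of_real (axis j 1 $ i) * c i) = c j"
  by (simp add: axis_def if_distrib[of complex_of_real] if_distrib[of "\<lambda>x. x * y" for y] cong: if_cong)

lemma partial_deriv_schwartz_add:
  assumes "\<phi> \<in> schwartz" "\<psi> \<in> schwartz"
  shows "partial_deriv i (\<lambda>x. \<phi> x + \<psi> x) = (\<lambda>x. partial_deriv i \<phi> x + partial_deriv i \<psi> x)"
  by (rule ext) (simp add: partial_deriv_eq[OF has_derivative_add[OF assms[THEN schwartz_has_derivative]]])

lemma schwartz_add:
  assumes "\<phi> \<in> schwartz" "\<psi> \<in> schwartz"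
  shows "(\<lambda>x. \<phi> x + \<psi> x) \<in> schwartz"
proof (rule schwartz_coinduct[where C="{\<lambda>x. \<phi> x + \<psi> x |\<phi> \<psi>. \<phi> \<in> schwartz \<and> \<psi> \<in> schwartz}"])
  fix f :: "real^'a \<Rightarrow> complex" and k
  assume "f \<in> {\<lambda>x. \<phi> x + \<psi> x |\<phi> \<psi>. \<phi> \<in> schwartz \<and> \<psi> \<in> schwartz}"
  then obtain \<phi> \<psi> where f: "f = (\<lambda>x. \<phi> x + \<psi> x)" and S: "\<phi> \<in> schwartz" "\<psi> \<in> schwartz" by blast
  show "f differentiable (at x)" for x
    unfolding f using S by (intro differentiable_add schwartz_differentiable)
  show "partial_deriv i f \<in> {\<lambda>x. \<phi> x + \<psi> x |\<phi> \<psi>. \<phi> \<in> schwartz \<and> \<psi> \<in> schwartz}" for i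
    unfolding f partial_deriv_schwartz_add[OF S] using S schwartz_partial_deriv by blast
  obtain M N where MN: "\<And>x. norm x ^ k * norm (\<phi> x) \<le> M" "\<And>x. norm x ^ k * norm (\<psi> x) \<le> N"
    using S[THEN schwartz_decay_power] by metis
  have "norm x ^ k * norm (f x) \<le> M + N" for x
  proof -
    have "norm x ^ k * norm (f x) \<le> norm x ^ k * (norm (\<phi> x) + norm (\<psi> x))"
      unfolding f by (intro mult_left_mono norm_triangle_ineq) auto
    then show ?thesis
      using MN(1)[of x] MN(2)[of x] by (simp add: distrib_left)
  qed
  then show "\<exists>M. \<forall>x. norm x ^ k * norm (f x) \<le> M" by blast
qed (use assms in blast)

lemma partial_deriv_schwartz_cmult:
  assumes "\<phi> \<in> schwartz"
  shows "partial_deriv i (\<lambda>x. c * \<phi> x) = (\<lambda>x. c * partial_deriv i \<phi> x)"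
  by (rule ext) (simp add: partial_deriv_eq[OF has_derivative_mult_right[OF schwartz_has_derivative[OF assms]]])

lemma schwartz_cmult:
  assumes "\<phi> \<in> schwartz"
  shows "(\<lambda>x. c * \<phi> x) \<in> schwartz"
proof (rule schwartz_coinduct[where C="{\<lambda>x. c * \<phi> x |\<phi>. \<phi> \<in> schwartz}"])
  fix f :: "real^'a \<Rightarrow> complex" and k
  assume "f \<in> {\<lambda>x. c * \<phi> x |\<phi>. \<phi> \<in> schwartz}"
  then obtain \<phi> where f: "f = (\<lambda>x. c * \<phi> x)" and S: "\<phi> \<in> schwartz" by blast
  show "f differentiable (at x)" for x
    unfolding f using S by (intro differentiable_mult differentiable_const schwartz_differentiable)
  show "partial_deriv i f \<in> {\<lambda>x. c * \<phi> x |\<phi>. \<phi> \<in> schwartz}" for i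
    unfolding f partial_deriv_schwartz_cmult[OF S] using S schwartz_partial_deriv by blast
  obtain M where "\<And>x. norm x ^ k * norm (\<phi> x) \<le> M"
    using S[THEN schwartz_decay_power] by metis
  then have "norm x ^ k * norm (f x) \<le> norm c * M" for x
    unfolding f norm_mult by (metis mult.left_commute mult_left_mono norm_ge_zero)
  then show "\<exists>M. \<forall>x. norm x ^ k * norm (f x) \<le> M" by blast
qed (use assms in blast)

lemma schwartz_zero: "(\<lambda>x. 0) \<in> schwartz"
proof (rule schwartz_coinduct[where C="{\<lambda>x. 0}"])
  fix f :: "real^'a \<Rightarrow> complex" and i assume "f \<in> {\<lambda>x. 0}"
  then show "partial_deriv i f \<in> {\<lambda>x. 0}"
    by (auto simp: partial_deriv_eq[OF has_derivative_const])
qed auto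

lemma schwartz_uminus: "\<phi> \<in> schwartz \<Longrightarrow> (\<lambda>x. - \<phi> x) \<in> schwartz"
  using schwartz_cmult[of \<phi> "-1"] by simp

lemma schwartz_diff: "\<phi> \<in> schwartz \<Longrightarrow> \<psi> \<in> schwartz \<Longrightarrow> (\<lambda>x. \<phi> x - \<psi> x) \<in> schwartz"
  using schwartz_add[OF _ schwartz_uminus] by simp

lemma schwartz_sum: "(\<And>i. i \<in> I \<Longrightarrow> \<phi> i \<in> schwartz) \<Longrightarrow> (\<lambda>x. \<Sum>i\<in>I. \<phi> i x) \<in> schwartz"
  by (induction I rule: infinite_finite_induct) (auto intro: schwartz_zero schwartz_add)

lemma partial_deriv_coord_mult:
  assumes "\<phi> \<in> schwartz"
  shows "partial_deriv i (\<lambda>x. of_real (x $ j) * \<phi> x) = (\<lambda>x. of_bool (i = j) * \<phi> x + of_real (x $ j) * partial_deriv i \<phi> x)"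
    and "(\<lambda>x. of_real (x $ j) * \<phi> x) differentiable (at x)"
proof -
  have *: "((\<lambda>x. of_real (x $ j) * \<phi> x) has_derivative
      (\<lambda>h. of_real (x $ j) * (\<Sum>i\<in>UNIV. of_real (h $ i) * partial_deriv i \<phi> x) + of_real (h $ j) * \<phi> x)) (at x)" for x
    by (intro has_derivative_mult schwartz_has_derivative assms bounded_linear_imp_has_derivative
        bounded_linear_compose[OF bounded_linear_of_real bounded_linear_vec_nth])
  show "partial_deriv i (\<lambda>x. of_real (x $ j) * \<phi> x) = (\<lambda>x. of_bool (i = j) * \<phi> x + of_real (x $ j) * partial_deriv i \<phi> x)"
    by (rule ext) (simp add: partial_deriv_eq[OF *], simp add: axis_def)
  show "(\<lambda>x. of_real (x $ j) * \<phi> x) differentiable (at x)"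
    using * differentiable_def by blast
qed

text \<open>The product rule leaves a term without the factor \<open>x $ j\<close>; the coinductive class contains sums
  in order to absorb it.\<close>

lemma schwartz_coord_mult:
  assumes "\<phi> \<in> schwartz"
  shows "(\<lambda>x. of_real (x $ j) * \<phi> x) \<in> schwartz"
proof (rule schwartz_coinduct[where C="{\<lambda>x. \<psi> x + of_real (x $ j) * \<phi> x |\<phi> \<psi>. \<phi> \<in> schwartz \<and> \<psi> \<in> schwartz}"])
  show "(\<lambda>x. of_real (x $ j) * \<phi> x) \<in> {\<lambda>x. \<psi> x + of_real (x $ j) * \<phi> x |\<phi> \<psi>. \<phi> \<in> schwartz \<and> \<psi> \<in> schwartz}"
    using assms schwartz_zero by (intro CollectI exI[of _ \<phi>] exI[of _ "\<lambda>x. 0"]) auto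
  fix f :: "real^'a \<Rightarrow> complex" and k
  assume "f \<in> {\<lambda>x. \<psi> x + of_real (x $ j) * \<phi> x |\<phi> \<psi>. \<phi> \<in> schwartz \<and> \<psi> \<in> schwartz}"
  then obtain \<phi> \<psi> where f: "f = (\<lambda>x. \<psi> x + of_real (x $ j) * \<phi> x)" and S: "\<phi> \<in> schwartz" "\<psi> \<in> schwartz" by blast
  show d: "f differentiable (at x)" for x
    unfolding f using S by (intro differentiable_add schwartz_differentiable partial_deriv_coord_mult)
  have "partial_deriv i f x = (partial_deriv i \<psi> x + of_bool (i = j) * \<phi> x) + of_real (x $ j) * partial_deriv i \<phi> x" for i x
  proof -
    obtain D where D: "((\<lambda>x. of_real (x $ j) * \<phi> x) has_derivative D) (at x)"
      using partial_deriv_coord_mult(2)[OF S(1)] differentiable_def by blast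
    show ?thesis
      unfolding f partial_deriv_eq[OF has_derivative_add[OF schwartz_has_derivative[OF S(2)] D]]
      using fun_cong[OF partial_deriv_coord_mult(1)[OF S(1), of i j], of x] partial_deriv_eq[OF D, of i]
      by simp
  qed
  then show "partial_deriv i f \<in> {\<lambda>x. \<psi> x + of_real (x $ j) * \<phi> x |\<phi> \<psi>. \<phi> \<in> schwartz \<and> \<psi> \<in> schwartz}" for i
    using S by (intro CollectI exI[of _ "partial_deriv i \<phi>"] exI[of _ "\<lambda>x. partial_deriv i \<psi> x + of_bool (i = j) * \<phi> x"])
      (auto intro!: schwartz_partial_deriv schwartz_add schwartz_cmult)
  obtain M N where M: "\<And>x. norm x ^ Suc k * norm (\<phi> x) \<le> M" and N: "\<And>x. norm x ^ k * norm (\<psi> x) \<le> N"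
    using S[THEN schwartz_decay_power] by metis
  have "norm x ^ k * norm (f x) \<le> N + M" for x
  proof -
    have "norm (f x) \<le> norm (\<psi> x) + norm x * norm (\<phi> x)"
      unfolding f by (rule order_trans[OF norm_triangle_ineq])
        (auto simp: norm_mult intro!: mult_right_mono component_le_norm_cart)
    then have "norm x ^ k * norm (f x) \<le> norm x ^ k * (norm (\<psi> x) + norm x * norm (\<phi> x))"
      by (intro mult_left_mono) auto
    also have "\<dots> \<le> N + M"
      using M[of x] N[of x] by (simp add: algebra_simps)
    finally show ?thesis .
  qed
  then show "\<exists>M. \<forall>x. norm x ^ k * norm (f x) \<le> M" by blast
qed

lemma schwartz_compose_linear:
  fixes A :: "real^'n^'n"
  assumes "\<phi> \<in> schwartz" "invertible A"
  shows "(\<lambda>x. \<phi> (A *v x)) \<in> schwartz"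
proof (rule schwartz_coinduct[where C="{\<lambda>x. \<phi> (A *v x) |\<phi>. \<phi> \<in> schwartz}"])
  fix f :: "real^'n \<Rightarrow> complex" and k
  assume "f \<in> {\<lambda>x. \<phi> (A *v x) |\<phi>. \<phi> \<in> schwartz}"
  then obtain \<phi> where f: "f = (\<lambda>x. \<phi> (A *v x))" and S: "\<phi> \<in> schwartz" by blast
  have *: "(f has_derivative (\<lambda>h. \<Sum>i\<in>UNIV. of_real ((A *v h) $ i) * partial_deriv i \<phi> (A *v x))) (at x)" for x
    unfolding f
    by (rule has_derivative_compose[OF _ schwartz_has_derivative[OF S]])
      (intro bounded_linear_imp_has_derivative matrix_vector_mul_bounded_linear)
  then show "f differentiable (at x)" for x
    using differentiable_def by blast
  have "partial_deriv j f = (\<lambda>x. (\<lambda>y. \<Sum>i\<in>UNIV. of_real (A $ i $ j) * partial_deriv i \<phi> y) (A *v x))" for j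
    by (rule ext) (simp add: partial_deriv_eq[OF *] matrix_vector_mult_basis column_def)
  moreover have "(\<lambda>y. \<Sum>i\<in>UNIV. of_real (A $ i $ j) * partial_deriv i \<phi> y) \<in> schwartz" for j
    using S by (intro schwartz_sum schwartz_cmult schwartz_partial_deriv)
  ultimately show "partial_deriv i f \<in> {\<lambda>x. \<phi> (A *v x) |\<phi>. \<phi> \<in> schwartz}" for i
    by (intro CollectI exI[of _ "\<lambda>y. \<Sum>k\<in>UNIV. of_real (A $ k $ i) * partial_deriv k \<phi> y"] conjI)
  obtain M where M: "\<And>x. norm x ^ k * norm (\<phi> x) \<le> M"
    using S[THEN schwartz_decay_power] by metis
  obtain A' where A': "A' ** A = mat 1"
    using \<open>invertible A\<close> by (auto simp: invertible_def)
  obtain K where K: "\<And>y. norm (A' *v y) \<le> norm y * K" "K > 0"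
    using bounded_linear.pos_bounded[OF matrix_vector_mul_bounded_linear[of A']] by blast
  have "norm x ^ k * norm (f x) \<le> K ^ k * M" for x
  proof -
    have "norm x \<le> norm (A *v x) * K"
      using K(1)[of "A *v x"] A' by (simp add: matrix_vector_mul_assoc)
    then have "norm x ^ k * norm (f x) \<le> (norm (A *v x) * K) ^ k * norm (f x)"
      by (intro mult_right_mono power_mono) auto
    also have "\<dots> = K ^ k * (norm (A *v x) ^ k * norm (\<phi> (A *v x)))"
      by (simp add: f power_mult_distrib)
    also have "\<dots> \<le> K ^ k * M"
      using K(2) by (intro mult_left_mono M) auto
    finally show ?thesis .
  qed
  then show "\<exists>M. \<forall>x. norm x ^ k * norm (f x) \<le> M" by blast
qed (use assms in blast)

text \<open>A derivative of \<open>exp p \<cdot> \<phi>\<close> is again \<open>exp p\<close> times a Schwartz function as long as the derivatives of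
  \<open>p\<close> are multipliers of the Schwartz space; the bound on \<open>Re p\<close> takes care of the decay.\<close>

lemma schwartz_exp_mult:
  fixes p :: "real^'n \<Rightarrow> complex"
  assumes "\<phi> \<in> schwartz"
    and p: "\<And>x. (p has_derivative p' x) (at x)"
    and p'_mult: "\<And>\<psi> i. \<psi> \<in> schwartz \<Longrightarrow> (\<lambda>x. p' x (axis i 1) * \<psi> x) \<in> schwartz"
    and Re: "\<And>x. Re (p x) \<le> b"
  shows "(\<lambda>x. exp (p x) * \<phi> x) \<in> schwartz"
proof (rule schwartz_coinduct[where C="{\<lambda>x. exp (p x) * \<phi> x |\<phi>. \<phi> \<in> schwartz}"])
  fix f :: "real^'n \<Rightarrow> complex" and k
  assume "f \<in> {\<lambda>x. exp (p x) * \<phi> x |\<phi>. \<phi> \<in> schwartz}"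
  then obtain \<phi> where f: "f = (\<lambda>x. exp (p x) * \<phi> x)" and S: "\<phi> \<in> schwartz" by blast
  have *: "(f has_derivative (\<lambda>h. exp (p x) * (\<Sum>i\<in>UNIV. of_real (h $ i) * partial_deriv i \<phi> x) + exp (p x) * p' x h * \<phi> x)) (at x)" for x
    unfolding f
    by (intro has_derivative_mult schwartz_has_derivative S)
      (rule has_derivative_compose[OF p DERIV_exp[unfolded has_field_derivative_def]])
  then show "f differentiable (at x)" for x
    using differentiable_def by blast
  have "partial_deriv j f = (\<lambda>x. exp (p x) * (partial_deriv j \<phi> x + p' x (axis j 1) * \<phi> x))" for j
    by (rule ext) (simp add: partial_deriv_eq[OF *], simp add: algebra_simps)
  then show "partial_deriv i f \<in> {\<lambda>x. exp (p x) * \<phi> x |\<phi>. \<phi> \<in> schwartz}" for i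
    using schwartz_add[OF schwartz_partial_deriv[OF S] p'_mult[OF S]]
    by (intro CollectI exI[of _ "\<lambda>x. partial_deriv i \<phi> x + p' x (axis i 1) * \<phi> x"] conjI)
  obtain M where M: "\<And>x. norm x ^ k * norm (\<phi> x) \<le> M"
    using S[THEN schwartz_decay_power] by metis
  have "norm x ^ k * norm (f x) \<le> exp b * M" for x
  proof -
    have "norm x ^ k * norm (f x) = exp (Re (p x)) * (norm x ^ k * norm (\<phi> x))"
      by (simp add: f norm_mult)
    also have "\<dots> \<le> exp b * M"
      using M[of x] Re[of x] by (intro mult_mono) auto
    finally show ?thesis .
  qed
  then show "\<exists>M. \<forall>x. norm x ^ k * norm (f x) \<le> M" by blast
qed (use assms in blast)

lemma schwartz_linear_form_mult:
  assumes "\<phi> \<in> schwartz" shows "(\<lambda>x. of_real (a \<bullet> x) * \<phi> x) \<in> schwartz"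
proof -
  have "(\<lambda>x. of_real (a \<bullet> x) * \<phi> x) = (\<lambda>x. \<Sum>i\<in>UNIV. of_real (a $ i) * (of_real (x $ i) * \<phi> x))"
    by (auto simp: inner_vec_def sum_distrib_left sum_distrib_right mult_ac)
  then show ?thesis
    using assms by (simp only:) (intro schwartz_sum schwartz_cmult schwartz_coord_mult)
qed

text \<open>For \<open>a = \<i>\<close> these are the Fourier multipliers of the Schroedinger operators, for \<open>Re a > 0\<close> Gaussians
  of complex width, and for \<open>a = 0\<close> plane waves.\<close>

lemma schwartz_quadratic_exp_mult:
  fixes A :: "real^'n^'n"
  assumes "\<phi> \<in> schwartz" and nonneg: "Re a = 0 \<or> Re a > 0 \<and> (\<forall>x. 0 \<le> (A *v x) \<bullet> x)"
  shows "(\<lambda>x. exp (- a * of_real ((A *v x) \<bullet> x) + \<i> * of_real (w \<bullet> x)) * \<phi> x) \<in> schwartz"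
proof (rule schwartz_exp_mult[OF assms(1)])
  show "((\<lambda>x. - a * of_real ((A *v x) \<bullet> x) + \<i> * of_real (w \<bullet> x)) has_derivative
      (\<lambda>h. - a * of_real ((A *v x + transpose A *v x) \<bullet> h) + \<i> * of_real (w \<bullet> h))) (at x)" for x
  proof -
    have "((*v) A has_derivative (*v) A) (at x)"
      by (intro bounded_linear_imp_has_derivative matrix_vector_mul_bounded_linear)
    then have "((\<lambda>x. (A *v x) \<bullet> x) has_derivative (\<lambda>h. (A *v x + transpose A *v x) \<bullet> h)) (at x)"
      by (rule has_derivative_eq_rhs[OF has_derivative_inner[OF _ has_derivative_ident]])
        (simp add: fun_eq_iff inner_add_left transpose_matrix_vector dot_lmul_matrix, simp add: inner_commute)
    then show ?thesis
      by (intro has_derivative_add has_derivative_mult_right has_derivative_of_real has_derivative_inner_right has_derivative_ident)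
  qed
  fix \<psi> :: "real^'n \<Rightarrow> complex" and i assume S: "\<psi> \<in> schwartz"
  have "(- a * of_real ((A *v x + transpose A *v x) \<bullet> axis i 1) + \<i> * of_real (w \<bullet> axis i 1)) * \<psi> x =
      - a * (of_real ((row i A + column i A) \<bullet> x) * \<psi> x) + \<i> * of_real (w $ i) * \<psi> x" for x
  proof -
    have "(A *v x + transpose A *v x) \<bullet> axis i 1 = (row i A + column i A) \<bullet> x"
    proof -
      have "(A *v x + transpose A *v x) \<bullet> axis i 1 = (A *v x + transpose A *v x) $ i"
        by (simp add: inner_axis)
      then show ?thesis
        by (simp add: matrix_vector_mult_def inner_vec_def row_def column_def transpose_def sum.distrib algebra_simps)
    qed
    then show ?thesis
      by (simp add: inner_axis algebra_simps)
  qed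
  then show "(\<lambda>x. (- a * of_real ((A *v x + transpose A *v x) \<bullet> axis i 1) + \<i> * of_real (w \<bullet> axis i 1)) * \<psi> x) \<in> schwartz"
    using S by (simp only:) (intro schwartz_add schwartz_cmult schwartz_linear_form_mult)
next
  show "Re (- a * of_real ((A *v x) \<bullet> x) + \<i> * of_real (w \<bullet> x)) \<le> 0" for x
    using nonneg by auto
qed

lemma norm_increment_le:
  fixes g :: "real \<Rightarrow> 'a::real_normed_vector"
  assumes "0 \<le> t"
    and "\<And>s. 0 \<le> s \<Longrightarrow> s \<le> t \<Longrightarrow> (g has_vector_derivative g' s) (at s)"
    and "\<And>s. 0 \<le> s \<Longrightarrow> s \<le> t \<Longrightarrow> norm (g' s) \<le> b"
  shows "norm (g t - g 0) \<le> t * b"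
proof (cases "t = 0")
  case False
  have "norm (g t - g 0) \<le> b * t - b * 0"
  proof (rule differentiable_bound_general[of 0 t g "\<lambda>s. b * s" g' "\<lambda>_. b"])
    show "continuous_on {0..t} g"
      using assms(2) by (intro continuous_at_imp_continuous_on) (metis atLeastAtMost_iff has_vector_derivative_continuous)
    show "((\<lambda>s. b * s) has_vector_derivative b) (at x)" for x
      by (auto intro!: derivative_eq_intros)
  qed (use assms False in \<open>auto intro!: continuous_intros\<close>)
  then show ?thesis by (simp add: mult.commute)
qed simp

lemma schwartz_has_vector_derivative_line:
  assumes "\<phi> \<in> schwartz" and "(c has_vector_derivative c') (at s)"
  shows "((\<lambda>s. \<phi> (c s)) has_vector_derivative (\<Sum>i\<in>UNIV. of_real (c' $ i) * partial_deriv i \<phi> (c s))) (at s)"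
proof -
  have "((\<lambda>s. \<phi> (c s)) has_derivative (\<lambda>h. \<Sum>i\<in>UNIV. of_real ((h *\<^sub>R c') $ i) * partial_deriv i \<phi> (c s))) (at s)"
    using assms(2) schwartz_has_derivative[OF assms(1)] unfolding has_vector_derivative_def
    by (rule has_derivative_compose)
  then show ?thesis
    unfolding has_vector_derivative_def vector_scaleR_component
    by (rule has_derivative_eq_rhs) (simp add: fun_eq_iff scaleR_conv_of_real[where 'a=complex] sum_distrib_left mult.assoc)
qed

lemma shifted_decay:
  fixes x y :: "'a::real_normed_vector"
  assumes "norm (x - y) \<le> 1" "M \<ge> 0"
  shows "M / (1 + norm y) ^ k \<le> (2 ^ k * M) / (1 + norm x) ^ k"
proof -
  have "1 + norm x \<le> 2 * (1 + norm y)"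
    using assms(1) norm_triangle_sub[of x y] norm_ge_zero[of y] unfolding distrib_left by linarith
  then have "(1 + norm x) ^ k \<le> (2 * (1 + norm y)) ^ k"
    by (intro power_mono) auto
  also have "\<dots> = 2 ^ k * (1 + norm y) ^ k"
    by (rule power_mult_distrib)
  finally have "M * (1 + norm x) ^ k \<le> M * (2 ^ k * (1 + norm y) ^ k)"
    using assms(2) by (rule mult_left_mono)
  moreover have "0 < (1 + norm x) ^ k" "0 < (1 + norm y) ^ k"
    by (auto intro!: zero_less_power add_pos_nonneg)
  ultimately show ?thesis
    by (simp add: field_simps)
qed

lemma has_vector_derivative_quotient:
  assumes "(g has_vector_derivative d) (at 0)"
  shows "((\<lambda>s. (g s - g 0) /\<^sub>R s) \<longlongrightarrow> d) (at 0)"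
proof -
  have "((\<lambda>h. norm (g (0 + h) - g 0 - h *\<^sub>R d) / norm h) \<longlongrightarrow> 0) (at 0)"
    using assms unfolding has_vector_derivative_def has_derivative_at by blast
  moreover have "\<forall>\<^sub>F h in at 0. norm (g (0 + h) - g 0 - h *\<^sub>R d) / norm h = norm ((g h - g 0) /\<^sub>R h - d)"
    unfolding eventually_at
  proof (intro exI[of _ 1] conjI ballI impI)
    fix h :: real assume "h \<noteq> 0 \<and> dist h 0 < 1"
    then have "(g h - g 0) /\<^sub>R h - d = (g h - g 0 - h *\<^sub>R d) /\<^sub>R h"
      by (simp add: scaleR_right_diff_distrib)
    then show "norm (g (0 + h) - g 0 - h *\<^sub>R d) / norm h = norm ((g h - g 0) /\<^sub>R h - d)"
      by (simp add: divide_inverse mult.commute)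
  qed simp
  ultimately have "((\<lambda>h. norm ((g h - g 0) /\<^sub>R h - d)) \<longlongrightarrow> 0) (at 0)"
    by (rule Lim_transform_eventually)
  then show ?thesis
    by (simp add: tendsto_norm_zero_iff LIM_zero_iff)
qed

text \<open>Lebesgue measure is translation invariant, so the integrals of difference quotients vanish.\<close>

lemma integral_partial_deriv:
  fixes \<phi> :: "real^'n \<Rightarrow> complex"
  assumes S: "\<phi> \<in> schwartz"
  shows "(LINT x|lborel. partial_deriv i \<phi> x) = 0"
proof -
  note [measurable] = schwartz_measurable[OF S] schwartz_measurable[OF schwartz_partial_deriv[OF S]]
  let ?e = "axis i 1 :: real^'n" and ?N = "CARD('n) + 2"
  define h where "h n = 1 / real (Suc n)" for n
  have h: "0 < h n" "h n \<le> 1" for n by (simp_all add: h_def)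
  define q where "q n x = (\<phi> (x + h n *\<^sub>R ?e) - \<phi> x) /\<^sub>R h n" for n x
  have [measurable]: "q n \<in> borel_measurable borel" for n
    unfolding q_def[abs_def] by measurable
  have line: "((\<lambda>s. \<phi> (x + s *\<^sub>R ?e)) has_vector_derivative partial_deriv i \<phi> (x + s *\<^sub>R ?e)) (at s)" for x s
  proof -
    have "((\<lambda>s. x + s *\<^sub>R ?e) has_vector_derivative ?e) (at s)"
      by (auto intro!: derivative_eq_intros)
    then show ?thesis
      using schwartz_has_vector_derivative_line[OF S] by fastforce
  qed
  obtain M where M: "M > 0" "\<And>x. norm (partial_deriv i \<phi> x) \<le> M / (1 + norm x) ^ ?N"
    using schwartz_decay[OF schwartz_partial_deriv[OF S]] by metis
  have "(\<lambda>n. LINT x|lborel. q n x) \<longlonglongrightarrow> (LINT x|lborel. partial_deriv i \<phi> x)"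
  proof (rule integral_dominated_convergence)
    \<comment> \<open>The factor \<open>2 ^ ?N\<close> pays for a shift of the argument by at most one.\<close>
    show "integrable lborel (\<lambda>x::real^'n. (2 ^ ?N * M) * (1 / (1 + norm x) ^ ?N))"
      using integrable_inverse_power[where 'a="real^'n"] by (intro integrable_mult_right) simp
    show "AE x in lborel. (\<lambda>n. q n x) \<longlonglongrightarrow> partial_deriv i \<phi> x"
    proof (rule AE_I2)
      fix x
      have "((\<lambda>s. (\<phi> (x + s *\<^sub>R ?e) - \<phi> x) /\<^sub>R s) \<longlongrightarrow> partial_deriv i \<phi> x) (at 0)"
        using has_vector_derivative_quotient[OF line[of x 0]] by simp
      moreover have "filterlim h (at 0) sequentially"
        using h(1) LIMSEQ_inverse_real_of_nat unfolding filterlim_at h_def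
        by (auto simp: inverse_eq_divide intro!: always_eventually)
      ultimately show "(\<lambda>n. q n x) \<longlonglongrightarrow> partial_deriv i \<phi> x"
        unfolding q_def by (rule filterlim_compose)
    qed
    show "AE x in lborel. norm (q n x) \<le> (2 ^ ?N * M) * (1 / (1 + norm x) ^ ?N)" for n
    proof (rule AE_I2)
      fix x
      have "norm (\<phi> (x + h n *\<^sub>R ?e) - \<phi> (x + 0 *\<^sub>R ?e)) \<le> h n * ((2 ^ ?N * M) / (1 + norm x) ^ ?N)"
      proof (rule norm_increment_le[OF _ line])
        fix s assume s: "0 \<le> s" "s \<le> h n"
        have "norm (x - (x + s *\<^sub>R ?e)) \<le> 1"
          using s h(2)[of n] by simp
        then show "norm (partial_deriv i \<phi> (x + s *\<^sub>R ?e)) \<le> (2 ^ ?N * M) / (1 + norm x) ^ ?N"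
          using shifted_decay[of x "x + s *\<^sub>R ?e" M ?N] M(1) M(2)[of "x + s *\<^sub>R ?e"] by linarith
      qed (use h in \<open>auto intro: less_imp_le\<close>)
      then show "norm (q n x) \<le> (2 ^ ?N * M) * (1 / (1 + norm x) ^ ?N)"
      proof -
        assume le: "norm (\<phi> (x + h n *\<^sub>R ?e) - \<phi> (x + 0 *\<^sub>R ?e)) \<le> h n * ((2 ^ ?N * M) / (1 + norm x) ^ ?N)"
        have "norm (q n x) = norm (\<phi> (x + h n *\<^sub>R ?e) - \<phi> (x + 0 *\<^sub>R ?e)) / h n"
          using h(1)[of n] unfolding q_def norm_scaleR by (simp add: divide_inverse mult.commute)
        also have "\<dots> \<le> h n * ((2 ^ ?N * M) / (1 + norm x) ^ ?N) / h n"
          using h(1)[of n] by (intro divide_right_mono le) auto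
        also have "\<dots> = (2 ^ ?N * M) * (1 / (1 + norm x) ^ ?N)"
          using h(1)[of n] by simp
        finally show ?thesis .
      qed
    qed
  qed measurable
  moreover have "(LINT x|lborel. q n x) = 0" for n
  proof -
    have "integrable lborel (\<lambda>x. \<phi> (x + h n *\<^sub>R ?e))"
      using integrable_schwartz[OF S] by (subst integrable_lborel_shift) auto
    then show ?thesis
      unfolding q_def using integrable_schwartz[OF S] by (simp add: integral_lborel_shift)
  qed
  ultimately show ?thesis
    by (simp add: LIMSEQ_const_iff)
qed

lemma real_polynomial_has_derivative:
  fixes P :: "real^'n \<Rightarrow> real"
  assumes "real_polynomial_function P"
  shows "\<exists>P'. (\<forall>i. real_polynomial_function (P' i)) \<and>
    (\<forall>x. (P has_derivative (\<lambda>h. \<Sum>i\<in>UNIV. h $ i * P' i x)) (at x))"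
  using assms
proof induction
  case (linear f)
  have "f h = (\<Sum>i\<in>UNIV. h $ i * f (axis i 1))" for h
  proof -
    have "h = (\<Sum>i\<in>UNIV. h $ i *\<^sub>R axis i 1)"
      by (simp add: vec_eq_iff axis_def if_distrib cong: if_cong)
    then have "f h = f (\<Sum>i\<in>UNIV. h $ i *\<^sub>R axis i 1)"
      by simp
    then show ?thesis
      using linear by (simp add: linear_sum linear_cmul bounded_linear.linear)
  qed
  then have "(f has_derivative (\<lambda>h. \<Sum>i\<in>UNIV. h $ i * f (axis i 1))) (at x)" for x
    using bounded_linear_imp_has_derivative[OF linear] by (metis (no_types, lifting) ext)
  then show ?case
    by (intro exI[of _ "\<lambda>i x. f (axis i 1)"]) auto
next
  case (const c)
  then show ?case
    by (intro exI[of _ "\<lambda>i x. 0"]) auto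
next
  case (add f g)
  then obtain f' g' where "\<forall>i. real_polynomial_function (f' i)" "\<forall>i. real_polynomial_function (g' i)"
    and *: "\<And>x. (f has_derivative (\<lambda>h. \<Sum>i\<in>UNIV. h $ i * f' i x)) (at x)"
      "\<And>x. (g has_derivative (\<lambda>h. \<Sum>i\<in>UNIV. h $ i * g' i x)) (at x)"
    by blast
  then show ?case
    using has_derivative_add[OF *]
    by (intro exI[of _ "\<lambda>i x. f' i x + g' i x"]) (auto simp: sum.distrib distrib_left)
next
  case (mult f g)
  then obtain f' g' where "\<forall>i. real_polynomial_function (f' i)" "\<forall>i. real_polynomial_function (g' i)"
    and *: "\<And>x. (f has_derivative (\<lambda>h. \<Sum>i\<in>UNIV. h $ i * f' i x)) (at x)"
      "\<And>x. (g has_derivative (\<lambda>h. \<Sum>i\<in>UNIV. h $ i * g' i x)) (at x)"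
    by blast
  then show ?case
    using has_derivative_mult[OF *] mult.hyps
    by (intro exI[of _ "\<lambda>i x. f x * g' i x + f' i x * g x"] conjI allI real_polynomial_function.intros(3,4))
      (auto simp: sum.distrib distrib_left sum_distrib_left sum_distrib_right mult_ac)
qed

lemma real_polynomial_growth:
  fixes P :: "'a::real_normed_vector \<Rightarrow> real"
  assumes "real_polynomial_function P"
  shows "\<exists>M d. M > 0 \<and> (\<forall>x. \<bar>P x\<bar> \<le> M * (1 + norm x) ^ d)"
  using assms
proof induction
  case (linear f)
  obtain K where K: "\<And>x. norm (f x) \<le> norm x * K" "K > 0"
    using bounded_linear.pos_bounded[OF linear] by blast
  have "\<bar>f x\<bar> \<le> K * (1 + norm x) ^ 1" for x
    using K(1)[of x] K(2) by (simp add: algebra_simps)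
  with K(2) show ?case by blast
next
  case (const c)
  have "\<bar>c\<bar> \<le> (\<bar>c\<bar> + 1) * (1 + norm x) ^ 0" for x :: 'a by simp
  then show ?case by (intro exI[of _ "\<bar>c\<bar> + 1"] exI[of _ 0]) auto
next
  case (add f g)
  then obtain M d N e where "M > 0" "N > 0" and
    *: "\<And>x. \<bar>f x\<bar> \<le> M * (1 + norm x) ^ d" "\<And>x. \<bar>g x\<bar> \<le> N * (1 + norm x) ^ e" by blast
  have "\<bar>f x + g x\<bar> \<le> (M + N) * (1 + norm x) ^ (d + e)" for x
  proof -
    have "M * (1 + norm x) ^ d \<le> M * (1 + norm x) ^ (d + e)" "N * (1 + norm x) ^ e \<le> N * (1 + norm x) ^ (d + e)"
      using \<open>M > 0\<close> \<open>N > 0\<close> by (auto intro!: mult_left_mono power_increasing)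
    then show ?thesis
      using *(1)[of x] *(2)[of x] by (simp add: distrib_right)
  qed
  with \<open>M > 0\<close> \<open>N > 0\<close> show ?case by (metis add_pos_pos)
next
  case (mult f g)
  then obtain M d N e where "M > 0" "N > 0" and
    *: "\<And>x. \<bar>f x\<bar> \<le> M * (1 + norm x) ^ d" "\<And>x. \<bar>g x\<bar> \<le> N * (1 + norm x) ^ e" by blast
  have "\<bar>f x * g x\<bar> \<le> (M * N) * (1 + norm x) ^ (d + e)" for x
    using mult_mono[OF *(1)[of x] *(2)[of x]] \<open>M > 0\<close> by (simp add: abs_mult power_add mult_ac)
  with \<open>M > 0\<close> \<open>N > 0\<close> show ?case by (metis mult_pos_pos)
qed

text \<open>The inequality \<open>1 + z \<le> exp z\<close> at \<open>z = c y / (k + 1)\<close>, raised to the power \<open>k\<close>; the denominator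
  \<open>k + 1\<close> in place of \<open>k\<close> covers \<open>k = 0\<close>.\<close>

lemma power_le_exp:
  fixes c y :: real
  assumes "c > 0" "y \<ge> 0"
  shows "y ^ k \<le> (real (Suc k) / c) ^ k * exp (c * y)"
proof -
  have "c * y / Suc k \<le> exp (c * y / Suc k)"
    using exp_ge_add_one_self[of "c * y / Suc k"] by linarith
  then have "(c * y / Suc k) ^ k \<le> exp (c * y / Suc k) ^ k"
    using assms by (intro power_mono) auto
  also have "\<dots> = exp (k * (c * y / Suc k))"
    by (rule exp_of_nat_mult[symmetric])
  also have "\<dots> \<le> exp (c * y)"
    using assms by (simp add: field_simps mult_left_mono)
  finally have "(real (Suc k) / c) ^ k * (c * y / Suc k) ^ k \<le> (real (Suc k) / c) ^ k * exp (c * y)"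
    using assms by (intro mult_left_mono) auto
  then show ?thesis
    using assms by (simp flip: power_mult_distrib)
qed

text \<open>The products of \<open>exp (- q)\<close> with polynomials are closed under partial derivatives, and linear growth
  of \<open>q\<close> gives exponential decay, which beats every polynomial.  Besides the Gaussians, this
  provides smooth approximations of the indicators of boxes, with \<open>q\<close> of high degree.\<close>

lemma schwartz_exp_polynomial:
  fixes q :: "real^'n \<Rightarrow> real"
  assumes q: "real_polynomial_function q" and "c > 0" and coercive: "\<And>x. c * norm x - b \<le> q x"
  shows "(\<lambda>x. complex_of_real (exp (- q x))) \<in> schwartz"
proof (rule schwartz_coinduct[where C="{\<lambda>x. complex_of_real (P x * exp (- q x)) |P. real_polynomial_function P}"])
  show "(\<lambda>x. complex_of_real (exp (- q x))) \<in> {\<lambda>x. complex_of_real (P x * exp (- q x)) |P. real_polynomial_function P}"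
    by (intro CollectI exI[of _ "\<lambda>x. 1"]) auto
  fix f :: "real^'n \<Rightarrow> complex" and k
  assume "f \<in> {\<lambda>x. complex_of_real (P x * exp (- q x)) |P. real_polynomial_function P}"
  then obtain P where f: "f = (\<lambda>x. complex_of_real (P x * exp (- q x)))" and P: "real_polynomial_function P" by blast
  obtain P' where P': "\<And>i. real_polynomial_function (P' i)" "\<And>x. (P has_derivative (\<lambda>h. \<Sum>i\<in>UNIV. h $ i * P' i x)) (at x)"
    using real_polynomial_has_derivative[OF P] by blast
  obtain q' where q': "\<And>i. real_polynomial_function (q' i)" "\<And>x. (q has_derivative (\<lambda>h. \<Sum>i\<in>UNIV. h $ i * q' i x)) (at x)"
    using real_polynomial_has_derivative[OF q] by blast
  have *: "(f has_derivative (\<lambda>h. complex_of_real (P x * (exp (- q x) * - (\<Sum>i\<in>UNIV. h $ i * q' i x)) + (\<Sum>i\<in>UNIV. h $ i * P' i x) * exp (- q x)))) (at x)" for x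
    unfolding f
    by (intro has_derivative_of_real has_derivative_mult P' has_derivative_compose[OF has_derivative_minus[OF q'(2)] DERIV_exp[unfolded has_field_derivative_def]])
  then show "f differentiable (at x)" for x
    using differentiable_def by blast
  have "(\<Sum>j\<in>UNIV. (axis i 1 :: real^'n) $ j * c j) = c i" for i c
    by (simp add: axis_def if_distrib[of "\<lambda>x. x * y" for y] cong: if_cong)
  then have "partial_deriv i f = (\<lambda>x. complex_of_real ((P' i x - P x * q' i x) * exp (- q x)))" for i
    by (intro ext) (simp only: partial_deriv_eq[OF *], simp add: algebra_simps)
  moreover have "real_polynomial_function (\<lambda>x. P' i x - P x * q' i x)" for i
    using P P' q' by (intro real_polynomial_function_diff real_polynomial_function.intros(4))
  ultimately show "partial_deriv i f \<in> {\<lambda>x. complex_of_real (P x * exp (- q x)) |P. real_polynomial_function P}" for i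
    by (intro CollectI exI[of _ "\<lambda>x. P' i x - P x * q' i x"] conjI)
  obtain M d where M: "M > 0" "\<And>x. \<bar>P x\<bar> \<le> M * (1 + norm x) ^ d"
    using real_polynomial_growth[OF P] by blast
  have "norm x ^ k * norm (f x) \<le> M * (real (Suc (k + d)) / c) ^ (k + d) * exp (b + c)" for x
  proof -
    have "norm x ^ k * norm (f x) = norm x ^ k * (\<bar>P x\<bar> * exp (- q x))"
      by (simp add: f norm_mult abs_mult)
    also have "\<dots> \<le> (1 + norm x) ^ k * ((M * (1 + norm x) ^ d) * exp (b - c * norm x))"
      using M coercive[of x] by (intro mult_mono power_mono) auto
    also have "\<dots> = M * (1 + norm x) ^ (k + d) * exp (b - c * norm x)"
      by (simp add: power_add)
    also have "\<dots> \<le> M * ((real (Suc (k + d)) / c) ^ (k + d) * exp (c * (1 + norm x))) * exp (b - c * norm x)"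
      using M(1) \<open>c > 0\<close> by (intro mult_right_mono mult_left_mono power_le_exp) auto
    also have "\<dots> = M * (real (Suc (k + d)) / c) ^ (k + d) * (exp (c * (1 + norm x)) * exp (b - c * norm x))"
      by (simp only: mult.assoc)
    also have "exp (c * (1 + norm x)) * exp (b - c * norm x) = exp (b + c)"
      by (simp flip: exp_add add: algebra_simps)
    finally show ?thesis .
  qed
  then show "\<exists>M. \<forall>x. norm x ^ k * norm (f x) \<le> M" by blast
qed

lemma real_polynomial_coord: "real_polynomial_function (\<lambda>x::real^'n. x $ i)"
  by (intro real_polynomial_function.intros(1) bounded_linear_vec_nth)

lemma schwartz_gaussian:
  assumes "a > 0"
  shows "(\<lambda>x::real^'n. complex_of_real (exp (- a * (x \<bullet> x)))) \<in> schwartz"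
proof -
  have "real_polynomial_function (\<lambda>x::real^'n. a * (x \<bullet> x))"
    unfolding inner_vec_def inner_real_def
    by (intro real_polynomial_function.intros(4) real_polynomial_function.intros(2) real_polynomial_function_sum real_polynomial_coord) auto
  moreover have "a * norm x - a \<le> a * (x \<bullet> x)" for x :: "real^'n"
  proof -
    have "norm x \<le> (norm x)\<^sup>2 + 1"
    proof -
      have "2 * norm x \<le> (norm x)\<^sup>2 + 1"
        using zero_le_power2[of "norm x - 1"] unfolding power2_diff by simp
      then show ?thesis
        using norm_ge_zero[of x] by linarith
    qed
    then show ?thesis
      using assms mult_left_mono[of "norm x" "(norm x)\<^sup>2 + 1" a]
      by (simp add: power2_norm_eq_inner algebra_simps)
  qed
  ultimately have "(\<lambda>x::real^'n. complex_of_real (exp (- (a * (x \<bullet> x))))) \<in> schwartz"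
    using assms by (intro schwartz_exp_polynomial[of "\<lambda>x. a * (x \<bullet> x)" a a])
  then show ?thesis by simp
qed

section \<open>Gaussian integrals\<close>

text \<open>By the mean value inequality an integrable bound for the derivative also bounds the difference
  quotients, so dominated convergence applies.\<close>

lemma has_vector_derivative_lborel_integral:
  fixes f :: "real \<Rightarrow> 'a::euclidean_space \<Rightarrow> complex"
  assumes s: "s \<in> {0..1}"
    and int: "\<And>r. r \<in> {0..1} \<Longrightarrow> integrable lborel (f r)"
    and [measurable]: "f' s \<in> borel_measurable borel"
    and der: "\<And>r x. r \<in> {0..1} \<Longrightarrow> ((\<lambda>r. f r x) has_vector_derivative f' r x) (at r)"
    and bound: "\<And>r x. r \<in> {0..1} \<Longrightarrow> norm (f' r x) \<le> b x" and b: "integrable lborel b"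
  shows "((\<lambda>r. LINT x|lborel. f r x) has_vector_derivative (LINT x|lborel. f' s x)) (at s within {0..1})"
proof -
  have incr: "norm (f r x - f q x) \<le> \<bar>r - q\<bar> * b x" if "r \<in> {0..1}" "q \<in> {0..1}" for r q x
  proof -
    have le: "norm (f r x - f q x) \<le> (r - q) * b x" if "q \<le> r" "r \<in> {0..1}" "q \<in> {0..1}" for r q
    proof -
      have "((\<lambda>u. f (q + u) x) has_vector_derivative f' (q + u) x) (at u)" if "0 \<le> u" "u \<le> r - q" for u
      proof -
        have "((\<lambda>u. f u x) \<circ> (\<lambda>u. q + u) has_vector_derivative 1 *\<^sub>R f' (q + u) x) (at u)"
          by (rule vector_diff_chain_at) (use that \<open>r \<in> {0..1}\<close> \<open>q \<in> {0..1}\<close> in \<open>auto intro!: derivative_eq_intros der\<close>)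
        then show ?thesis by (simp add: o_def)
      qed
      moreover have "norm (f' (q + u) x) \<le> b x" if "0 \<le> u" "u \<le> r - q" for u
        using that \<open>r \<in> {0..1}\<close> \<open>q \<in> {0..1}\<close> by (intro bound) auto
      ultimately show ?thesis
        using norm_increment_le[of "r - q" "\<lambda>u. f (q + u) x" "\<lambda>u. f' (q + u) x" "b x"] \<open>q \<le> r\<close> by simp
    qed
    show ?thesis
      using le[of q r] le[of r q] that by (cases "q \<le> r") (auto simp: norm_minus_commute)
  qed
  have "((\<lambda>r. ((LINT x|lborel. f r x) - (LINT x|lborel. f s x)) /\<^sub>R (r - s)) \<longlongrightarrow> (LINT x|lborel. f' s x)) (at s within {0..1})"
    unfolding tendsto_at_iff_sequentially
  proof (intro allI impI)
    fix X :: "nat \<Rightarrow> real" assume X: "\<forall>i. X i \<in> {0..1} - {s}" "X \<longlonglongrightarrow> s"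
    have [measurable]: "f (X n) \<in> borel_measurable borel" "f s \<in> borel_measurable borel" for n
      using int[of "X n"] int[of s] X(1) s borel_measurable_integrable by (force dest: borel_measurable_integrable)+
    have "(\<lambda>n. LINT x|lborel. (f (X n) x - f s x) /\<^sub>R (X n - s)) \<longlonglongrightarrow> (LINT x|lborel. f' s x)"
    proof (rule integral_dominated_convergence[OF _ _ b])
      show "AE x in lborel. (\<lambda>n. (f (X n) x - f s x) /\<^sub>R (X n - s)) \<longlonglongrightarrow> f' s x"
      proof (rule AE_I2)
        fix x
        have "((\<lambda>u. f u x) \<circ> (\<lambda>u. s + u) has_vector_derivative 1 *\<^sub>R f' (s + 0) x) (at 0)"
          by (rule vector_diff_chain_at) (use der[OF s] in \<open>auto intro!: derivative_eq_intros\<close>)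
        then have "((\<lambda>u. f (s + u) x) has_vector_derivative f' s x) (at 0)"
          by (simp add: o_def)
        from has_vector_derivative_quotient[OF this]
        have "((\<lambda>u. (f (s + u) x - f s x) /\<^sub>R u) \<longlongrightarrow> f' s x) (at 0)"
          by simp
        moreover have "filterlim (\<lambda>n. X n - s) (at 0) sequentially"
          using X by (auto simp: filterlim_at LIM_zero_iff intro!: always_eventually)
        ultimately have "(\<lambda>n. (f (s + (X n - s)) x - f s x) /\<^sub>R (X n - s)) \<longlonglongrightarrow> f' s x"
          by (rule filterlim_compose)
        then show "(\<lambda>n. (f (X n) x - f s x) /\<^sub>R (X n - s)) \<longlonglongrightarrow> f' s x" by simp
      qed
      show "AE x in lborel. norm ((f (X n) x - f s x) /\<^sub>R (X n - s)) \<le> b x" for n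
      proof (rule AE_I2)
        fix x
        have "X n \<noteq> s" "X n \<in> {0..1}" using X(1) by auto
        then show "norm ((f (X n) x - f s x) /\<^sub>R (X n - s)) \<le> b x"
          using incr[of "X n" s x] s by (simp add: divide_simps mult.commute)
      qed
    qed measurable
    moreover have "(LINT x|lborel. (f (X n) x - f s x) /\<^sub>R (X n - s)) = ((LINT x|lborel. f (X n) x) - (LINT x|lborel. f s x)) /\<^sub>R (X n - s)" for n
      using int[of "X n"] int[of s] X(1) s by (simp add: Bochner_Integration.integral_diff)
    ultimately show "((\<lambda>r. ((LINT x|lborel. f r x) - (LINT x|lborel. f s x)) /\<^sub>R (r - s)) \<circ> X) \<longlonglongrightarrow> (LINT x|lborel. f' s x)"
      by (simp only: o_def)
  qed
  then have "((\<lambda>r. norm (((LINT x|lborel. f r x) - (LINT x|lborel. f s x)) /\<^sub>R (r - s) - (LINT x|lborel. f' s x))) \<longlongrightarrow> 0) (at s within {0..1})"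
    by (intro tendsto_norm_zero LIM_zero)
  moreover have "\<forall>\<^sub>F r in at s within {0..1}. norm (((LINT x|lborel. f r x) - (LINT x|lborel. f s x)) /\<^sub>R (r - s) - (LINT x|lborel. f' s x)) =
      norm ((LINT x|lborel. f r x) - (LINT x|lborel. f s x) - (r - s) *\<^sub>R (LINT x|lborel. f' s x)) / norm (r - s)"
    unfolding eventually_at
  proof (intro exI[of _ 1] conjI ballI impI)
    fix r assume "r \<noteq> s \<and> dist r s < 1"
    then have "((LINT x|lborel. f r x) - (LINT x|lborel. f s x)) /\<^sub>R (r - s) - (LINT x|lborel. f' s x)
       = ((LINT x|lborel. f r x) - (LINT x|lborel. f s x) - (r - s) *\<^sub>R (LINT x|lborel. f' s x)) /\<^sub>R (r - s)"
      by (simp add: scaleR_right_diff_distrib)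
    then show "norm (((LINT x|lborel. f r x) - (LINT x|lborel. f s x)) /\<^sub>R (r - s) - (LINT x|lborel. f' s x)) =
      norm ((LINT x|lborel. f r x) - (LINT x|lborel. f s x) - (r - s) *\<^sub>R (LINT x|lborel. f' s x)) / norm (r - s)"
      by (simp only:) (simp add: divide_inverse mult.commute)
  qed simp
  ultimately have "((\<lambda>r. norm ((LINT x|lborel. f r x) - (LINT x|lborel. f s x) - (r - s) *\<^sub>R (LINT x|lborel. f' s x)) / norm (r - s)) \<longlongrightarrow> 0) (at s within {0..1})"
    by (rule Lim_transform_eventually)
  then have "((\<lambda>r. (1 / norm (r - s)) *\<^sub>R ((LINT x|lborel. f r x) - ((LINT x|lborel. f s x) + (r - s) *\<^sub>R (LINT x|lborel. f' s x)))) \<longlongrightarrow> 0) (at s within {0..1})"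
    by - (rule tendsto_norm_zero_cancel, simp only: norm_scaleR diff_diff_eq, simp)
  then show ?thesis
    unfolding has_vector_derivative_def has_derivative_within by (intro conjI bounded_linear_scaleR_left)
qed

lemma integral_gaussian_real:
  "(LINT x|lborel. exp (- ((x::real^'n) \<bullet> x))) = sqrt pi ^ CARD('n)"
proof -
  have even: "has_bochner_integral lborel (\<lambda>x::real. exp (- x\<^sup>2)) (sqrt pi)"
    using has_bochner_integral_even_function[OF gaussian_moment_0] by simp
  then have one: "(\<integral>\<^sup>+x. ennreal (exp (- x\<^sup>2)) \<partial>lborel) = ennreal (sqrt pi)"
    by (subst nn_integral_eq_integral) (auto simp: has_bochner_integral_iff)
  have "(\<integral>\<^sup>+x. ennreal (exp (- ((x::real^'n) \<bullet> x))) \<partial>lborel) = (\<integral>\<^sup>+x. (\<Prod>b\<in>Basis. ennreal (exp (- ((x::real^'n) \<bullet> b)\<^sup>2))) \<partial>lborel)"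
    by (simp add: prod_ennreal exp_sum[symmetric] sum_negf euclidean_inner[of x x for x :: "real^'n"] power2_eq_square)
  also have "\<dots> = (\<Prod>b\<in>(Basis :: (real^'n) set). ennreal (sqrt pi))"
    by (subst nn_integral_lborel_prod) (simp_all only: one, auto)
  also have "\<dots> = ennreal (sqrt pi ^ CARD('n))"
    by (simp add: ennreal_power)
  finally show ?thesis
    by (subst integral_eq_nn_integral) auto
qed

text \<open>The Gaussian is kept together with the plane wave, so that its integral is its Fourier transform at \<open>w\<close>.\<close>

definition gauss :: "complex \<Rightarrow> real^'n \<Rightarrow> real^'n \<Rightarrow> complex"
  where "gauss a w x = exp (- a * of_real (x \<bullet> x) + \<i> * of_real (w \<bullet> x))"

lemma gauss_schwartz:
  assumes "Re a > 0" shows "gauss a w \<in> (schwartz :: (real^'n \<Rightarrow> complex) set)"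
proof -
  define b where "b = Re a / 2"
  have "(\<lambda>x::real^'n. exp (- (a - of_real b) * of_real ((mat 1 *v x) \<bullet> x) + \<i> * of_real (w \<bullet> x)) * complex_of_real (exp (- b * (x \<bullet> x)))) \<in> schwartz"
    using assms by (intro schwartz_quadratic_exp_mult schwartz_gaussian) (auto simp: b_def)
  also have "(\<lambda>x::real^'n. exp (- (a - of_real b) * of_real ((mat 1 *v x) \<bullet> x) + \<i> * of_real (w \<bullet> x)) * complex_of_real (exp (- b * (x \<bullet> x)))) = gauss a w"
    by (simp add: fun_eq_iff gauss_def exp_of_real[symmetric] exp_add[symmetric] algebra_simps)
  finally show ?thesis .
qed

lemma has_derivative_gauss:
  "(gauss a w has_derivative (\<lambda>h. gauss a w x * (- a * of_real (2 * (x \<bullet> h)) + \<i> * of_real (w \<bullet> h)))) (at x)"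
proof -
  have "((\<lambda>x. - a * of_real (x \<bullet> x) + \<i> * of_real (w \<bullet> x)) has_derivative
      (\<lambda>h. - a * of_real (x \<bullet> h + h \<bullet> x) + \<i> * of_real (w \<bullet> h))) (at x)"
    by (intro has_derivative_add has_derivative_mult_right has_derivative_of_real has_derivative_inner_right
        has_derivative_inner has_derivative_ident)
  moreover have "x \<bullet> h + h \<bullet> x = 2 * (x \<bullet> h)" for h
    by (simp add: inner_commute)
  ultimately have "((\<lambda>x. - a * of_real (x \<bullet> x) + \<i> * of_real (w \<bullet> x)) has_derivative
      (\<lambda>h. - a * of_real (2 * (x \<bullet> h)) + \<i> * of_real (w \<bullet> h))) (at x)"
    by (simp only:)
  then have "((\<lambda>x. exp (- a * of_real (x \<bullet> x) + \<i> * of_real (w \<bullet> x))) has_derivative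
      (\<lambda>h. exp (- a * of_real (x \<bullet> x) + \<i> * of_real (w \<bullet> x)) * (- a * of_real (2 * (x \<bullet> h)) + \<i> * of_real (w \<bullet> h)))) (at x)"
    by (rule has_derivative_compose[OF _ DERIV_exp[unfolded has_field_derivative_def]])
  then show ?thesis
    unfolding gauss_def[abs_def] .
qed

text \<open>The first two moments follow from the vanishing integrals of the partial derivatives of
  \<open>gauss a w\<close> and of \<open>x $ i\<close> times it.\<close>

lemma
  fixes w :: "real^'n"
  assumes a: "Re a > 0"
  shows integral_gauss_coord: "(LINT x|lborel. of_real (x $ i) * gauss a w x) = \<i> * of_real (w $ i) / (2 * a) * (LINT x|lborel. gauss a w x)"
    and integral_gauss_coord_sq: "(LINT x|lborel. of_real (x $ i) * (of_real (x $ i) * gauss a w x)) =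
      (1 / (2 * a) - of_real ((w $ i)\<^sup>2) / (4 * a\<^sup>2)) * (LINT x|lborel. gauss a w x)"
proof -
  note S = gauss_schwartz[OF a, of w]
  have [simp]: "a \<noteq> 0" using a by auto
  have pd: "partial_deriv i (gauss a w) x = - (2 * a) * (of_real (x $ i) * gauss a w x) + \<i> * of_real (w $ i) * gauss a w x" for x
    by (simp add: partial_deriv_eq[OF has_derivative_gauss] inner_axis algebra_simps)
  note I = integrable_schwartz[OF S] integrable_schwartz[OF schwartz_coord_mult[OF S, of i]]
    integrable_schwartz[OF schwartz_coord_mult[OF schwartz_coord_mult[OF S, of i], of i]]
  have "0 = (LINT x|lborel. - (2 * a) * (of_real (x $ i) * gauss a w x) + \<i> * of_real (w $ i) * gauss a w x)"
    using integral_partial_deriv[OF S, of i] unfolding pd by simp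
  also have "\<dots> = - (2 * a) * (LINT x|lborel. of_real (x $ i) * gauss a w x) + \<i> * of_real (w $ i) * (LINT x|lborel. gauss a w x)"
    using I by (subst Bochner_Integration.integral_add) auto
  finally show 1: "(LINT x|lborel. of_real (x $ i) * gauss a w x) = \<i> * of_real (w $ i) / (2 * a) * (LINT x|lborel. gauss a w x)"
    by (simp add: field_simps)
  have "0 = (LINT x|lborel. gauss a w x + (- (2 * a) * (of_real (x $ i) * (of_real (x $ i) * gauss a w x)) + \<i> * of_real (w $ i) * (of_real (x $ i) * gauss a w x)))"
    using integral_partial_deriv[OF schwartz_coord_mult[OF S, of i], of i] unfolding partial_deriv_coord_mult(1)[OF S] pd
    by (simp add: algebra_simps)
  also have "\<dots> = (LINT x|lborel. gauss a w x) + (- (2 * a) * (LINT x|lborel. of_real (x $ i) * (of_real (x $ i) * gauss a w x))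
      + \<i> * of_real (w $ i) * (LINT x|lborel. of_real (x $ i) * gauss a w x))"
    using I by (subst Bochner_Integration.integral_add, simp, simp, subst Bochner_Integration.integral_add) auto
  finally show "(LINT x|lborel. of_real (x $ i) * (of_real (x $ i) * gauss a w x)) =
      (1 / (2 * a) - of_real ((w $ i)\<^sup>2) / (4 * a\<^sup>2)) * (LINT x|lborel. gauss a w x)"
    unfolding 1 by (simp add: field_simps power2_eq_square)
qed

text \<open>Along the segment from the standard Gaussian to the given one the logarithmic derivative
  of the integral is known from the first two moments.  The square root of \<open>a\<close> is the principal
  one because the segment stays in the right half plane.\<close>

lemma integral_gauss:
  fixes w :: "real^'n"
  assumes a: "Re a > 0"
  shows "(LINT x|lborel. gauss a w x) = (of_real (sqrt pi) / csqrt a) ^ CARD('n) * exp (- of_real (w \<bullet> w) / (4 * a))"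
proof -
  let ?m = "CARD('n)"
  define A where "A s = 1 + of_real s * (a - 1)" for s :: real
  define J where "J s = (LINT x|lborel. gauss (A s) (s *\<^sub>R w) x)" for s :: real
  \<comment> \<open>A lower bound for the real part of the width along the segment.\<close>
  define c where "c = min 1 (Re a)"
  have "c > 0" using a by (simp add: c_def)
  have ReA: "Re (A s) \<ge> c" if "s \<in> {0..1}" for s
  proof -
    have "(1 - s) * c + s * c \<le> (1 - s) * 1 + s * Re a"
      using that by (intro add_mono mult_left_mono) (auto simp: c_def)
    then show ?thesis by (simp add: A_def algebra_simps)
  qed
  define k where "k x = - (a - 1) * of_real (x \<bullet> x) + \<i> * of_real (w \<bullet> x)" for x :: "real^'n"
  have gA: "gauss (A s) (s *\<^sub>R w) x = exp (- of_real (x \<bullet> x) + of_real s * k x)" for s x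
    by (simp add: gauss_def A_def k_def algebra_simps)
  have dJ: "(J has_vector_derivative (LINT x|lborel. k x * gauss (A s) (s *\<^sub>R w) x)) (at s within {0..1})" if s: "s \<in> {0..1}" for s
    unfolding J_def[abs_def]
  proof (rule has_vector_derivative_lborel_integral[OF s, where b="\<lambda>x. cmod (k x) * exp (- c * (x \<bullet> x))"])
    show "integrable lborel (gauss (A r) (r *\<^sub>R w))" if "r \<in> {0..1}" for r
      using ReA[OF that] \<open>c > 0\<close> by (intro integrable_schwartz gauss_schwartz) auto
    show "(\<lambda>x. k x * gauss (A s) (s *\<^sub>R w) x) \<in> borel_measurable borel"
      unfolding k_def gauss_def by measurable
    show "((\<lambda>r. gauss (A r) (r *\<^sub>R w) x) has_vector_derivative k x * gauss (A r) (r *\<^sub>R w) x) (at r)" for r x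
    proof -
      have "((\<lambda>z. exp (- of_real (x \<bullet> x) + z * k x)) has_field_derivative exp (- of_real (x \<bullet> x) + of_real r * k x) * k x) (at (of_real r))"
        by (auto intro!: derivative_eq_intros)
      then have "((\<lambda>r. exp (- of_real (x \<bullet> x) + of_real r * k x)) has_vector_derivative exp (- of_real (x \<bullet> x) + of_real r * k x) * k x) (at r)"
        by (rule has_vector_derivative_real_field)
      then show ?thesis by (simp add: gA mult.commute)
    qed
    show "cmod (k x * gauss (A r) (r *\<^sub>R w) x) \<le> cmod (k x) * exp (- c * (x \<bullet> x))" if "r \<in> {0..1}" for r x
    proof -
      have "cmod (gauss (A r) (r *\<^sub>R w) x) = exp (- Re (A r) * (x \<bullet> x))"
        by (simp add: gauss_def)
      also have "\<dots> \<le> exp (- c * (x \<bullet> x))"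
        using ReA[OF that] by (simp add: mult_right_mono)
      finally show ?thesis
        by (simp add: norm_mult mult_left_mono)
    qed
    have "(\<lambda>x. k x * gauss (of_real c) 0 x) \<in> schwartz"
    proof -
      have "(\<lambda>x. k x * gauss (of_real c) 0 x) = (\<lambda>x. (\<Sum>i\<in>UNIV. - (a - 1) * (of_real (x $ i) * (of_real (x $ i) * gauss (of_real c) 0 x))) + \<i> * (of_real (w \<bullet> x) * gauss (of_real c) 0 x))"
        by (simp add: fun_eq_iff k_def inner_vec_def[of x x for x :: "real^'n"] sum_distrib_left sum_distrib_right algebra_simps sum_subtractf)
      then show ?thesis
        using gauss_schwartz[of "of_real c" 0] \<open>c > 0\<close>
        by (simp only:) (intro schwartz_add schwartz_sum schwartz_cmult schwartz_coord_mult schwartz_linear_form_mult, auto)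
    qed
    then have "integrable lborel (\<lambda>x. norm (k x * gauss (of_real c) 0 x))"
      by (intro integrable_norm integrable_schwartz)
    then show "integrable lborel (\<lambda>x. cmod (k x) * exp (- c * (x \<bullet> x)))"
      by (simp add: norm_mult gauss_def)
  qed
  have JD: "(LINT x|lborel. k x * gauss (A s) (s *\<^sub>R w) x) =
      J s * (- (a - 1) * (?m / (2 * A s) - of_real (s\<^sup>2 * (w \<bullet> w)) / (4 * (A s)\<^sup>2)) - of_real (s * (w \<bullet> w)) / (2 * A s))"
    if s: "s \<in> {0..1}" for s
  proof -
    let ?g = "gauss (A s) (s *\<^sub>R w)"
    have Re: "Re (A s) > 0" using ReA[OF s] \<open>c > 0\<close> by simp
    note S = gauss_schwartz[OF Re, of "s *\<^sub>R w"]
    have "(LINT x|lborel. k x * ?g x) = (LINT x|lborel. (\<Sum>i\<in>UNIV. - (a - 1) * (of_real (x $ i) * (of_real (x $ i) * ?g x)) + \<i> * of_real (w $ i) * (of_real (x $ i) * ?g x)))"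
      by (rule Bochner_Integration.integral_cong)
        (simp_all add: k_def inner_vec_def sum_distrib_left sum_distrib_right sum.distrib algebra_simps sum_subtractf)
    also have "\<dots> = (\<Sum>i\<in>UNIV. - (a - 1) * (LINT x|lborel. of_real (x $ i) * (of_real (x $ i) * ?g x)) + \<i> * of_real (w $ i) * (LINT x|lborel. of_real (x $ i) * ?g x))"
      using integrable_schwartz[OF schwartz_coord_mult[OF S]] integrable_schwartz[OF schwartz_coord_mult[OF schwartz_coord_mult[OF S]]]
      by (subst Bochner_Integration.integral_sum, simp, intro sum.cong refl, subst Bochner_Integration.integral_add) auto
    also have "\<dots> = (\<Sum>i\<in>UNIV. J s * (- (a - 1) / (2 * A s)) + of_real (w $ i * w $ i) * (J s * ((a - 1) * of_real (s\<^sup>2) / (4 * (A s)\<^sup>2) - of_real s / (2 * A s))))"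
      unfolding integral_gauss_coord[OF Re] integral_gauss_coord_sq[OF Re] J_def[symmetric]
      by (intro sum.cong refl) (simp add: algebra_simps power2_eq_square power_mult_distrib add_divide_distrib diff_divide_distrib)
    also have "\<dots> = J s * (- (a - 1) / (2 * A s)) * ?m + of_real (w \<bullet> w) * (J s * ((a - 1) * of_real (s\<^sup>2) / (4 * (A s)\<^sup>2) - of_real s / (2 * A s)))"
      by (simp add: sum.distrib inner_vec_def[of w w] sum_distrib_right)
    also have "\<dots> = J s * (- (a - 1) * (?m / (2 * A s) - of_real (s\<^sup>2 * (w \<bullet> w)) / (4 * (A s)\<^sup>2)) - of_real (s * (w \<bullet> w)) / (2 * A s))"
      by (simp add: algebra_simps add_divide_distrib diff_divide_distrib)
    finally show ?thesis .
  qed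
  \<comment> \<open>Up to a constant, the reciprocal of the claimed value of \<open>J\<close>; the product \<open>J L\<close> turns out to be constant.\<close>
  define L where "L z = csqrt (1 + z * (a - 1)) ^ ?m * exp (z\<^sup>2 * of_real (w \<bullet> w) / (4 * (1 + z * (a - 1))))" for z
  have dL: "((\<lambda>s. L (of_real s)) has_vector_derivative
     L (of_real s) * ((a - 1) * (?m / (2 * A s) - of_real (s\<^sup>2 * (w \<bullet> w)) / (4 * (A s)\<^sup>2)) + of_real (s * (w \<bullet> w)) / (2 * A s))) (at s within {0..1})"
    if s: "s \<in> {0..1}" for s
  proof -
    have Re: "Re (A s) > 0" using ReA[OF s] \<open>c > 0\<close> by simp
    then have n: "A s \<noteq> 0" "A s \<notin> \<real>\<^sub>\<le>\<^sub>0" by (auto simp: complex_nonpos_Reals_iff)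
    have sq: "csqrt (A s) * csqrt (A s) = A s"
      using power2_csqrt[of "A s"] by (simp add: power2_eq_square)
    have n': "csqrt (A s) \<noteq> 0" using n by simp
    have pw: "csqrt (A s) ^ (?m - Suc 0) = csqrt (A s) ^ ?m / csqrt (A s)"
      using n' by (simp add: power_diff)
    have d1: "((\<lambda>z. csqrt (1 + z * (a - 1)) ^ ?m) has_field_derivative csqrt (A s) ^ ?m * ((a - 1) * ?m / (2 * A s))) (at (of_real s))"
      using n unfolding A_def
      by (auto intro!: derivative_eq_intros simp: A_def[symmetric] pw) (simp add: field_simps n' sq)
    have d2: "((\<lambda>z. exp (z\<^sup>2 * of_real (w \<bullet> w) / (4 * (1 + z * (a - 1))))) has_field_derivative
        exp ((of_real s)\<^sup>2 * of_real (w \<bullet> w) / (4 * A s)) * (of_real (s * (w \<bullet> w)) / (2 * A s) - (a - 1) * (of_real (s\<^sup>2 * (w \<bullet> w)) / (4 * (A s)\<^sup>2)))) (at (of_real s))"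
    proof -
      have num: "((\<lambda>z. z\<^sup>2 * of_real (w \<bullet> w)) has_field_derivative 2 * of_real s * of_real (w \<bullet> w)) (at (of_real s :: complex))"
        by (auto intro!: derivative_eq_intros)
      have den: "((\<lambda>z. 4 * (1 + z * (a - 1))) has_field_derivative 4 * (a - 1)) (at (of_real s))"
        by (auto intro!: derivative_eq_intros)
      have As: "1 + of_real s * (a - 1) = A s" by (simp add: A_def)
      have "4 * (1 + of_real s * (a - 1)) \<noteq> 0" using n As by simp
      note DERIV_chain2[OF DERIV_exp DERIV_divide[OF num den this], unfolded As]
      then show ?thesis
        by (rule DERIV_cong) (use n in \<open>simp add: field_simps power2_eq_square\<close>)
    qed
    have "(L has_field_derivative L (of_real s) * ((a - 1) * (?m / (2 * A s) - of_real (s\<^sup>2 * (w \<bullet> w)) / (4 * (A s)\<^sup>2)) + of_real (s * (w \<bullet> w)) / (2 * A s))) (at (of_real s))"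
    proof -
      have As: "1 + of_real s * (a - 1) = A s" by (simp add: A_def)
      have Ls: "L (of_real s) = csqrt (A s) ^ ?m * exp ((of_real s)\<^sup>2 * of_real (w \<bullet> w) / (4 * A s))"
        by (simp add: L_def As)
      have sum_eq: "(a - 1) * (?m / (2 * A s) - of_real (s\<^sup>2 * (w \<bullet> w)) / (4 * (A s)\<^sup>2)) + of_real (s * (w \<bullet> w)) / (2 * A s)
          = (a - 1) * ?m / (2 * A s) + (of_real (s * (w \<bullet> w)) / (2 * A s) - (a - 1) * (of_real (s\<^sup>2 * (w \<bullet> w)) / (4 * (A s)\<^sup>2)))"
        by (simp add: right_diff_distrib)
      have product: "X * p * Y + Y * q * X = X * Y * (p + q)" for X Y p q :: complex
        by (simp add: algebra_simps)
      show ?thesis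
        unfolding L_def[abs_def] sum_eq Ls[unfolded L_def]
        by (rule DERIV_cong[OF DERIV_mult[OF d1 d2]]) (simp only: As product)
    qed
    then have "((\<lambda>s. L (of_real s)) has_vector_derivative L (of_real s) * ((a - 1) * (?m / (2 * A s) - of_real (s\<^sup>2 * (w \<bullet> w)) / (4 * (A s)\<^sup>2)) + of_real (s * (w \<bullet> w)) / (2 * A s))) (at s)"
      by (rule has_vector_derivative_real_field)
    then show ?thesis by (rule has_vector_derivative_at_within)
  qed
  have "((\<lambda>s. J s * L (of_real s)) has_derivative (\<lambda>h. 0)) (at s within {0..1})" if s: "s \<in> {0..1}" for s
  proof -
    have cancel: "j * (l * ((a - 1) * z + y)) + j * (- (a - 1) * z - y) * l = 0" for j l z y :: complex
      by (simp add: algebra_simps)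
    show ?thesis
      using has_vector_derivative_mult[OF dJ[OF s, unfolded JD[OF s]] dL[OF s]]
      unfolding cancel has_vector_derivative_def by simp
  qed
  then obtain K where K: "\<And>s. s \<in> {0..1} \<Longrightarrow> J s * L (of_real s) = K"
    using has_derivative_zero_constant[of "{0..1::real}" "\<lambda>s. J s * L (of_real s)"] by (auto simp: convex_real_interval)
  have "J 0 = of_real (LINT x|lborel. exp (- ((x::real^'n) \<bullet> x)))"
    unfolding integral_complex_of_real[symmetric] J_def
    by (intro Bochner_Integration.integral_cong) (simp_all add: gauss_def A_def exp_of_real[symmetric])
  then have "J 0 = of_real (sqrt pi) ^ ?m"
    by (simp add: integral_gaussian_real)
  then have eq: "J 1 * (csqrt a ^ ?m * exp (of_real (w \<bullet> w) / (4 * a))) = of_real (sqrt pi) ^ ?m"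
    using K[of 0] K[of 1] by (simp add: L_def)
  have "csqrt a \<noteq> 0" using a by auto
  have "J 1 = J 1 * (csqrt a ^ ?m * exp (of_real (w \<bullet> w) / (4 * a))) * (exp (- of_real (w \<bullet> w) / (4 * a)) / csqrt a ^ ?m)"
    using \<open>csqrt a \<noteq> 0\<close> by (simp add: exp_minus field_simps)
  also have "\<dots> = (of_real (sqrt pi) / csqrt a) ^ ?m * exp (- of_real (w \<bullet> w) / (4 * a))"
    unfolding eq by (simp add: power_divide)
  finally show ?thesis
    by (simp add: J_def A_def)
qed

section \<open>The Fourier transform on the Schwartz space\<close>

lemma integrable_lborel_pair_bound:
  fixes f :: "'a::euclidean_space \<Rightarrow> 'b::euclidean_space \<Rightarrow> complex"
  assumes [measurable]: "(\<lambda>(x, y). f x y) \<in> borel_measurable (lborel \<Otimes>\<^sub>M lborel)"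
    and g: "integrable lborel g" and h: "integrable lborel h"
    and le: "\<And>x y. norm (f x y) \<le> g x * h y"
  shows "integrable (lborel \<Otimes>\<^sub>M lborel) (\<lambda>(x, y). f x y)"
proof (rule Bochner_Integration.integrable_bound)
  have [measurable]: "g \<in> borel_measurable borel" "h \<in> borel_measurable borel"
    using g h by (auto dest: borel_measurable_integrable)
  show "integrable (lborel \<Otimes>\<^sub>M lborel) (\<lambda>z. g (fst z) * h (snd z))"
  proof (rule lborel_pair.Fubini_integrable)
    show "integrable lborel (\<lambda>x. LINT y|lborel. norm (g (fst (x, y)) * h (snd (x, y))))"
      using g by (simp add: abs_mult integrable_mult_left)
    show "AE x in lborel. integrable lborel (\<lambda>y. g (fst (x, y)) * h (snd (x, y)))"
      using h by simp
  qed measurable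
  show "AE z in lborel \<Otimes>\<^sub>M lborel. norm (case z of (x, y) \<Rightarrow> f x y) \<le> norm (g (fst z) * h (snd z))"
    by (rule AE_I2) (auto simp: split_beta intro: order_trans[OF le abs_ge_self])
qed measurable

text \<open>The sign in the exponent is the positive one; the normalisation makes the transform unitary.\<close>

definition fourier :: "(real^'n \<Rightarrow> complex) \<Rightarrow> real^'n \<Rightarrow> complex" where
  "fourier \<phi> \<xi> = of_real ((2 * pi) powr (- real CARD('n) / 2)) * (LINT x|lborel. exp (\<i> * of_real (\<xi> \<bullet> x)) * \<phi> x)"

lemma fourier_const_power2: "((2 * pi) powr (- real n / 2))\<^sup>2 = 1 / (2 * pi) ^ n"
proof -
  have "((2 * pi) powr (- real n / 2))\<^sup>2 = (2 * pi) powr (- real n / 2 + - real n / 2)"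
    unfolding power2_eq_square by (rule powr_add[symmetric])
  also have "\<dots> = 1 / (2 * pi) ^ n"
    by (simp add: powr_minus_divide powr_realpow)
  finally show ?thesis .
qed

lemma plane_wave_mult_schwartz:
  "\<phi> \<in> schwartz \<Longrightarrow> (\<lambda>x. exp (\<i> * of_real (w \<bullet> x)) * \<phi> x) \<in> schwartz"
  using schwartz_quadratic_exp_mult[of \<phi> 0 "mat 1" w] by simp

text \<open>The Taylor remainder \<open>\<bar>exp (i s) - 1 - i s\<bar> \<le> s\<^sup>2 / 2\<close> with \<open>s = \<langle>h, x\<rangle>\<close> bounds the error by
  \<open>\<bar>h\<bar>\<^sup>2\<close> times the integral of \<open>\<bar>x\<bar>\<^sup>2 \<bar>\<phi>(x)\<bar>\<close>.\<close>

lemma fourier_has_derivative: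
  fixes \<phi> :: "real^'n \<Rightarrow> complex"
  assumes S: "\<phi> \<in> schwartz"
  shows "(fourier \<phi> has_derivative (\<lambda>h. \<Sum>i\<in>UNIV. of_real (h $ i) * fourier (\<lambda>x. \<i> * (of_real (x $ i) * \<phi> x)) \<xi>)) (at \<xi>)"
proof -
  define c where "c = complex_of_real ((2 * pi) powr (- real CARD('n) / 2))"
  define D where "D h = (\<Sum>i\<in>UNIV. of_real (h $ i) * fourier (\<lambda>x. \<i> * (of_real (x $ i) * \<phi> x)) \<xi>)" for h :: "real^'n"
  define K where "K = norm c * (LINT x|lborel. (norm x)\<^sup>2 * norm (\<phi> x))"
  note [measurable] = schwartz_measurable[OF S]
  have int: "integrable lborel (\<lambda>x. exp (\<i> * of_real (w \<bullet> x)) * \<psi> x)" if "\<psi> \<in> schwartz" for w :: "real^'n" and \<psi>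
    using that by (intro integrable_schwartz plane_wave_mult_schwartz)
  have D: "D h = c * (LINT x|lborel. exp (\<i> * of_real (\<xi> \<bullet> x)) * (\<i> * (of_real (h \<bullet> x) * \<phi> x)))" for h
  proof -
    have "D h = c * (\<Sum>i\<in>UNIV. of_real (h $ i) * (LINT x|lborel. exp (\<i> * of_real (\<xi> \<bullet> x)) * (\<i> * (of_real (x $ i) * \<phi> x))))"
      by (simp add: D_def fourier_def c_def sum_distrib_left mult_ac)
    also have "\<dots> = c * (LINT x|lborel. (\<Sum>i\<in>UNIV. of_real (h $ i) * (exp (\<i> * of_real (\<xi> \<bullet> x)) * (\<i> * (of_real (x $ i) * \<phi> x)))))"
      using int[OF schwartz_cmult[OF schwartz_coord_mult[OF S]]]
      by (subst Bochner_Integration.integral_sum) auto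
    also have "(\<lambda>x. \<Sum>i\<in>UNIV. of_real (h $ i) * (exp (\<i> * of_real (\<xi> \<bullet> x)) * (\<i> * (of_real (x $ i) * \<phi> x)))) =
        (\<lambda>x. exp (\<i> * of_real (\<xi> \<bullet> x)) * (\<i> * (of_real (h \<bullet> x) * \<phi> x)))"
      by (simp add: fun_eq_iff inner_vec_def sum_distrib_left sum_distrib_right mult_ac)
    finally show ?thesis .
  qed
  have intK: "integrable lborel (\<lambda>x. (norm x)\<^sup>2 * norm (\<phi> x))"
  proof -
    have "integrable lborel (\<lambda>x. \<Sum>i\<in>UNIV. norm (of_real (x $ i) * (of_real (x $ i) * \<phi> x)))"
      using S by (intro Bochner_Integration.integrable_sum integrable_norm integrable_schwartz schwartz_coord_mult)
    then show ?thesis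
      by (simp add: norm_mult power2_norm_eq_inner inner_vec_def sum_distrib_right mult.assoc[symmetric] abs_mult_self_eq)
  qed
  have "norm (fourier \<phi> (\<xi> + h) - fourier \<phi> \<xi> - D h) \<le> (norm h)\<^sup>2 * K" for h
  proof -
    have "fourier \<phi> (\<xi> + h) - fourier \<phi> \<xi> - D h =
        c * (LINT x|lborel. exp (\<i> * of_real ((\<xi> + h) \<bullet> x)) * \<phi> x - exp (\<i> * of_real (\<xi> \<bullet> x)) * \<phi> x - exp (\<i> * of_real (\<xi> \<bullet> x)) * (\<i> * (of_real (h \<bullet> x) * \<phi> x)))"
      unfolding D fourier_def c_def[symmetric] using int[OF S] int[OF schwartz_cmult[OF schwartz_linear_form_mult[OF S]]]
      by (simp add: Bochner_Integration.integral_diff right_diff_distrib)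
    also have "norm \<dots> \<le> norm c * (LINT x|lborel. (norm h)\<^sup>2 * ((norm x)\<^sup>2 * norm (\<phi> x)))"
      unfolding norm_mult
    proof (intro mult_left_mono Bochner_Integration.integral_norm_bound_integral)
      show "integrable lborel (\<lambda>x. exp (\<i> * of_real ((\<xi> + h) \<bullet> x)) * \<phi> x - exp (\<i> * of_real (\<xi> \<bullet> x)) * \<phi> x - exp (\<i> * of_real (\<xi> \<bullet> x)) * (\<i> * (of_real (h \<bullet> x) * \<phi> x)))"
        using int[OF S] int[OF schwartz_cmult[OF schwartz_linear_form_mult[OF S]]] by (intro Bochner_Integration.integrable_diff)
      fix x :: "real^'n"
      let ?t = "h \<bullet> x"
      have "exp (\<i> * of_real ((\<xi> + h) \<bullet> x)) * \<phi> x - exp (\<i> * of_real (\<xi> \<bullet> x)) * \<phi> x - exp (\<i> * of_real (\<xi> \<bullet> x)) * (\<i> * (of_real (h \<bullet> x) * \<phi> x))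
          = exp (\<i> * of_real (\<xi> \<bullet> x)) * (exp (\<i> * of_real ?t) - (1 + \<i> * of_real ?t)) * \<phi> x"
        by (simp add: inner_add_left distrib_left exp_add algebra_simps)
      then have "norm (exp (\<i> * of_real ((\<xi> + h) \<bullet> x)) * \<phi> x - exp (\<i> * of_real (\<xi> \<bullet> x)) * \<phi> x - exp (\<i> * of_real (\<xi> \<bullet> x)) * (\<i> * (of_real (h \<bullet> x) * \<phi> x)))
          = norm (exp (\<i> * of_real ?t) - (1 + \<i> * of_real ?t)) * norm (\<phi> x)"
        by (simp add: norm_mult)
      also have "norm (exp (\<i> * of_real ?t) - (1 + \<i> * of_real ?t)) \<le> ?t\<^sup>2 / 2"
        using iexp_approx1[of ?t 1] by (simp add: numeral_2_eq_2)
      also have "?t\<^sup>2 / 2 \<le> (norm h * norm x)\<^sup>2"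
      proof -
        have "?t\<^sup>2 \<le> (norm h * norm x)\<^sup>2"
          using power_mono[OF Cauchy_Schwarz_ineq2[of h x] abs_ge_zero, of 2] by simp
        then show ?thesis
          using zero_le_power2[of ?t] by linarith
      qed
      finally show "norm (exp (\<i> * of_real ((\<xi> + h) \<bullet> x)) * \<phi> x - exp (\<i> * of_real (\<xi> \<bullet> x)) * \<phi> x - exp (\<i> * of_real (\<xi> \<bullet> x)) * (\<i> * (of_real (h \<bullet> x) * \<phi> x)))
          \<le> (norm h)\<^sup>2 * ((norm x)\<^sup>2 * norm (\<phi> x))"
        by (simp add: power_mult_distrib mult_right_mono mult.assoc[symmetric])
    qed (use intK in auto)
    also have "\<dots> = (norm h)\<^sup>2 * K"
      by (simp add: K_def)
    finally show ?thesis .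
  qed
  then have bound: "norm (norm (fourier \<phi> (\<xi> + h) - fourier \<phi> \<xi> - D h) / norm h) \<le> norm h * K" for h
    by (cases "h = 0") (auto simp: divide_simps power2_eq_square mult_ac)
  have "(\<lambda>h. norm (fourier \<phi> (\<xi> + h) - fourier \<phi> \<xi> - D h) / norm h) \<midarrow>0\<rightarrow> 0"
  proof (rule Lim_null_comparison)
    show "\<forall>\<^sub>F h in at 0. norm (norm (fourier \<phi> (\<xi> + h) - fourier \<phi> \<xi> - D h) / norm h) \<le> norm h * K"
      using bound by (intro always_eventually) auto
    show "((\<lambda>h::real^'n. norm h * K) \<longlongrightarrow> 0) (at 0)"
      by (auto intro!: tendsto_eq_intros)
  qed
  moreover have "bounded_linear D"
    unfolding D_def
    by (intro bounded_linear_sum bounded_linear_mult_const bounded_linear_compose[OF bounded_linear_of_real bounded_linear_vec_nth])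
  ultimately have "(fourier \<phi> has_derivative D) (at \<xi>)"
    unfolding has_derivative_at by blast
  then show ?thesis
    by (simp only: D_def[abs_def])
qed

lemma partial_deriv_fourier:
  assumes "\<phi> \<in> schwartz"
  shows "partial_deriv i (fourier \<phi>) = fourier (\<lambda>x. \<i> * (of_real (x $ i) * \<phi> x))"
  by (rule ext) (simp add: partial_deriv_eq[OF fourier_has_derivative[OF assms]])

lemma partial_deriv_plane_wave_mult:
  assumes "\<phi> \<in> schwartz"
  shows "partial_deriv i (\<lambda>x. exp (\<i> * of_real (w \<bullet> x)) * \<phi> x) =
    (\<lambda>x. exp (\<i> * of_real (w \<bullet> x)) * partial_deriv i \<phi> x + \<i> * of_real (w $ i) * (exp (\<i> * of_real (w \<bullet> x)) * \<phi> x))"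
proof
  fix x
  have "((\<lambda>x. \<i> * of_real (w \<bullet> x)) has_derivative (\<lambda>h. \<i> * of_real (w \<bullet> h))) (at x)"
    by (intro has_derivative_mult_right has_derivative_of_real has_derivative_inner_right has_derivative_ident)
  note product = has_derivative_mult[OF has_derivative_compose[OF this DERIV_exp[unfolded has_field_derivative_def]] schwartz_has_derivative[OF assms]]
  show "partial_deriv i (\<lambda>x. exp (\<i> * of_real (w \<bullet> x)) * \<phi> x) x =
    exp (\<i> * of_real (w \<bullet> x)) * partial_deriv i \<phi> x + \<i> * of_real (w $ i) * (exp (\<i> * of_real (w \<bullet> x)) * \<phi> x)"
    unfolding partial_deriv_eq[OF product] by (simp add: inner_axis)
qed

lemma fourier_cmult: "fourier (\<lambda>x. a * \<phi> x) \<xi> = a * fourier \<phi> \<xi>"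
  by (simp add: fourier_def mult.left_commute[of _ a])

lemma fourier_diff:
  assumes "\<phi> \<in> schwartz" "\<psi> \<in> schwartz"
  shows "fourier (\<lambda>x. \<phi> x - \<psi> x) \<xi> = fourier \<phi> \<xi> - fourier \<psi> \<xi>"
  using assms[THEN plane_wave_mult_schwartz, THEN integrable_schwartz]
  by (simp add: fourier_def right_diff_distrib)

lemma fourier_add:
  assumes "\<phi> \<in> schwartz" "\<psi> \<in> schwartz"
  shows "fourier (\<lambda>x. \<phi> x + \<psi> x) \<xi> = fourier \<phi> \<xi> + fourier \<psi> \<xi>"
  using assms[THEN plane_wave_mult_schwartz, THEN integrable_schwartz]
  by (simp add: fourier_def distrib_left)

lemma fourier_sum:
  assumes "\<And>i. i \<in> I \<Longrightarrow> \<phi> i \<in> schwartz"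
  shows "fourier (\<lambda>x. \<Sum>i\<in>I. \<phi> i x) \<xi> = (\<Sum>i\<in>I. fourier (\<phi> i) \<xi>)"
  using assms[THEN plane_wave_mult_schwartz, THEN integrable_schwartz]
  by (simp add: fourier_def sum_distrib_left)

lemma fourier_partial_deriv:
  assumes "\<phi> \<in> schwartz"
  shows "fourier (partial_deriv i \<phi>) \<xi> = - \<i> * of_real (\<xi> $ i) * fourier \<phi> \<xi>"
proof -
  have "0 = (LINT x|lborel. exp (\<i> * of_real (\<xi> \<bullet> x)) * partial_deriv i \<phi> x + \<i> * of_real (\<xi> $ i) * (exp (\<i> * of_real (\<xi> \<bullet> x)) * \<phi> x))"
    using integral_partial_deriv[OF plane_wave_mult_schwartz[OF assms, of \<xi>], of i]
    unfolding partial_deriv_plane_wave_mult[OF assms] by simp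
  also have "\<dots> = (LINT x|lborel. exp (\<i> * of_real (\<xi> \<bullet> x)) * partial_deriv i \<phi> x) + \<i> * of_real (\<xi> $ i) * (LINT x|lborel. exp (\<i> * of_real (\<xi> \<bullet> x)) * \<phi> x)"
    using integrable_schwartz[OF plane_wave_mult_schwartz[OF assms, of \<xi>]]
      integrable_schwartz[OF plane_wave_mult_schwartz[OF schwartz_partial_deriv[OF assms, of i], of \<xi>]]
    by (subst Bochner_Integration.integral_add) auto
  finally show ?thesis
    by (simp add: fourier_def add_eq_0_iff2 mult_ac eq_commute[of 0])
qed

lemma norm_fourier_le:
  "norm (fourier \<phi> \<xi>) \<le> (2 * pi) powr (- real CARD('n) / 2) * (LINT x|lborel. norm (\<phi> x))" for \<phi> :: "real^'n \<Rightarrow> complex"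
  using integral_norm_bound[of lborel "\<lambda>x. exp (\<i> * of_real (\<xi> \<bullet> x)) * \<phi> x"]
  by (simp add: fourier_def norm_mult)

text \<open>Each power of \<open>\<bar>\<xi>\<bar>\<close> is traded for a partial derivative of \<open>\<phi>\<close>.\<close>

lemma fourier_decay:
  assumes "\<phi> \<in> schwartz" shows "\<exists>M. \<forall>\<xi>. norm \<xi> ^ k * norm (fourier \<phi> \<xi>) \<le> M"
  using assms
proof (induction k arbitrary: \<phi>)
  case 0
  then show ?case using norm_fourier_le[of \<phi>] by auto
next
  case (Suc k)
  have "\<forall>i. \<exists>M. \<forall>\<xi>. norm \<xi> ^ k * norm (fourier (partial_deriv i \<phi>) \<xi>) \<le> M"
    using Suc by (auto intro: schwartz_partial_deriv)
  then obtain M where M: "\<And>i \<xi>. norm \<xi> ^ k * norm (fourier (partial_deriv i \<phi>) \<xi>) \<le> M i"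
    by metis
  have "norm \<xi> ^ Suc k * norm (fourier \<phi> \<xi>) \<le> (\<Sum>i\<in>UNIV. M i)" for \<xi>
  proof -
    have "norm \<xi> ^ Suc k * norm (fourier \<phi> \<xi>) = norm \<xi> ^ k * (norm \<xi> * norm (fourier \<phi> \<xi>))"
      by simp
    also have "\<dots> \<le> norm \<xi> ^ k * ((\<Sum>i\<in>UNIV. \<bar>\<xi> $ i\<bar>) * norm (fourier \<phi> \<xi>))"
      by (intro mult_left_mono mult_right_mono norm_le_l1_cart) auto
    also have "\<dots> = (\<Sum>i\<in>UNIV. norm \<xi> ^ k * norm (fourier (partial_deriv i \<phi>) \<xi>))"
      by (simp add: fourier_partial_deriv[OF Suc.prems] norm_mult sum_distrib_left sum_distrib_right)
    also have "\<dots> \<le> (\<Sum>i\<in>UNIV. M i)"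
      by (intro sum_mono M)
    finally show ?thesis .
  qed
  then show ?case by blast
qed

lemma fourier_schwartz:
  assumes "\<phi> \<in> schwartz" shows "fourier \<phi> \<in> schwartz"
proof (rule schwartz_coinduct[where C="fourier ` schwartz"])
  fix f :: "real^'a \<Rightarrow> complex" and i x and k :: nat assume "f \<in> fourier ` schwartz"
  then obtain \<phi> where f: "f = fourier \<phi>" and S: "\<phi> \<in> schwartz" by blast
  show "f differentiable (at x)"
    unfolding f using fourier_has_derivative[OF S] differentiable_def by blast
  show "partial_deriv i f \<in> fourier ` schwartz"
    unfolding f partial_deriv_fourier[OF S] using S by (intro imageI schwartz_cmult schwartz_coord_mult)
  show "\<exists>M. \<forall>x. norm x ^ k * norm (f x) \<le> M"
    unfolding f by (rule fourier_decay[OF S])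
qed (use assms in blast)

section \<open>Fourier inversion, Plancherel's theorem and the Schroedinger kernel\<close>

lemma inner_transpose: "x \<bullet> (A *v y) = (transpose A *v x) \<bullet> y" for A :: "real^'n^'n"
  by (simp add: transpose_matrix_vector dot_lmul_matrix)

lemma integral_gauss_linear:
  fixes M M' :: "real^'n^'n"
  assumes a: "Re a > 0" and M: "M' ** M = mat 1"
  shows "(LINT \<xi>|lborel. exp (- a * of_real ((M *v \<xi>) \<bullet> (M *v \<xi>)) + \<i> * of_real (w \<bullet> \<xi>))) =
    (of_real (sqrt pi) / csqrt a) ^ CARD('n) / of_real \<bar>det M\<bar> * exp (- of_real ((transpose M' *v w) \<bullet> (transpose M' *v w)) / (4 * a))"
proof -
  have "det M' * det M = 1"
    using arg_cong[OF M, of det] by (simp add: det_mul)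
  then have det: "det M \<noteq> 0" by auto
  have "w \<bullet> \<xi> = (transpose M' *v w) \<bullet> (M *v \<xi>)" for \<xi>
    using M inner_transpose[of w M' "M *v \<xi>"] by (simp add: matrix_vector_mul_assoc)
  then have "(LINT \<xi>|lborel. exp (- a * of_real ((M *v \<xi>) \<bullet> (M *v \<xi>)) + \<i> * of_real (w \<bullet> \<xi>))) =
      (LINT \<xi>|lborel. gauss a (transpose M' *v w) (M *v \<xi>))"
    by (simp add: gauss_def)
  also have "\<dots> = (LINT \<xi>|lborel. gauss a (transpose M' *v w) \<xi>) /\<^sub>R \<bar>det M\<bar>"
    by (rule lborel_integral_linear[OF det]) (intro schwartz_measurable gauss_schwartz a)
  finally show ?thesis
    unfolding integral_gauss[OF a] scaleR_conv_of_real[where 'a=complex] of_real_inverse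
    by (simp only: divide_inverse mult_ac)
qed

text \<open>With a Gaussian regulator Fubini's theorem applies to the iterated Fourier integral.  Both
  the inversion formula and the oscillating kernel arise from this identity, by letting \<open>a\<close> tend
  to \<open>0\<close> and to \<open>\<i>\<close>.\<close>

lemma regularised_inversion:
  fixes M M' :: "real^'n^'n" and \<phi> :: "real^'n \<Rightarrow> complex"
  assumes a: "Re a > 0" and M: "M' ** M = mat 1" and S: "\<phi> \<in> schwartz"
  shows "(LINT \<xi>|lborel. exp (- a * of_real ((M *v \<xi>) \<bullet> (M *v \<xi>))) * (exp (- \<i> * of_real (z \<bullet> \<xi>)) *
      (LINT y|lborel. exp (\<i> * of_real (\<xi> \<bullet> y)) * \<phi> y))) =
    (of_real (sqrt pi) / csqrt a) ^ CARD('n) / of_real \<bar>det M\<bar> *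
      (LINT y|lborel. exp (- of_real ((transpose M' *v (y - z)) \<bullet> (transpose M' *v (y - z))) / (4 * a)) * \<phi> y)"
proof -
  define f where "f \<xi> y = exp (- a * of_real ((M *v \<xi>) \<bullet> (M *v \<xi>))) * (exp (- \<i> * of_real (z \<bullet> \<xi>)) *
      (exp (\<i> * of_real (\<xi> \<bullet> y)) * \<phi> y))" for \<xi> y
  note [measurable] = schwartz_measurable[OF S]
  have "det M' * det M = 1"
    using arg_cong[OF M, of det] by (simp add: det_mul)
  then have det: "det M \<noteq> 0" by auto
  have "integrable lborel (\<lambda>\<xi>. gauss a 0 (M *v \<xi>))"
    using gauss_schwartz[OF a] integrable_schwartz by (subst integrable_linear_iff[OF det]) auto
  then have "integrable lborel (\<lambda>\<xi>. norm (gauss a 0 (M *v \<xi>)))"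
    by (rule integrable_norm)
  then have g: "integrable lborel (\<lambda>\<xi>. exp (- Re a * ((M *v \<xi>) \<bullet> (M *v \<xi>))))"
    by (simp add: gauss_def)
  have int: "integrable (lborel \<Otimes>\<^sub>M lborel) (\<lambda>(\<xi>, y). f \<xi> y)"
  proof (rule integrable_lborel_pair_bound[OF _ g integrable_norm[OF integrable_schwartz[OF S]]])
    show "(\<lambda>(\<xi>, y). f \<xi> y) \<in> borel_measurable (lborel \<Otimes>\<^sub>M lborel)"
      unfolding f_def by measurable
  qed (simp add: f_def norm_mult)
  have "(LINT \<xi>|lborel. exp (- a * of_real ((M *v \<xi>) \<bullet> (M *v \<xi>))) * (exp (- \<i> * of_real (z \<bullet> \<xi>)) *
      (LINT y|lborel. exp (\<i> * of_real (\<xi> \<bullet> y)) * \<phi> y))) = (LINT \<xi>|lborel. (LINT y|lborel. f \<xi> y))"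
    using integrable_schwartz[OF plane_wave_mult_schwartz[OF S]] by (simp add: f_def)
  also have "\<dots> = (LINT y|lborel. (LINT \<xi>|lborel. f \<xi> y))"
    by (rule lborel_pair.Fubini_integral[OF int, symmetric])
  also have "\<dots> = (LINT y|lborel. (of_real (sqrt pi) / csqrt a) ^ CARD('n) / of_real \<bar>det M\<bar> *
      (exp (- of_real ((transpose M' *v (y - z)) \<bullet> (transpose M' *v (y - z))) / (4 * a)) * \<phi> y))"
  proof (rule Bochner_Integration.integral_cong[OF refl])
    fix y
    have "(LINT \<xi>|lborel. f \<xi> y) = (LINT \<xi>|lborel. exp (- a * of_real ((M *v \<xi>) \<bullet> (M *v \<xi>)) + \<i> * of_real ((y - z) \<bullet> \<xi>)) * \<phi> y)"
    proof (rule Bochner_Integration.integral_cong[OF refl])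
      fix \<xi>
      have "\<i> * complex_of_real ((y - z) \<bullet> \<xi>) = - \<i> * of_real (z \<bullet> \<xi>) + \<i> * of_real (\<xi> \<bullet> y)"
        by (simp add: inner_diff_left inner_commute[of \<xi> y] right_diff_distrib)
      then show "f \<xi> y = exp (- a * of_real ((M *v \<xi>) \<bullet> (M *v \<xi>)) + \<i> * of_real ((y - z) \<bullet> \<xi>)) * \<phi> y"
        by (simp only: f_def exp_add mult.assoc)
    qed
    also have "\<dots> = (LINT \<xi>|lborel. exp (- a * of_real ((M *v \<xi>) \<bullet> (M *v \<xi>)) + \<i> * of_real ((y - z) \<bullet> \<xi>))) * \<phi> y"
      by simp
    finally show "(LINT \<xi>|lborel. f \<xi> y) = (of_real (sqrt pi) / csqrt a) ^ CARD('n) / of_real \<bar>det M\<bar> *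
      (exp (- of_real ((transpose M' *v (y - z)) \<bullet> (transpose M' *v (y - z))) / (4 * a)) * \<phi> y)"
      unfolding integral_gauss_linear[OF a M] by simp
  qed
  finally show ?thesis by simp
qed

lemma fourier_integral_schwartz:
  assumes "\<phi> \<in> schwartz"
  shows "(\<lambda>\<xi>. LINT y|lborel. exp (\<i> * of_real (\<xi> \<bullet> y)) * \<phi> y) \<in> (schwartz :: (real^'n \<Rightarrow> complex) set)"
  using schwartz_cmult[OF fourier_schwartz[OF assms], of "1 / of_real ((2 * pi) powr (- real CARD('n) / 2))"]
  by (simp add: fourier_def[abs_def])

text \<open>The regularised identity with width \<open>a = 1 / (n + 1)\<close>: the left side converges because the
  transform is integrable, and on the right side the substitution \<open>y = z + 2 a\<^sup>1\<^sup>/\<^sup>2 v\<close> turns the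
  concentrating kernel into a fixed Gaussian.\<close>

lemma integral_fourier_inversion:
  fixes \<phi> :: "real^'n \<Rightarrow> complex"
  assumes S: "\<phi> \<in> schwartz"
  shows "(LINT \<xi>|lborel. exp (- \<i> * of_real (z \<bullet> \<xi>)) * (LINT y|lborel. exp (\<i> * of_real (\<xi> \<bullet> y)) * \<phi> y)) = (2 * pi) ^ CARD('n) * \<phi> z"
proof -
  let ?m = "CARD('n)"
  define W where "W \<xi> = (LINT y|lborel. exp (\<i> * of_real (\<xi> \<bullet> y)) * \<phi> y)" for \<xi>
  have WS: "W \<in> schwartz"
    unfolding W_def[abs_def] by (rule fourier_integral_schwartz[OF S])
  define e where "e n = 1 / real (Suc n)" for n
  have e: "e n > 0" for n by (simp add: e_def)
  have e_lim: "e \<longlonglongrightarrow> 0"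
    using LIMSEQ_inverse_real_of_nat by (simp add: e_def[abs_def] inverse_eq_divide)
  note [measurable] = schwartz_measurable[OF S] schwartz_measurable[OF WS]
  define L where "L n = (LINT \<xi>|lborel. exp (- of_real (e n) * of_real (\<xi> \<bullet> \<xi>)) * (exp (- \<i> * of_real (z \<bullet> \<xi>)) * W \<xi>))" for n
  have lim1: "L \<longlonglongrightarrow> (LINT \<xi>|lborel. exp (- \<i> * of_real (z \<bullet> \<xi>)) * W \<xi>)"
    unfolding L_def[abs_def]
  proof (rule integral_dominated_convergence[where w="\<lambda>\<xi>. norm (W \<xi>)"])
    show "integrable lborel (\<lambda>\<xi>. norm (W \<xi>))"
      by (intro integrable_norm integrable_schwartz WS)
    show "AE \<xi> in lborel. norm (exp (- of_real (e n) * of_real (\<xi> \<bullet> \<xi>)) * (exp (- \<i> * of_real (z \<bullet> \<xi>)) * W \<xi>)) \<le> norm (W \<xi>)" for n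
      using e[of n] by (intro AE_I2) (simp add: norm_mult mult_left_le_one_le)
    show "AE \<xi> in lborel. (\<lambda>n. exp (- of_real (e n) * of_real (\<xi> \<bullet> \<xi>)) * (exp (- \<i> * of_real (z \<bullet> \<xi>)) * W \<xi>)) \<longlonglongrightarrow> exp (- \<i> * of_real (z \<bullet> \<xi>)) * W \<xi>"
    proof (rule AE_I2)
      fix \<xi>
      have "(\<lambda>n. exp (- of_real (e n) * of_real (\<xi> \<bullet> \<xi>)) * (exp (- \<i> * of_real (z \<bullet> \<xi>)) * W \<xi>)) \<longlonglongrightarrow>
          exp (- of_real 0 * of_real (\<xi> \<bullet> \<xi>)) * (exp (- \<i> * of_real (z \<bullet> \<xi>)) * W \<xi>)"
        by (intro tendsto_intros e_lim)
      then show "(\<lambda>n. exp (- of_real (e n) * of_real (\<xi> \<bullet> \<xi>)) * (exp (- \<i> * of_real (z \<bullet> \<xi>)) * W \<xi>)) \<longlonglongrightarrow> exp (- \<i> * of_real (z \<bullet> \<xi>)) * W \<xi>"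
        by simp
    qed
  qed measurable
  have L: "L n = of_real ((2 * sqrt pi) ^ ?m) * (LINT v|lborel. of_real (exp (- (v \<bullet> v))) * \<phi> ((2 * sqrt (e n)) *\<^sub>R v + z))" for n
  proof -
    have en: "csqrt (of_real (e n)) = of_real (sqrt (e n))" "sqrt (e n) > 0"
      using e[of n] by (simp_all add: csqrt_of_real_nonneg less_imp_le)
    define F where "F y = exp (- of_real ((y - z) \<bullet> (y - z)) / (4 * of_real (e n))) * \<phi> y" for y
    have [measurable]: "F \<in> borel_measurable borel"
      unfolding F_def[abs_def] by measurable
    have "L n = (LINT \<xi>|lborel. exp (- of_real (e n) * of_real ((mat 1 *v \<xi>) \<bullet> (mat 1 *v \<xi>))) * (exp (- \<i> * of_real (z \<bullet> \<xi>)) *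
      (LINT y|lborel. exp (\<i> * of_real (\<xi> \<bullet> y)) * \<phi> y)))"
      by (simp add: L_def W_def)
    also have "\<dots> = of_real ((sqrt pi / sqrt (e n)) ^ ?m) * (LINT y|lborel. F y)"
      using e[of n] by (subst regularised_inversion[OF _ _ S, where M'="mat 1"]) (simp_all add: en F_def[abs_def] transpose_mat)
    also have "(LINT y|lborel. F y) = (LINT y|lborel. F (y + z))"
      by (simp add: integral_lborel_shift)
    also have "\<dots> = (2 * sqrt (e n)) ^ ?m *\<^sub>R (LINT v|lborel. F ((2 * sqrt (e n)) *\<^sub>R v + z))"
      using en(2) integral_lborel_scale[of "2 * sqrt (e n)" "\<lambda>y. F (y + z)"] by simp
    also have "(\<lambda>v. F ((2 * sqrt (e n)) *\<^sub>R v + z)) = (\<lambda>v. of_real (exp (- (v \<bullet> v))) * \<phi> ((2 * sqrt (e n)) *\<^sub>R v + z))"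
    proof
      fix v :: "real^'n"
      have eq: "((2 * sqrt (e n)) *\<^sub>R v) \<bullet> ((2 * sqrt (e n)) *\<^sub>R v) = 4 * e n * (v \<bullet> v)"
        using e[of n] by (simp add: mult_ac real_sqrt_mult_self)
      have "- complex_of_real (((2 * sqrt (e n)) *\<^sub>R v) \<bullet> ((2 * sqrt (e n)) *\<^sub>R v)) / (4 * of_real (e n)) = of_real (- (v \<bullet> v))"
        unfolding eq using e[of n] by simp
      then show "F ((2 * sqrt (e n)) *\<^sub>R v + z) = of_real (exp (- (v \<bullet> v))) * \<phi> ((2 * sqrt (e n)) *\<^sub>R v + z)"
        by (simp add: F_def exp_of_real[symmetric])
    qed
    also have "of_real ((sqrt pi / sqrt (e n)) ^ ?m) * ((2 * sqrt (e n)) ^ ?m *\<^sub>R (LINT v|lborel. of_real (exp (- (v \<bullet> v))) * \<phi> ((2 * sqrt (e n)) *\<^sub>R v + z)))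
       = of_real ((sqrt pi / sqrt (e n)) ^ ?m * (2 * sqrt (e n)) ^ ?m) * (LINT v|lborel. of_real (exp (- (v \<bullet> v))) * \<phi> ((2 * sqrt (e n)) *\<^sub>R v + z))"
      by (simp add: scaleR_conv_of_real)
    also have "(sqrt pi / sqrt (e n)) ^ ?m * (2 * sqrt (e n)) ^ ?m = (2 * sqrt pi) ^ ?m"
    proof -
      have "(sqrt pi / sqrt (e n)) * (2 * sqrt (e n)) = 2 * sqrt pi"
        using en(2) by simp
      then show ?thesis
        by (simp only: power_mult_distrib[symmetric])
    qed
    finally show ?thesis .
  qed
  have "(\<lambda>n. LINT v|lborel. of_real (exp (- (v \<bullet> v))) * \<phi> ((2 * sqrt (e n)) *\<^sub>R v + z)) \<longlonglongrightarrow> (LINT v|lborel. of_real (exp (- ((v::real^'n) \<bullet> v))) * \<phi> z)"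
  proof -
    obtain C where C: "C > 0" "\<And>x. norm (\<phi> x) \<le> C / (1 + norm x) ^ 0"
      using schwartz_decay[OF S] by metis
    show ?thesis
    proof (rule integral_dominated_convergence[where w="\<lambda>v. norm (gauss 1 0 v) * C"])
      show "integrable lborel (\<lambda>v::real^'n. norm (gauss 1 0 v) * C)"
        by (intro integrable_mult_left integrable_norm integrable_schwartz gauss_schwartz) simp
      show "AE v in lborel. norm (of_real (exp (- (v \<bullet> v))) * \<phi> ((2 * sqrt (e n)) *\<^sub>R v + z)) \<le> norm (gauss 1 0 v) * C" for n
        using C(2) by (intro AE_I2) (simp add: norm_mult gauss_def)
      show "AE v in lborel. (\<lambda>n. of_real (exp (- (v \<bullet> v))) * \<phi> ((2 * sqrt (e n)) *\<^sub>R v + z)) \<longlonglongrightarrow> of_real (exp (- (v \<bullet> v))) * \<phi> z"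
      proof (rule AE_I2)
        fix v
        have "(\<lambda>n. (2 * sqrt (e n)) *\<^sub>R v + z) \<longlonglongrightarrow> (2 * sqrt 0) *\<^sub>R v + z"
          by (intro tendsto_intros e_lim)
        then have "(\<lambda>n. \<phi> ((2 * sqrt (e n)) *\<^sub>R v + z)) \<longlonglongrightarrow> \<phi> z"
          using schwartz_continuous_on[OF S, of UNIV] by (auto intro: continuous_on_tendsto_compose)
        then show "(\<lambda>n. of_real (exp (- (v \<bullet> v))) * \<phi> ((2 * sqrt (e n)) *\<^sub>R v + z)) \<longlonglongrightarrow> of_real (exp (- (v \<bullet> v))) * \<phi> z"
          by (rule tendsto_mult_left)
      qed
    qed measurable
  qed
  then have "L \<longlonglongrightarrow> of_real ((2 * sqrt pi) ^ ?m) * (LINT v|lborel. of_real (exp (- ((v::real^'n) \<bullet> v))) * \<phi> z)"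
    unfolding L[abs_def] by (rule tendsto_mult_left)
  also have "(LINT v|lborel. of_real (exp (- ((v::real^'n) \<bullet> v))) * \<phi> z) = of_real (sqrt pi ^ ?m) * \<phi> z"
    by (simp add: integral_gaussian_real)
  also have "complex_of_real ((2 * sqrt pi) ^ ?m) * (of_real (sqrt pi ^ ?m) * \<phi> z) = of_real (((2 * sqrt pi) * sqrt pi) ^ ?m) * \<phi> z"
    by (simp add: power_mult_distrib)
  also have "(2 * sqrt pi) * sqrt pi = 2 * pi"
    by simp
  finally show ?thesis
    using LIMSEQ_unique[OF lim1] by (simp add: W_def)
qed

lemma fourier_inversion:
  fixes x :: "real^'n"
  assumes S: "\<phi> \<in> schwartz"
  shows "fourier (fourier \<phi>) x = \<phi> (- x)"
proof -
  let ?c = "complex_of_real ((2 * pi) powr (- real CARD('n) / 2))"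
  have "fourier (fourier \<phi>) x = ?c * (LINT \<xi>|lborel. ?c * (exp (- \<i> * of_real (- x \<bullet> \<xi>)) * (LINT y|lborel. exp (\<i> * of_real (\<xi> \<bullet> y)) * \<phi> y)))"
    by (simp add: fourier_def mult_ac)
  also have "\<dots> = (?c * ?c) * (LINT \<xi>|lborel. exp (- \<i> * of_real (- x \<bullet> \<xi>)) * (LINT y|lborel. exp (\<i> * of_real (\<xi> \<bullet> y)) * \<phi> y))"
    by simp
  also have "\<dots> = of_real (((2 * pi) powr (- real CARD('n) / 2))\<^sup>2) * ((2 * pi) ^ CARD('n) * \<phi> (- x))"
    unfolding integral_fourier_inversion[OF S] by (simp only: power2_eq_square of_real_mult)
  also have "\<dots> = \<phi> (- x)"
    unfolding fourier_const_power2 by simp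
  finally show ?thesis .
qed

lemma fourier_multiplication:
  fixes \<phi> \<psi> :: "real^'n \<Rightarrow> complex"
  assumes f: "integrable lborel \<phi>" and g: "integrable lborel \<psi>"
  shows "(LINT \<xi>|lborel. fourier \<phi> \<xi> * \<psi> \<xi>) = (LINT x|lborel. \<phi> x * fourier \<psi> x)"
proof -
  let ?c = "complex_of_real ((2 * pi) powr (- real CARD('n) / 2))"
  have [measurable]: "\<phi> \<in> borel_measurable borel" "\<psi> \<in> borel_measurable borel"
    using f g by (auto dest: borel_measurable_integrable)
  have int: "integrable (lborel \<Otimes>\<^sub>M lborel) (\<lambda>(\<xi>, x). exp (\<i> * of_real (\<xi> \<bullet> x)) * \<phi> x * \<psi> \<xi>)"
    by (rule integrable_lborel_pair_bound[OF _ integrable_norm[OF g] integrable_norm[OF f]]) (measurable, simp add: norm_mult)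
  have "(LINT \<xi>|lborel. fourier \<phi> \<xi> * \<psi> \<xi>) = ?c * (LINT \<xi>|lborel. (LINT x|lborel. exp (\<i> * of_real (\<xi> \<bullet> x)) * \<phi> x * \<psi> \<xi>))"
  proof -
    have "fourier \<phi> \<xi> * \<psi> \<xi> = ?c * (LINT x|lborel. exp (\<i> * of_real (\<xi> \<bullet> x)) * \<phi> x * \<psi> \<xi>)" for \<xi>
      unfolding fourier_def mult.assoc[of ?c] by simp
    then show ?thesis
      by (simp only: integral_mult_right_zero)
  qed
  also have "\<dots> = ?c * (LINT x|lborel. (LINT \<xi>|lborel. exp (\<i> * of_real (\<xi> \<bullet> x)) * \<phi> x * \<psi> \<xi>))"
    by (subst lborel_pair.Fubini_integral[OF int]) simp
  also have "(\<lambda>x. LINT \<xi>|lborel. exp (\<i> * of_real (\<xi> \<bullet> x)) * \<phi> x * \<psi> \<xi>) = (\<lambda>x. \<phi> x * (LINT \<xi>|lborel. exp (\<i> * of_real (x \<bullet> \<xi>)) * \<psi> \<xi>))"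
    by (simp add: mult.assoc mult.left_commute[of _ "\<phi> _"] inner_commute)
  also have "?c * (LINT x|lborel. \<phi> x * (LINT \<xi>|lborel. exp (\<i> * of_real (x \<bullet> \<xi>)) * \<psi> \<xi>)) =
      (LINT x|lborel. ?c * (\<phi> x * (LINT \<xi>|lborel. exp (\<i> * of_real (x \<bullet> \<xi>)) * \<psi> \<xi>)))"
    by (rule integral_mult_right_zero[symmetric])
  finally show ?thesis
    by (simp only: fourier_def mult.left_commute)
qed

text \<open>The multiplication formula is applied to \<open>\<phi>\<close> and the conjugate of its transform, whose own transform
  is the conjugate of \<open>\<phi>\<close> by inversion.\<close>

lemma plancherel:
  assumes S: "\<phi> \<in> schwartz"
  shows "(LINT \<xi>|lborel. (norm (fourier \<phi> \<xi>))\<^sup>2) = (LINT x|lborel. (norm (\<phi> x))\<^sup>2)"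
proof -
  note FS = fourier_schwartz[OF S]
  have "fourier (\<lambda>\<xi>. cnj (fourier \<phi> \<xi>)) x = cnj (\<phi> x)" for x
  proof -
    have "fourier (\<lambda>\<xi>. cnj (fourier \<phi> \<xi>)) x = cnj (fourier (fourier \<phi>) (- x))"
    proof -
      have "cnj (LINT \<xi>|lborel. exp (\<i> * of_real (- x \<bullet> \<xi>)) * fourier \<phi> \<xi>) =
          (LINT \<xi>|lborel. cnj (exp (\<i> * of_real (- x \<bullet> \<xi>)) * fourier \<phi> \<xi>))"
        by (rule Bochner_Integration.integral_cnj[symmetric])
      also have "\<dots> = (LINT \<xi>|lborel. exp (\<i> * of_real (x \<bullet> \<xi>)) * cnj (fourier \<phi> \<xi>))"
        by (simp add: exp_cnj)
      finally show ?thesis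
        unfolding fourier_def[of "fourier \<phi>"] fourier_def[of "\<lambda>\<xi>. cnj (fourier \<phi> \<xi>)"]
        by (simp only: complex_cnj_mult complex_cnj_complex_of_real)
    qed
    then show ?thesis
      by (simp add: fourier_inversion[OF S])
  qed
  then have "(LINT \<xi>|lborel. fourier \<phi> \<xi> * cnj (fourier \<phi> \<xi>)) = (LINT x|lborel. \<phi> x * cnj (\<phi> x))"
    using fourier_multiplication[OF integrable_schwartz[OF S], of "\<lambda>\<xi>. cnj (fourier \<phi> \<xi>)"] integrable_schwartz[OF FS]
    by (simp add: complex_integrable_cnj)
  then have "complex_of_real (LINT \<xi>|lborel. (norm (fourier \<phi> \<xi>))\<^sup>2) = complex_of_real (LINT x|lborel. (norm (\<phi> x))\<^sup>2)"
    by (simp add: complex_norm_square[symmetric] flip: integral_complex_of_real)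
  then show ?thesis
    by (simp only: of_real_eq_iff)
qed

lemma norm_L2_of_fourier:
  "\<phi> \<in> schwartz \<Longrightarrow> norm (L2_of (fourier \<phi>)) = norm (L2_of \<phi>)"
  by (simp add: norm_L2_of square_integrable_schwartz fourier_schwartz plancherel)

lemma norm_exp_divide_le_one:
  assumes "Re a > 0" "r \<ge> 0"
  shows "norm (exp (- complex_of_real r / (4 * a))) \<le> 1"
proof -
  have "Re (- complex_of_real r / (4 * a)) = - (r * (4 * Re a) / ((4 * Re a)\<^sup>2 + (4 * Im a)\<^sup>2))"
    by (simp add: Re_divide)
  also have "\<dots> \<le> 0"
    using assms by (intro iffD2[OF neg_le_0_iff_le] divide_nonneg_nonneg) auto
  finally show ?thesis by simp
qed

text \<open>The limit \<open>a \<longrightarrow> \<i>\<close> within the right half plane.  There the Gaussian factors have modulus at most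
  one, so the integrable functions \<open>\<phi>\<close> and its transform are majorants; the principal square root is
  continuous at \<open>\<i>\<close>.\<close>

lemma oscillating_inversion:
  fixes M M' :: "real^'n^'n" and \<phi> :: "real^'n \<Rightarrow> complex"
  assumes M: "M' ** M = mat 1" and S: "\<phi> \<in> schwartz"
  shows "(LINT \<xi>|lborel. exp (- \<i> * of_real ((M *v \<xi>) \<bullet> (M *v \<xi>))) * (exp (- \<i> * of_real (z \<bullet> \<xi>)) *
      (LINT y|lborel. exp (\<i> * of_real (\<xi> \<bullet> y)) * \<phi> y))) =
    (of_real (sqrt pi) / csqrt \<i>) ^ CARD('n) / of_real \<bar>det M\<bar> *
      (LINT y|lborel. exp (\<i> * of_real ((transpose M' *v (y - z)) \<bullet> (transpose M' *v (y - z))) / 4) * \<phi> y)"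
proof -
  define W where "W \<xi> = (LINT y|lborel. exp (\<i> * of_real (\<xi> \<bullet> y)) * \<phi> y)" for \<xi>
  have WS: "W \<in> schwartz"
    unfolding W_def[abs_def] by (rule fourier_integral_schwartz[OF S])
  note [measurable] = schwartz_measurable[OF S] schwartz_measurable[OF WS]
  define a where "a n = of_real (1 / real (Suc n)) + \<i>" for n
  have a: "Re (a n) > 0" for n by (simp add: a_def)
  have "(\<lambda>n. of_real (1 / real (Suc n)) + \<i>) \<longlonglongrightarrow> of_real 0 + \<i>"
    using LIMSEQ_inverse_real_of_nat by (intro tendsto_intros) (simp add: inverse_eq_divide)
  then have a_lim: "a \<longlonglongrightarrow> \<i>" by (simp add: a_def[abs_def])
  have lim1: "(\<lambda>n. LINT \<xi>|lborel. exp (- a n * of_real ((M *v \<xi>) \<bullet> (M *v \<xi>))) * (exp (- \<i> * of_real (z \<bullet> \<xi>)) * W \<xi>)) \<longlonglongrightarrow>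
      (LINT \<xi>|lborel. exp (- \<i> * of_real ((M *v \<xi>) \<bullet> (M *v \<xi>))) * (exp (- \<i> * of_real (z \<bullet> \<xi>)) * W \<xi>))"
  proof (rule integral_dominated_convergence[where w="\<lambda>\<xi>. norm (W \<xi>)"])
    show "integrable lborel (\<lambda>\<xi>. norm (W \<xi>))"
      by (intro integrable_norm integrable_schwartz WS)
    show "AE \<xi> in lborel. norm (exp (- a n * of_real ((M *v \<xi>) \<bullet> (M *v \<xi>))) * (exp (- \<i> * of_real (z \<bullet> \<xi>)) * W \<xi>)) \<le> norm (W \<xi>)" for n
      using a[of n] by (intro AE_I2) (simp add: norm_mult mult_left_le_one_le)
    show "AE \<xi> in lborel. (\<lambda>n. exp (- a n * of_real ((M *v \<xi>) \<bullet> (M *v \<xi>))) * (exp (- \<i> * of_real (z \<bullet> \<xi>)) * W \<xi>)) \<longlonglongrightarrow>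
        exp (- \<i> * of_real ((M *v \<xi>) \<bullet> (M *v \<xi>))) * (exp (- \<i> * of_real (z \<bullet> \<xi>)) * W \<xi>)"
      by (intro AE_I2 tendsto_intros a_lim)
  qed measurable
  have lim2: "(\<lambda>n. LINT y|lborel. exp (- of_real ((transpose M' *v (y - z)) \<bullet> (transpose M' *v (y - z))) / (4 * a n)) * \<phi> y) \<longlonglongrightarrow>
      (LINT y|lborel. exp (- of_real ((transpose M' *v (y - z)) \<bullet> (transpose M' *v (y - z))) / (4 * \<i>)) * \<phi> y)"
  proof (rule integral_dominated_convergence[where w="\<lambda>\<xi>. norm (\<phi> \<xi>)"])
    show "integrable lborel (\<lambda>\<xi>. norm (\<phi> \<xi>))"
      by (intro integrable_norm integrable_schwartz S)
    show "AE y in lborel. norm (exp (- of_real ((transpose M' *v (y - z)) \<bullet> (transpose M' *v (y - z))) / (4 * a n)) * \<phi> y) \<le> norm (\<phi> y)" for n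
      unfolding norm_mult using a[of n]
      by (intro AE_I2 mult_left_le_one_le norm_exp_divide_le_one) auto
    show "AE y in lborel. (\<lambda>n. exp (- of_real ((transpose M' *v (y - z)) \<bullet> (transpose M' *v (y - z))) / (4 * a n)) * \<phi> y) \<longlonglongrightarrow>
        exp (- of_real ((transpose M' *v (y - z)) \<bullet> (transpose M' *v (y - z))) / (4 * \<i>)) * \<phi> y"
      by (intro AE_I2 tendsto_intros a_lim) simp
  qed measurable
  have "isCont csqrt \<i>"
    by (rule continuous_at_csqrt) (simp add: complex_nonpos_Reals_iff)
  then have "(\<lambda>n. csqrt (a n)) \<longlonglongrightarrow> csqrt \<i>"
    using a_lim by (rule isCont_tendsto_compose)
  then have "(\<lambda>n. (of_real (sqrt pi) / csqrt (a n)) ^ CARD('n) / of_real \<bar>det M\<bar> *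
      (LINT y|lborel. exp (- of_real ((transpose M' *v (y - z)) \<bullet> (transpose M' *v (y - z))) / (4 * a n)) * \<phi> y)) \<longlonglongrightarrow>
    (of_real (sqrt pi) / csqrt \<i>) ^ CARD('n) / of_real \<bar>det M\<bar> *
      (LINT y|lborel. exp (- of_real ((transpose M' *v (y - z)) \<bullet> (transpose M' *v (y - z))) / (4 * \<i>)) * \<phi> y)"
    unfolding divide_inverse[of _ "complex_of_real \<bar>det M\<bar>"]
    by (intro tendsto_mult tendsto_power tendsto_divide tendsto_const lim2) (auto simp: csqrt_eq_0 simp del: csqrt_ii)
  from LIMSEQ_unique[OF lim1[unfolded W_def regularised_inversion[OF a M S]] this]
  show ?thesis
    by simp
qed

section \<open>Density of the Schwartz functions\<close>

lemma L2_of_sum: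
  assumes "finite I" "\<And>i. i \<in> I \<Longrightarrow> square_integrable (h i)"
  shows "square_integrable (\<lambda>x. \<Sum>i\<in>I. h i x)" "L2_of (\<lambda>x. \<Sum>i\<in>I. h i x) = (\<Sum>i\<in>I. L2_of (h i))"
proof -
  have "square_integrable (\<lambda>x. \<Sum>i\<in>I. h i x) \<and> L2_of (\<lambda>x. \<Sum>i\<in>I. h i x) = (\<Sum>i\<in>I. L2_of (h i))"
    using assms
  proof (induction I rule: finite_induct)
    case empty
    then show ?case by (simp add: square_integrable_zero zero_L2.abs_eq)
  next
    case (insert i I)
    then show ?case
      by (auto simp: square_integrable_add L2_of_add[symmetric])
  qed
  then show "square_integrable (\<lambda>x. \<Sum>i\<in>I. h i x)" "L2_of (\<lambda>x. \<Sum>i\<in>I. h i x) = (\<Sum>i\<in>I. L2_of (h i))"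
    by auto
qed

lemma subspace_closure_normed:
  fixes S :: "'a::real_normed_vector set"
  assumes S: "subspace S" shows "subspace (closure S)"
  unfolding subspace_def
proof (intro conjI ballI allI)
  show "0 \<in> closure S"
    using subspace_0[OF S] closure_subset by blast
  fix x assume "x \<in> closure S"
  then obtain X where X: "\<And>n. X n \<in> S" "X \<longlonglongrightarrow> x"
    unfolding closure_sequential by blast
  show "c *\<^sub>R x \<in> closure S" for c
    unfolding closure_sequential
    by (intro exI[of _ "\<lambda>n. c *\<^sub>R X n"] conjI allI subspace_scale[OF S] tendsto_scaleR tendsto_const X)
  fix y assume "y \<in> closure S"
  then obtain Y where Y: "\<And>n. Y n \<in> S" "Y \<longlonglongrightarrow> y"
    unfolding closure_sequential by blast
  show "x + y \<in> closure S"
    unfolding closure_sequential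
    by (intro exI[of _ "\<lambda>n. X n + Y n"] conjI allI subspace_add[OF S] tendsto_add X Y)
qed

lemma subspace_schwartz_L2: "subspace (L2_of ` schwartz)"
  unfolding subspace_def
proof (intro conjI ballI allI)
  show "0 \<in> L2_of ` schwartz"
    using schwartz_zero by (auto simp: zero_L2.abs_eq)
next
  fix F G :: "(real^'n) L2" assume "F \<in> L2_of ` schwartz" "G \<in> L2_of ` schwartz"
  then show "F + G \<in> L2_of ` schwartz"
    by (auto simp: L2_of_add square_integrable_schwartz intro!: imageI schwartz_add)
next
  fix r and F :: "(real^'n) L2" assume "F \<in> L2_of ` schwartz"
  then show "r *\<^sub>R F \<in> L2_of ` schwartz"
    by (auto simp: scaleR_eq_scaleC_L2 L2_of_scaleC square_integrable_schwartz intro!: imageI schwartz_cmult)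
qed

lemma scaleC_schwartz_L2: "F \<in> L2_of ` schwartz \<Longrightarrow> c *\<^sub>C F \<in> L2_of ` schwartz"
  by (auto simp: L2_of_scaleC square_integrable_schwartz intro!: imageI schwartz_cmult)

text \<open>The functions \<open>exp (- (\<Sum>i. ((x$i - c$i) / r$i)^(2n)))\<close> converge to the indicator of a box as
  \<open>n\<close> tends to infinity; for every \<open>n\<close> they are Schwartz functions, with a common exponential bound.\<close>

lemma indicator_box_in_closure_schwartz:
  fixes a b :: "real^'n"
  shows "L2_of (indicator (box a b)) \<in> closure (L2_of ` schwartz)"
proof (cases "box a b = {}")
  case True
  then have "indicator (box a b) = (\<lambda>x. 0 :: complex)" by (simp add: fun_eq_iff)
  then show ?thesis
    using schwartz_zero closure_subset[of "L2_of ` schwartz"] by (metis image_eqI subsetD)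
next
  case False
  then have ab: "a $ i < b $ i" for i
    using interval_eq_empty_cart(1)[of a b] by (auto simp: not_le)
  define c where "c = (\<chi> i. (a $ i + b $ i) / 2)"
  define r where "r = (\<chi> i. (b $ i - a $ i) / 2)"
  have r: "r $ i > 0" for i using ab[of i] by (simp add: r_def)
  define y where "y x i = (x $ i - c $ i) / r $ i" for x i
  define q where "q n x = (\<Sum>i\<in>UNIV. y x i ^ (2 * Suc n))" for n x
  define f where "f n x = complex_of_real (exp (- q n x))" for n x
  define R where "R = Max (range (\<lambda>i. r $ i))"
  have rR: "r $ i \<le> R" for i unfolding R_def by (intro Max_ge) auto
  then have R: "R > 0" using r less_le_trans by blast
  \<comment> \<open>Coercivity comes from \<open>\<bar>s\<bar> \<le> 1 + \<bar>s\<bar> ^ (2 * Suc n)\<close> in every coordinate, with constants that do not depend on \<open>n\<close>.\<close>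
  define d where "d = real CARD('n) + (\<Sum>i\<in>UNIV. \<bar>c $ i\<bar> / r $ i)"
  have coercive: "1 / R * norm x - d \<le> q n x" for n x
  proof -
    have yi: "\<bar>x $ i\<bar> / R - \<bar>c $ i\<bar> / r $ i - 1 \<le> y x i ^ (2 * Suc n)" for i
    proof -
      have "\<bar>x $ i\<bar> / R \<le> \<bar>x $ i\<bar> / r $ i"
        using rR[of i] r[of i] by (intro divide_left_mono) auto
      also have "\<dots> \<le> (\<bar>x $ i - c $ i\<bar> + \<bar>c $ i\<bar>) / r $ i"
        using r[of i] by (intro divide_right_mono) auto
      also have "\<dots> = \<bar>y x i\<bar> + \<bar>c $ i\<bar> / r $ i"
        using r[of i] by (simp add: y_def add_divide_distrib)
      finally have "\<bar>x $ i\<bar> / R - \<bar>c $ i\<bar> / r $ i \<le> \<bar>y x i\<bar>" by simp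
      moreover have "\<bar>y x i\<bar> \<le> 1 + \<bar>y x i\<bar> ^ (2 * Suc n)"
      proof (cases "\<bar>y x i\<bar> \<le> 1")
        case False
        then have "\<bar>y x i\<bar> ^ 1 \<le> \<bar>y x i\<bar> ^ (2 * Suc n)"
          by (intro power_increasing) auto
        then show ?thesis by simp
      qed (simp add: add_increasing2)
      moreover have "\<bar>y x i\<bar> ^ (2 * Suc n) = y x i ^ (2 * Suc n)"
        by (rule power_even_abs) simp
      ultimately show ?thesis by linarith
    qed
    have "1 / R * norm x \<le> 1 / R * (\<Sum>i\<in>UNIV. \<bar>x $ i\<bar>)"
      using R by (intro mult_left_mono norm_le_l1_cart) auto
    also have "\<dots> - d = (\<Sum>i\<in>UNIV. \<bar>x $ i\<bar> / R - \<bar>c $ i\<bar> / r $ i - 1)"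
      by (simp add: d_def sum_subtractf sum_divide_distrib)
    also have "\<dots> \<le> q n x"
      unfolding q_def by (intro sum_mono yi)
    finally show ?thesis by simp
  qed
  have f_schwartz: "f n \<in> schwartz" for n
  proof -
    have "real_polynomial_function (\<lambda>x::real^'n. y x i)" for i
      unfolding y_def by (intro real_polynomial_function_divide real_polynomial_function_diff real_polynomial_coord real_polynomial_function.intros(2))
    then have "real_polynomial_function (q n)"
      unfolding q_def[abs_def] by (intro real_polynomial_function_sum real_polynomial_function_power) auto
    then show ?thesis
      unfolding f_def[abs_def] using R coercive by (intro schwartz_exp_polynomial[of "q n" "1 / R" d]) auto
  qed
  let ?N = "CARD('n) + 2"
  define M where "M = (real (Suc ?N) / (1 / R)) ^ ?N * exp (1 / R) * exp d"
  have bound: "norm (f n x) \<le> M / (1 + norm x) ^ ?N" for n x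
  proof -
    have "norm (f n x) * (1 + norm x) ^ ?N \<le> exp (d - 1 / R * norm x) * ((real (Suc ?N) / (1 / R)) ^ ?N * exp (1 / R * (1 + norm x)))"
      using coercive[of x n] R unfolding f_def
      by (intro mult_mono power_le_exp) auto
    also have "\<dots> = M"
    proof -
      have "d - 1 / R * norm x + 1 / R * (1 + norm x) = 1 / R + d"
        by (simp add: algebra_simps add_divide_distrib)
      then have "exp (d - 1 / R * norm x) * exp (1 / R * (1 + norm x)) = exp (1 / R) * exp d"
        by (simp only: mult_exp_exp)
      then have "z * (exp (d - 1 / R * norm x) * exp (1 / R * (1 + norm x))) = z * exp (1 / R) * exp d" for z
        by (simp only: mult.assoc)
      then show ?thesis
        unfolding M_def by (subst mult.left_commute)
    qed
    finally have "norm (f n x) * (1 + norm x) ^ ?N \<le> M" .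
    moreover have "0 < (1 + norm x) ^ ?N"
      by (intro zero_less_power add_pos_nonneg) auto
    ultimately show ?thesis
      by (simp only: pos_le_divide_eq)
  qed
  have "(\<lambda>n. L2_of (f n)) \<longlonglongrightarrow> L2_of (indicator (box a b))"
  proof (rule L2_dominated_convergence(3)[where w="\<lambda>x. M / (1 + norm x) ^ ?N"])
    show "f n \<in> borel_measurable borel" for n
      using f_schwartz by (rule schwartz_measurable)
    show "integrable lborel (\<lambda>x::real^'n. (M / (1 + norm x) ^ ?N)\<^sup>2)"
    proof -
      have "M \<ge> 0" using R by (simp add: M_def)
      then show ?thesis
        using integrable_decay_square[of M, where 'a="real^'n"] by simp
    qed
    have bd: "AE x in lborel. x \<notin> cbox a b - box a b"
    proof (rule AE_not_in)
      have "emeasure lborel (cbox a b - box a b) = emeasure lborel (cbox a b) - emeasure lborel (box a b)"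
        by (intro emeasure_Diff) (auto simp: box_subset_cbox emeasure_lborel_box_eq)
      then show "cbox a b - box a b \<in> null_sets lborel"
        by (simp add: null_sets_def emeasure_lborel_box_eq emeasure_lborel_cbox_eq)
    qed
    show "AE x in lborel. (\<lambda>n. f n x) \<longlonglongrightarrow> indicator (box a b) x"
      using bd
    proof eventually_elim
      case (elim x)
      have y_lt: "\<bar>y x i\<bar> < 1 \<longleftrightarrow> a $ i < x $ i \<and> x $ i < b $ i" for i
        using r[of i] by (auto simp: y_def abs_less_iff field_simps c_def r_def)
      have y_gt: "\<bar>y x i\<bar> > 1 \<longleftrightarrow> x $ i < a $ i \<or> b $ i < x $ i" for i
      proof -
        have "\<bar>y x i\<bar> > 1 \<longleftrightarrow> y x i > 1 \<or> y x i < -1" by linarith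
        also have "\<dots> \<longleftrightarrow> x $ i < a $ i \<or> b $ i < x $ i"
          using r[of i] by (auto simp: y_def field_simps c_def r_def)
        finally show ?thesis .
      qed
      show ?case
      proof (cases "x \<in> box a b")
        case True
        then have "\<bar>y x i\<bar> < 1" for i by (simp add: y_lt mem_box_cart)
        then have "(\<lambda>n. y x i ^ (2 * Suc n)) \<longlonglongrightarrow> 0" for i
          unfolding power_mult using LIMSEQ_Suc[OF LIMSEQ_power_zero[of "(y x i)\<^sup>2"]] by (simp add: abs_square_less_1)
        then have "(\<lambda>n. q n x) \<longlonglongrightarrow> (\<Sum>i\<in>(UNIV :: 'n set). 0)"
          unfolding q_def by (intro tendsto_sum)
        then have "(\<lambda>n. f n x) \<longlonglongrightarrow> of_real (exp (- 0))"
          unfolding f_def by (intro tendsto_intros) simp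
        then show ?thesis using True by simp
      next
        case False
        then have "x \<notin> cbox a b" using elim by auto
        then obtain i where "x $ i < a $ i \<or> b $ i < x $ i"
          by (auto simp: mem_box_cart not_le)
        then have "\<bar>y x i\<bar> > 1" by (simp add: y_gt)
        then have y1: "1 < (y x i)\<^sup>2"
          by (metis abs_square_le_1 not_le)
        then have "filterlim (\<lambda>n. ((y x i)\<^sup>2) ^ n) at_top sequentially"
          by (intro filterlim_at_infinity_imp_filterlim_at_top filterlim_realpow_sequentially_gt1 always_eventually allI
              zero_less_power[OF less_trans[OF zero_less_one y1]]) simp
        then have "filterlim (\<lambda>n. ((y x i)\<^sup>2) ^ Suc n) at_top sequentially"
          by (rule filterlim_compose[OF _ filterlim_Suc])
        then have "filterlim (\<lambda>n. q n x) at_top sequentially"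
        proof (rule filterlim_at_top_mono, intro always_eventually allI)
          fix n
          have "((y x i)\<^sup>2) ^ Suc n = y x i ^ (2 * Suc n)" by (rule power_mult[symmetric])
          also have "\<dots> \<le> q n x"
            unfolding q_def by (rule member_le_sum[OF UNIV_I zero_le_even_power]) simp_all
          finally show "((y x i)\<^sup>2) ^ Suc n \<le> q n x" .
        qed
        then have "(\<lambda>n. exp (- q n x)) \<longlonglongrightarrow> 0"
          by (intro filterlim_compose[OF exp_at_bot] filterlim_compose[OF filterlim_uminus_at_bot_at_top])
        then have "(\<lambda>n. f n x) \<longlonglongrightarrow> of_real 0"
          unfolding f_def by (rule tendsto_of_real)
        then show ?thesis using False by simp
      qed
    qed
    show "AE x in lborel. norm (f n x) \<le> M / (1 + norm x) ^ ?N" for n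
      using bound by simp
  qed measurable
  then show ?thesis
    unfolding closure_sequential using f_schwartz
    by (intro exI[of _ "\<lambda>n. L2_of (f n)"] conjI allI imageI)
qed

lemma in_closure_of_limit:
  fixes S :: "'a::metric_space set"
  assumes "\<And>n. X n \<in> closure S" "X \<longlonglongrightarrow> l"
  shows "l \<in> closure S"
  by (rule closed_sequentially[OF closed_closure]) (use assms in auto)

lemma square_integrable_indicator:
  assumes [measurable]: "A \<in> sets borel" and "A \<subseteq> box a b"
  shows "square_integrable (indicator A :: 'a::euclidean_space \<Rightarrow> complex)"
proof -
  have "emeasure lborel A \<le> emeasure lborel (box a b)"
    by (rule emeasure_mono) (use assms in auto)
  also have "\<dots> < \<infinity>" by (simp add: emeasure_lborel_box_eq)
  finally have "integrable lborel (indicator A :: 'a \<Rightarrow> real)"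
    by (intro integrable_real_indicator) auto
  moreover have "(\<lambda>x. (norm (indicator A x :: complex))\<^sup>2) = indicator A"
    by (auto simp: indicator_def)
  ultimately show ?thesis
    by (simp add: square_integrable_def)
qed

text \<open>Boxes are stable under intersection and generate the Borel sets, so it suffices that the class of
  sets in question is closed under complements and disjoint unions.  The intersection with a fixed
  box keeps all indicators square integrable.\<close>

lemma indicator_bounded_in_closure_schwartz:
  fixes A :: "(real^'n) set"
  assumes "A \<in> sets borel"
  shows "L2_of (indicator (A \<inter> box a b)) \<in> closure (L2_of ` schwartz)"
proof -
  let ?H = "closure (L2_of ` schwartz) :: (real^'n) L2 set"
  let ?G = "range (\<lambda>(a, b). box a (b :: real^'n))"
  let ?K = "box a b"
  have H: "subspace ?H"
    by (rule subspace_closure_normed[OF subspace_schwartz_L2])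
  have sets_eq: "sets borel = sigma_sets UNIV ?G"
    by (simp add: borel_eq_box)
  have Int: "Int_stable ?G"
    unfolding Int_stable_def by (auto simp: box_Int_box intro!: image_eqI[OF _ UNIV_I] split: prod.splits)
  have sq: "square_integrable (indicator (A \<inter> ?K) :: _ \<Rightarrow> complex)" if "A \<in> sigma_sets UNIV ?G" for A
    using that sets_eq by (intro square_integrable_indicator[of _ a b]) auto
  have "?G \<subseteq> Pow UNIV" by simp
  from Int this assms[unfolded sets_eq] show ?thesis
  proof (induction rule: sigma_sets_induct_disjoint)
    case (basic A)
    then obtain u v where "A = box u v" by auto
    then obtain u' v' where "A \<inter> ?K = box u' v'" by (simp add: box_Int_box)
    then show ?case
      using indicator_box_in_closure_schwartz by simp
  next
    case empty
    have "L2_of (\<lambda>x. 0) = (0 :: (real^'n) L2)" by (simp add: zero_L2.abs_eq)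
    moreover have "0 \<in> ?H" using H by (simp add: subspace_0)
    ultimately show ?case by (simp add: indicator_def)
  next
    case (compl A)
    have "indicator ((UNIV - A) \<inter> ?K) = (\<lambda>x. indicator ?K x - indicator (A \<inter> ?K) x :: complex)"
      by (auto simp: indicator_def)
    then have "L2_of (indicator ((UNIV - A) \<inter> ?K)) = L2_of (indicator ?K) - L2_of (indicator (A \<inter> ?K))"
      using sq[OF compl.hyps] square_integrable_indicator[of ?K a b] by (simp add: L2_of_diff)
    then show ?case
      using subspace_diff[OF H indicator_box_in_closure_schwartz compl.IH] by simp
  next
    case (union A)
    have [measurable]: "A i \<in> sets borel" for i using union.hyps sets_eq by auto
    have part: "indicator ((\<Union>i<n. A i) \<inter> ?K) x = (\<Sum>i<n. indicator (A i \<inter> ?K) x :: complex)" for n x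
    proof (induction n)
      case (Suc n)
      have "A n \<inter> A i = {}" if "i < n" for i
        using disjoint_family_onD[OF union.hyps(1), of n i] that by simp
      then have "A n \<inter> (\<Union>i<n. A i) = {}"
        by blast
      then have "indicator ((\<Union>i<Suc n. A i) \<inter> ?K) x = (indicator ((\<Union>i<n. A i) \<inter> ?K) x + indicator (A n \<inter> ?K) x :: complex)"
        by (auto simp: indicator_def lessThan_Suc)
      then show ?case using Suc by simp
    qed simp
    have "L2_of (indicator ((\<Union>i<n. A i) \<inter> ?K)) \<in> ?H" for n
    proof -
      have s: "square_integrable (indicator (A i \<inter> ?K) :: _ \<Rightarrow> complex)" for i
        using union.hyps by (intro sq) auto
      have "L2_of (indicator ((\<Union>i<n. A i) \<inter> ?K)) = (\<Sum>i<n. L2_of (indicator (A i \<inter> ?K)))"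
        unfolding part[abs_def] using s by (intro L2_of_sum) auto
      then show ?thesis
        using union.IH by (simp add: subspace_sum[OF H])
    qed
    moreover have "(\<lambda>n. L2_of (indicator ((\<Union>i<n. A i) \<inter> ?K))) \<longlonglongrightarrow> L2_of (indicator ((\<Union>i. A i) \<inter> ?K))"
    proof (rule L2_dominated_convergence(3)[where w="\<lambda>x. norm (indicator ?K x :: complex)"])
      show "integrable lborel (\<lambda>x. (norm (indicator ?K x :: complex))\<^sup>2)"
        using square_integrable_indicator[of ?K a b] by (simp add: square_integrable_def)
      show "AE x in lborel. (\<lambda>n. indicator ((\<Union>i<n. A i) \<inter> ?K) x :: complex) \<longlonglongrightarrow> indicator ((\<Union>i. A i) \<inter> ?K) x"
      proof (rule AE_I2)
        fix x
        show "(\<lambda>n. indicator ((\<Union>i<n. A i) \<inter> ?K) x :: complex) \<longlonglongrightarrow> indicator ((\<Union>i. A i) \<inter> ?K) x"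
        proof (cases "x \<in> (\<Union>i. A i) \<inter> ?K")
          case True
          then obtain i where i: "x \<in> A i" "x \<in> ?K" by auto
          show ?thesis
            by (rule tendsto_eventually, rule eventually_sequentiallyI[of "Suc i"])
              (use i in \<open>auto simp: indicator_def intro!: bexI[of _ i]\<close>)
        qed (auto simp: indicator_def)
      qed
      show "AE x in lborel. norm (indicator ((\<Union>i<n. A i) \<inter> ?K) x :: complex) \<le> norm (indicator ?K x :: complex)" for n
        by (auto simp: indicator_def)
    qed measurable
    ultimately show ?case
      by (rule in_closure_of_limit)
  qed
qed

text \<open>Simple functions that approximate \<open>f\<close> pointwise, cut off outside large boxes, are dominated by
  \<open>2 \<bar>f\<bar>\<close> and are combinations of indicators of bounded sets.\<close>

theorem schwartz_dense_L2: "closure (L2_of ` schwartz) = (UNIV :: (real^'n) L2 set)"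
proof (intro equalityI subsetI UNIV_I)
  let ?H = "closure (L2_of ` schwartz) :: (real^'n) L2 set"
  have H: "subspace ?H"
    by (rule subspace_closure_normed[OF subspace_schwartz_L2])
  have HC: "c *\<^sub>C F \<in> ?H" if F: "F \<in> ?H" for c F
  proof -
    obtain X where X: "\<And>n. X n \<in> L2_of ` schwartz" "X \<longlonglongrightarrow> F"
      using F unfolding closure_sequential by blast
    show ?thesis
      unfolding closure_sequential
      by (intro exI[of _ "\<lambda>n. c *\<^sub>C X n"] conjI allI scaleC_schwartz_L2 tendsto_scaleC_L2 X)
  qed
  fix F :: "(real^'n) L2"
  obtain f where f: "square_integrable f" and F: "F = L2_of f"
    by (rule L2_of_cases)
  have [measurable]: "f \<in> borel_measurable borel" using f by (simp add: square_integrable_def)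
  obtain s where s: "\<And>n. simple_function borel (s n)" "\<And>x. (\<lambda>n. s n x) \<longlonglongrightarrow> f x" "\<And>n x. norm (s n x) \<le> 2 * norm (f x)"
    using borel_measurable_implies_sequence_metric[of f borel 0] by auto
  define K where "K n = box (\<chi> i. - real n) ((\<chi> i. real n) :: real^'n)" for n
  define g where "g n x = (s n x * indicator (K n) x :: complex)" for n x
  have [measurable]: "s n \<in> borel_measurable borel" "K n \<in> sets borel" for n
    using s(1) borel_measurable_simple_function by (auto simp: K_def)
  have "L2_of (g n) \<in> ?H" for n
  proof -
    let ?R = "range (s n)"
    have fin: "finite ?R" using s(1)[of n] by (simp add: simple_function_def)
    have "g n = (\<lambda>x. \<Sum>z\<in>?R. z * indicator ((s n -` {z}) \<inter> K n) x)"
    proof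
      fix x :: "real^'n"
      have "(\<Sum>z\<in>?R. z * indicator ((s n -` {z}) \<inter> K n) x) = (\<Sum>z\<in>?R. if z = s n x then g n x else 0)"
        by (rule sum.cong) (auto simp: g_def indicator_def)
      then show "g n x = (\<Sum>z\<in>?R. z * indicator ((s n -` {z}) \<inter> K n) x)"
        using fin by simp
    qed
    moreover have meas: "s n -` {z} \<in> sets borel" for z
      using measurable_sets[of "s n" borel borel "{z}"] by simp
    have sq: "square_integrable (indicator ((s n -` {z}) \<inter> K n) :: _ \<Rightarrow> complex)" for z
      using meas by (intro square_integrable_indicator[where a="\<chi> i. - real n" and b="\<chi> i. real n"]) (auto simp: K_def)
    have "L2_of (\<lambda>x. \<Sum>z\<in>?R. z * indicator ((s n -` {z}) \<inter> K n) x) = (\<Sum>z\<in>?R. z *\<^sub>C L2_of (indicator ((s n -` {z}) \<inter> K n)))"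
      using fin sq by (subst L2_of_sum(2)) (auto intro: square_integrable_cmult simp: L2_of_scaleC)
    moreover have "z *\<^sub>C L2_of (indicator ((s n -` {z}) \<inter> K n)) \<in> ?H" for z
      using indicator_bounded_in_closure_schwartz[OF meas] by (intro HC) (simp add: K_def)
    ultimately show ?thesis
      by (simp add: subspace_sum[OF H])
  qed
  moreover have "(\<lambda>n. L2_of (g n)) \<longlonglongrightarrow> L2_of f"
  proof (rule L2_dominated_convergence(3)[where w="\<lambda>x. 2 * norm (f x)"])
    show "g n \<in> borel_measurable borel" for n
      unfolding g_def[abs_def] by measurable
    show "integrable lborel (\<lambda>x. (2 * norm (f x))\<^sup>2)"
      using f by (simp add: square_integrable_def power_mult_distrib)
    show "AE x in lborel. norm (g n x) \<le> 2 * norm (f x)" for n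
      using s(3) by (intro AE_I2) (auto simp: g_def indicator_def)
    show "AE x in lborel. (\<lambda>n. g n x) \<longlonglongrightarrow> f x"
    proof (rule AE_I2)
      fix x :: "real^'n"
      obtain k where k: "norm x < real k" using reals_Archimedean2 by blast
      have "x \<in> K n" if "n \<ge> k" for n
        using k that component_le_norm_cart[of x]
        by (auto simp: K_def mem_box_cart abs_less_iff[symmetric] intro: le_less_trans)
          (smt (verit) of_nat_mono)+
      then have "\<forall>\<^sub>F n in sequentially. s n x = g n x"
        by (intro eventually_sequentiallyI[of k]) (simp add: g_def)
      then show "(\<lambda>n. g n x) \<longlonglongrightarrow> f x"
        using s(2)[of x] by (rule Lim_transform_eventually[rotated])
    qed
  qed simp
  ultimately show "F \<in> ?H"
    unfolding F by (rule in_closure_of_limit)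
qed

section \<open>The matrix exponential and the matrices \<open>Q(t)\<close>\<close>

lemma bounded_bilinear_matrix_mult: "bounded_bilinear ((**) :: real^'n^'m \<Rightarrow> real^'k^'n \<Rightarrow> real^'k^'m)"
  unfolding bilinear_conv_bounded_bilinear[symmetric] bilinear_def
  by (auto intro!: linearI simp: matrix_matrix_mult_def vec_eq_iff sum.distrib sum_distrib_left algebra_simps)

lemmas matrix_mult_scaleR_left = bounded_bilinear.scaleR_left[OF bounded_bilinear_matrix_mult]
  and matrix_mult_scaleR_right = bounded_bilinear.scaleR_right[OF bounded_bilinear_matrix_mult]
  and matrix_mult_minus_left = bounded_bilinear.minus_left[OF bounded_bilinear_matrix_mult]
  and matrix_mult_zero_left = bounded_bilinear.zero_left[OF bounded_bilinear_matrix_mult]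

lemma bounded_bilinear_matrix_vector_mult: "bounded_bilinear ((*v) :: real^'n^'m \<Rightarrow> real^'n \<Rightarrow> real^'m)"
  unfolding bilinear_conv_bounded_bilinear[symmetric] bilinear_def
  by (auto intro!: linearI simp: matrix_vector_mult_def vec_eq_iff sum.distrib sum_distrib_left algebra_simps)

lemma matrix_power_Suc: "matrix_power A (Suc k) = A ** matrix_power A k"
  by (simp add: matrix_power_def)

lemma matrix_power_Suc_right: "matrix_power A (Suc k) = matrix_power A k ** A"
  by (induction k) (simp_all add: matrix_power_Suc, simp_all add: matrix_power_def matrix_mul_assoc)

lemma matrix_power_scaleR: "matrix_power (c *\<^sub>R A) k = c ^ k *\<^sub>R matrix_power A k"
  by (induction k) (simp_all add: matrix_power_Suc matrix_mult_scaleR_left matrix_mult_scaleR_right, simp_all add: matrix_power_def)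

lemma matrix_power_transpose: "matrix_power (transpose A) k = transpose (matrix_power A k)"
proof (induction k)
  case (Suc k)
  then show ?case
    by (simp only: matrix_power_Suc[of "transpose A"] matrix_power_Suc_right[of A] matrix_transpose_mul)
qed (simp add: matrix_power_def transpose_mat)

lemma summable_matrix_exp: "summable (\<lambda>k. matrix_power A k /\<^sub>R fact k)" for A :: "real^'n^'n"
proof -
  obtain K where K: "\<And>(A :: real^'n^'n) (B :: real^'n^'n). norm (A ** B) \<le> norm A * norm B * K" "K > 0"
    using bounded_bilinear.pos_bounded[OF bounded_bilinear_matrix_mult] by blast
  let ?c = "norm (mat 1 :: real^'n^'n)"
  have "norm (matrix_power A k) \<le> ?c * (K * norm A) ^ k" for k
  proof (induction k)
    case (Suc k)
    have "norm (matrix_power A (Suc k)) \<le> norm A * norm (matrix_power A k) * K"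
      unfolding matrix_power_Suc using K(1)[of A "matrix_power A k"] by simp
    also have "\<dots> \<le> norm A * (?c * (K * norm A) ^ k) * K"
      using Suc K(2) by (intro mult_right_mono mult_left_mono) auto
    finally show ?case by (simp add: mult_ac)
  qed (simp add: matrix_power_def)
  then have le: "norm (matrix_power A k /\<^sub>R fact k) \<le> ?c * ((K * norm A) ^ k /\<^sub>R fact k)" for k
    by (simp add: divide_inverse mult.commute mult_left_mono)
  have "summable (\<lambda>k. ?c * ((K * norm A) ^ k /\<^sub>R fact k))"
    by (intro summable_mult summable_exp_generic)
  then show ?thesis
    by (rule summable_comparison_test'[where N=0]) (rule le)
qed

lemma matrix_exp_nth:
  fixes A :: "real^'n^'n"
  shows "summable (\<lambda>k. matrix_power A k $ i $ j / fact k)"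
    and "matrix_exp A $ i $ j = (\<Sum>k. matrix_power A k $ i $ j / fact k)"
proof -
  have bl: "bounded_linear (\<lambda>M :: real^'n^'n. M $ i $ j)"
    by (intro bounded_linear_compose[OF bounded_linear_vec_nth bounded_linear_vec_nth])
  show "summable (\<lambda>k. matrix_power A k $ i $ j / fact k)"
    using bounded_linear.summable[OF bl summable_matrix_exp[of A]] by (simp add: divide_inverse mult.commute)
  show "matrix_exp A $ i $ j = (\<Sum>k. matrix_power A k $ i $ j / fact k)"
    unfolding matrix_exp_def using bounded_linear.suminf[OF bl summable_matrix_exp[of A]]
    by (simp add: divide_inverse mult.commute)
qed

lemma matrix_exp_transpose: "matrix_exp (t *\<^sub>R transpose B) = transpose (matrix_exp (t *\<^sub>R B))" for B :: "real^'n^'n"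
proof -
  have "transpose M $ i $ j = M $ j $ i" for M :: "real^'n^'n" and i j
    by (simp add: transpose_def)
  then show ?thesis
    by (simp add: vec_eq_iff matrix_exp_nth(2) matrix_power_scaleR matrix_power_transpose)
qed

lemma matrix_exp_zero [simp]: "matrix_exp 0 = (mat 1 :: real^'n^'n)"
proof -
  have "matrix_power (0 :: real^'n^'n) k /\<^sub>R fact k = (if k = 0 then mat 1 else 0)" for k
    by (cases k) (simp_all add: matrix_power_Suc matrix_power_def matrix_mult_zero_left)
  moreover have "(\<Sum>k. if k = 0 then mat 1 else 0 :: real^'n^'n) = mat 1"
    using suminf_finite[of "{0::nat}" "\<lambda>k. if k = 0 then mat 1 else 0 :: real^'n^'n"] by simp
  ultimately show ?thesis
    unfolding matrix_exp_def by (simp only:)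
qed

lemma matrix_has_vector_derivativeI:
  fixes F :: "real \<Rightarrow> real^'n^'m"
  assumes "\<And>i j. ((\<lambda>t. F t $ i $ j) has_real_derivative F' $ i $ j) (at t)"
  shows "(F has_vector_derivative F') (at t)"
  unfolding has_vector_derivative_def
proof (subst has_derivative_componentwise_within, intro ballI)
  fix b :: "real^'n^'m" assume "b \<in> Basis"
  then obtain i j where b: "b = axis i (axis j 1)"
    by (auto simp: Basis_vec_def)
  show "((\<lambda>t. F t \<bullet> b) has_derivative (\<lambda>x. (x *\<^sub>R F') \<bullet> b)) (at t)"
    using assms[of i j] unfolding b by (simp add: inner_axis has_field_derivative_def mult.commute[of _ "F' $ i $ j"])
qed

text \<open>Every entry is a power series in \<open>t\<close>.  The series of its derivative has the factor \<open>B\<close> to be split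
  off from \<open>B ^ (k + 1)\<close> on either side, which gives the derivative and the commutation rule at once.\<close>

lemma
  fixes B :: "real^'n^'n"
  shows matrix_exp_has_vector_derivative: "((\<lambda>t. matrix_exp (t *\<^sub>R B)) has_vector_derivative B ** matrix_exp (t *\<^sub>R B)) (at t)"
    and matrix_exp_commute: "B ** matrix_exp (t *\<^sub>R B) = matrix_exp (t *\<^sub>R B) ** B"
proof -
  define c where "c i j k = matrix_power B k $ i $ j / fact k" for i j k
  have sm: "summable (\<lambda>k. c i j k * t ^ k)" for i j t
    using matrix_exp_nth(1)[of "t *\<^sub>R B" i j] by (simp add: c_def matrix_power_scaleR mult.commute)
  have eq: "matrix_exp (t *\<^sub>R B) $ i $ j = (\<Sum>k. c i j k * t ^ k)" for i j t
    unfolding matrix_exp_nth(2) by (simp add: c_def matrix_power_scaleR mult.commute)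
  have dc: "diffs (c i j) k * t ^ k = (\<Sum>l\<in>UNIV. B $ i $ l * (c l j k * t ^ k))" for i j k t
  proof -
    have "diffs (c i j) k = matrix_power B (Suc k) $ i $ j / fact k"
      by (simp add: diffs_def c_def)
    also have "\<dots> = (\<Sum>l\<in>UNIV. B $ i $ l * c l j k)"
      by (simp add: matrix_power_Suc matrix_matrix_mult_def c_def sum_divide_distrib)
    finally show ?thesis by (simp add: sum_distrib_right mult.assoc)
  qed
  have dc': "diffs (c i j) k * t ^ k = (\<Sum>l\<in>UNIV. (c i l k * t ^ k) * B $ l $ j)" for i j k t
  proof -
    have "diffs (c i j) k = matrix_power B (Suc k) $ i $ j / fact k"
      by (simp add: diffs_def c_def)
    also have "\<dots> = (\<Sum>l\<in>UNIV. c i l k * B $ l $ j)"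
      by (simp add: matrix_power_Suc_right matrix_matrix_mult_def c_def sum_divide_distrib)
    finally show ?thesis by (simp add: sum_distrib_left mult_ac)
  qed
  have left: "(\<Sum>k. diffs (c i j) k * t ^ k) = (B ** matrix_exp (t *\<^sub>R B)) $ i $ j" for i j
    unfolding dc using sm
    by (subst suminf_sum) (auto intro!: summable_mult sum.cong simp: suminf_mult matrix_matrix_mult_def eq)
  have right: "(\<Sum>k. diffs (c i j) k * t ^ k) = (matrix_exp (t *\<^sub>R B) ** B) $ i $ j" for i j
    unfolding dc' using sm
    by (subst suminf_sum) (auto intro!: summable_mult2 sum.cong simp: suminf_mult2[symmetric] matrix_matrix_mult_def eq)
  show "B ** matrix_exp (t *\<^sub>R B) = matrix_exp (t *\<^sub>R B) ** B"
    using left right by (simp add: vec_eq_iff)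
  show "((\<lambda>t. matrix_exp (t *\<^sub>R B)) has_vector_derivative B ** matrix_exp (t *\<^sub>R B)) (at t)"
    using termdiffs_strong_converges_everywhere[OF sm, of _ _ t]
    by (intro matrix_has_vector_derivativeI) (simp only: eq left[symmetric])
qed

text \<open>The derivative of \<open>e\<^bsup>-sB\<^esup> e\<^bsup>(s+t)B\<^esup>\<close> with respect to \<open>s\<close> vanishes.\<close>

lemma matrix_exp_neg_mult: "matrix_exp ((- s) *\<^sub>R B) ** matrix_exp ((s + t) *\<^sub>R B) = matrix_exp (t *\<^sub>R B)"
  for B :: "real^'n^'n"
proof -
  let ?U = "\<lambda>t. matrix_exp (t *\<^sub>R B)"
  have "((\<lambda>s. ?U (- s) ** ?U (s + t)) has_derivative (\<lambda>h. 0)) (at s)" for s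
  proof -
    have "((\<lambda>s. - s) has_vector_derivative -1) (at s)" for s :: real
      by (auto intro!: derivative_eq_intros)
    from vector_diff_chain_at[OF this matrix_exp_has_vector_derivative[of B "- s"]]
    have 1: "((\<lambda>s. ?U (- s)) has_vector_derivative - (?U (- s) ** B)) (at s)"
      unfolding matrix_exp_commute[of B "- s"] by (simp add: o_def)
    have "((\<lambda>s. s + t) has_vector_derivative 1) (at s)" for s :: real
      by (auto intro!: derivative_eq_intros)
    from vector_diff_chain_at[OF this matrix_exp_has_vector_derivative[of B "s + t"]]
    have 2: "((\<lambda>s. ?U (s + t)) has_vector_derivative B ** ?U (s + t)) (at s)"
      by (simp add: o_def)
    from bounded_bilinear.has_vector_derivative[OF bounded_bilinear_matrix_mult 1 2]
    show ?thesis
      by (simp add: has_vector_derivative_def matrix_mul_assoc matrix_mult_minus_left)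
  qed
  then obtain c where c: "\<And>s. ?U (- s) ** ?U (s + t) = c"
    using has_derivative_zero_constant[of UNIV "\<lambda>s. ?U (- s) ** ?U (s + t)"] by auto
  show ?thesis
    using c[of s] c[of 0] by simp
qed

lemma matrix_exp_neg: "matrix_exp ((- s) *\<^sub>R B) ** matrix_exp (s *\<^sub>R B) = mat 1"
  "matrix_exp (s *\<^sub>R B) ** matrix_exp ((- s) *\<^sub>R B) = mat 1"
  using matrix_exp_neg_mult[of s B 0] matrix_exp_neg_mult[of "- s" B 0] by simp_all

lemma invertible_matrix_exp: "invertible (matrix_exp (t *\<^sub>R B))"
  unfolding invertible_def using matrix_exp_neg by blast

lemma matrix_exp_add: "matrix_exp ((s + t) *\<^sub>R B) = matrix_exp (s *\<^sub>R B) ** matrix_exp (t *\<^sub>R B)"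
  for B :: "real^'n^'n"
proof -
  have "matrix_exp (s *\<^sub>R B) ** (matrix_exp ((- s) *\<^sub>R B) ** matrix_exp ((s + t) *\<^sub>R B)) = matrix_exp ((s + t) *\<^sub>R B)"
    by (simp only: matrix_mul_assoc matrix_exp_neg matrix_mul_lid)
  then show ?thesis
    by (simp only: matrix_exp_neg_mult)
qed

lemma continuous_on_matrix_exp: "continuous_on X (\<lambda>t. matrix_exp (t *\<^sub>R B))" for B :: "real^'n^'n"
  by (intro continuous_at_imp_continuous_on ballI) (metis has_vector_derivative_continuous matrix_exp_has_vector_derivative)

lemma continuous_on_Qt_integrand:
  fixes Q B :: "real^'n^'n"
  shows "continuous_on X (\<lambda>s. matrix_exp (s *\<^sub>R B) ** Q ** matrix_exp (s *\<^sub>R transpose B))"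
  by (intro bounded_bilinear.continuous_on[OF bounded_bilinear_matrix_mult] continuous_on_matrix_exp continuous_on_const)

lemma Qt_zero [simp]: "Qt Q B 0 = 0"
  by (simp add: Qt_def)

text \<open>The part of the integral beyond \<open>t\<close> is the integral over \<open>[0, s]\<close> conjugated by \<open>exp(tB)\<close>.\<close>

lemma Qt_add:
  fixes Q B :: "real^'n^'n"
  assumes "0 \<le> s" "0 \<le> t"
  shows "Qt Q B (t + s) = Qt Q B t + matrix_exp (t *\<^sub>R B) ** Qt Q B s ** transpose (matrix_exp (t *\<^sub>R B))"
proof -
  let ?U = "\<lambda>t. matrix_exp (t *\<^sub>R B)"
  let ?q = "\<lambda>s. ?U s ** Q ** matrix_exp (s *\<^sub>R transpose B)"
  have int: "?q integrable_on {a..b}" for a b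
    by (intro integrable_continuous_real continuous_on_Qt_integrand)
  have "bounded_linear (\<lambda>M. ?U t ** M ** transpose (?U t))"
    by (rule bounded_linear_compose[OF bounded_bilinear.bounded_linear_left[OF bounded_bilinear_matrix_mult]
        bounded_bilinear.bounded_linear_right[OF bounded_bilinear_matrix_mult]])
  then have "integral {0..s} (\<lambda>r. ?U t ** ?q r ** transpose (?U t)) = ?U t ** Qt Q B s ** transpose (?U t)"
    using Henstock_Kurzweil_Integration.integral_linear[OF int[of 0 s], of "\<lambda>M. ?U t ** M ** transpose (?U t)"] by (simp add: Qt_def o_def)
  moreover have "?U t ** ?q r ** transpose (?U t) = ?q (t + r)" for r
    by (simp add: matrix_exp_add matrix_exp_transpose matrix_transpose_mul matrix_mul_assoc)
  moreover have "integral {0..s} (\<lambda>r. ?q (t + r)) = integral {t..t + s} ?q"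
    using integral_shift[OF continuous_on_Qt_integrand[of "{0 + t..s + t}" B Q]] by (simp add: add.commute o_def)
  moreover have "integral {0..t} ?q + integral {t..t + s} ?q = integral {0..t + s} ?q"
    using assms int by (intro Henstock_Kurzweil_Integration.integral_combine) auto
  ultimately show ?thesis
    by (simp add: Qt_def)
qed

lemma integral_average_tendsto:
  fixes c :: "real \<Rightarrow> 'a::banach"
  assumes "continuous_on {0..1} c"
  shows "((\<lambda>t. integral {0..t} c /\<^sub>R t) \<longlongrightarrow> c 0) (at_right 0)"
proof -
  let ?I = "\<lambda>t. integral {0..t} c"
  have "(?I has_vector_derivative c 0) (at 0 within {0..1})"
    by (rule integral_has_vector_derivative[OF assms]) simp
  then have "((\<lambda>t. norm (?I t - ?I 0 - (t - 0) *\<^sub>R c 0) / norm (t - 0)) \<longlongrightarrow> 0) (at 0 within {0..1})"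
    unfolding has_vector_derivative_def has_derivative_within'
    by (simp add: has_derivative_within' tendsto_iff eventually_at dist_norm) force
  moreover have "at 0 within {0..1} = (at_right 0 :: real filter)"
    by (rule at_within_nhd[of _ "{..<1}"]) auto
  ultimately have "((\<lambda>t. norm (?I t - t *\<^sub>R c 0) / norm t) \<longlongrightarrow> 0) (at_right 0)"
    by simp
  moreover have "\<forall>\<^sub>F t in at_right 0. norm (?I t - t *\<^sub>R c 0) / norm t = norm (?I t /\<^sub>R t - c 0)"
    unfolding eventually_at
  proof (intro exI[of _ 1] conjI ballI impI)
    fix t :: real assume t: "t \<in> {0<..}" "t \<noteq> 0 \<and> dist t 0 < 1"
    then have "?I t /\<^sub>R t - c 0 = (?I t - t *\<^sub>R c 0) /\<^sub>R t"
      by (simp add: scaleR_right_diff_distrib)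
    then show "norm (?I t - t *\<^sub>R c 0) / norm t = norm (?I t /\<^sub>R t - c 0)"
      by (simp add: divide_inverse mult.commute)
  qed simp
  ultimately have "((\<lambda>t. norm (?I t /\<^sub>R t - c 0)) \<longlongrightarrow> 0) (at_right 0)"
    by (rule Lim_transform_eventually)
  then show ?thesis
    by (simp add: tendsto_norm_zero_iff LIM_zero_iff)
qed

lemma Qt_quotient: "((\<lambda>t. Qt Q B t /\<^sub>R t) \<longlongrightarrow> Q) (at_right 0)" for Q B :: "real^'n^'n"
  using integral_average_tendsto[OF continuous_on_Qt_integrand[of _ B Q]] by (simp add: Qt_def)

text \<open>A basis that is orthonormal for the inner product \<open>\<langle>Px, y\<rangle>\<close> is built one vector at a time: fewer
  than \<open>n\<close> linear conditions always leave a nonzero vector.\<close>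

lemma pos_definite_orthonormal_basis:
  fixes P :: "real^'n^'n"
  assumes P: "pos_definite P" and "finite I"
  shows "\<exists>f :: 'n \<Rightarrow> real^'n. \<forall>i\<in>I. \<forall>j\<in>I. (P *v f i) \<bullet> f j = of_bool (i = j)"
  using \<open>finite I\<close>
proof induction
  case (insert k I)
  then obtain f where f: "\<And>i j. i \<in> I \<Longrightarrow> j \<in> I \<Longrightarrow> (P *v f i) \<bullet> f j = of_bool (i = j)"
    by blast
  have sym: "(P *v x) \<bullet> y = (P *v y) \<bullet> x" for x y
  proof -
    have "(P *v y) \<bullet> x = x \<bullet> (P *v y)" by (rule inner_commute)
    also have "\<dots> = (transpose P *v x) \<bullet> y" by (rule inner_transpose)
    finally show ?thesis using P by (simp only: pos_definite_def)
  qed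
  have "dim ((\<lambda>i. P *v f i) ` I) \<le> card ((\<lambda>i. P *v f i) ` I)"
    by (rule dim_le_card') (use insert in simp)
  also have "\<dots> \<le> card I" using insert by (intro card_image_le)
  also have "\<dots> < CARD('n)"
    using insert by (intro psubset_card_mono) auto
  finally obtain x where x: "x \<noteq> 0" "\<And>i. i \<in> I \<Longrightarrow> (P *v f i) \<bullet> x = 0"
    by (rule_tac orthogonal_to_subspace_exists[of "(\<lambda>i. P *v f i) ` I"])
      (auto simp: orthogonal_def inner_commute intro: span_base)
  define r where "r = sqrt ((P *v x) \<bullet> x)"
  have pos: "(P *v x) \<bullet> x > 0" using P x(1) by (auto simp: pos_definite_def)
  then have r: "r > 0" "r * r = (P *v x) \<bullet> x" by (simp_all add: r_def)
  have kk: "(P *v (x /\<^sub>R r)) \<bullet> (x /\<^sub>R r) = 1"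
    using r(1) by (simp add: matrix_vector_mult_scaleR r(2)[symmetric], simp add: field_simps)
  have ik: "(P *v f i) \<bullet> (x /\<^sub>R r) = 0" "(P *v (x /\<^sub>R r)) \<bullet> f i = 0" if "i \<in> I" for i
    using x(2)[OF that] sym[of x "f i"] by (simp_all add: matrix_vector_mult_scaleR)
  have "(P *v (f(k := x /\<^sub>R r)) i) \<bullet> (f(k := x /\<^sub>R r)) j = of_bool (i = j)" if "i \<in> insert k I" "j \<in> insert k I" for i j
    using that f kk ik insert.hyps by (cases "i = k"; cases "j = k") auto
  then show ?case by blast
qed simp

text \<open>A matrix \<open>R\<close> whose columns are orthonormal for \<open>\<langle>Px, y\<rangle>\<close> satisfies \<open>R\<^sup>T P R = 1\<close>; so \<open>M\<close> is the inverse
  \<open>R\<^sup>T P\<close> of \<open>R\<close>, and \<open>R\<close> itself serves as \<open>M'\<close>.\<close>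

lemma pos_definite_factorization:
  fixes P :: "real^'n^'n"
  assumes P: "pos_definite P"
  obtains M M' where "M' ** M = mat 1" "P = transpose M ** M" "matrix_inv P = M' ** transpose M'" "\<bar>det M\<bar> = sqrt (det P)"
proof -
  obtain f :: "'n \<Rightarrow> real^'n" where f: "\<And>i j. (P *v f i) \<bullet> f j = of_bool (i = j)"
    using pos_definite_orthonormal_basis[OF P, of UNIV] by auto
  define R where "R = (\<chi> i j. f j $ i)"
  have "transpose R ** P ** R = mat 1"
  proof -
    have "(transpose R ** (P ** R)) $ i $ j = (P *v f j) \<bullet> f i" for i j
      by (simp add: R_def transpose_def matrix_matrix_mult_def inner_vec_def matrix_vector_mult_def mult.commute)
    then show ?thesis
      by (simp add: vec_eq_iff f mat_def of_bool_def matrix_mul_assoc[symmetric])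
  qed
  then have 1: "(transpose R ** P) ** R = mat 1" by simp
  then have 2: "R ** (transpose R ** P) = mat 1"
    using matrix_left_right_inverse by blast
  have 3: "(R ** transpose R) ** P = mat 1" using 2 by (simp add: matrix_mul_assoc)
  then have 4: "P ** (R ** transpose R) = mat 1"
    using matrix_left_right_inverse by blast
  define M where "M = transpose R ** P"
  have PT: "transpose P = P" using P by (simp add: pos_definite_def)
  have "transpose M ** M = P ** (R ** transpose R) ** P"
    by (simp add: M_def matrix_transpose_mul PT matrix_mul_assoc)
  then have PM: "P = transpose M ** M" using 4 by simp
  have "\<exists>A'. P ** A' = mat 1 \<and> A' ** P = mat 1" using 3 4 by blast
  from someI_ex[OF this] have "matrix_inv P ** P = mat 1" by (simp add: matrix_inv_def)
  then have "matrix_inv P ** P ** (R ** transpose R) = R ** transpose R" by simp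
  then have inv: "matrix_inv P = R ** transpose R"
    using 4 by (simp add: matrix_mul_assoc[symmetric])
  have "det P = det M * det M"
    by (subst PM) (simp add: det_mul)
  then have det: "\<bar>det M\<bar> = sqrt (det P)" by simp
  have "R ** M = mat 1" using 2 by (simp only: M_def)
  then show thesis
    by (rule that[OF _ PM inv det])
qed

section \<open>Bounded operators and semigroups determined on a dense subspace\<close>

lemma continuous_eq_on_dense:
  fixes f g :: "'a::topological_space \<Rightarrow> 'b::t2_space"
  assumes "continuous_on UNIV f" "continuous_on UNIV g" "closure C = UNIV" "\<And>x. x \<in> C \<Longrightarrow> f x = g x"
  shows "f x = g x"
proof -
  have "closed {x. f x = g x}"
    by (intro closed_Collect_eq assms)
  then have "closure C \<subseteq> {x. f x = g x}"
    using assms(4) by (intro closure_minimal) auto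
  with assms(3) show ?thesis by auto
qed

lemma bounded_linear_extension_dense:
  fixes u :: "'a::real_normed_vector \<Rightarrow> 'b::banach"
  assumes C: "subspace C" "closure C = UNIV"
    and add: "\<And>x y. x \<in> C \<Longrightarrow> y \<in> C \<Longrightarrow> u (x + y) = u x + u y"
    and scale: "\<And>c x. x \<in> C \<Longrightarrow> u (c *\<^sub>R x) = c *\<^sub>R u x"
    and bound: "\<And>x. x \<in> C \<Longrightarrow> norm (u x) \<le> K * norm x"
  shows "\<exists>T. bounded_linear T \<and> (\<forall>x\<in>C. T x = u x) \<and> (\<forall>x. norm (T x) \<le> K * norm x)"
proof -
  have diff: "u (x - y) = u x - u y" if "x \<in> C" "y \<in> C" for x y
  proof -
    have "u (x + (-1) *\<^sub>R y) = u x + u ((-1) *\<^sub>R y)"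
      by (intro add subspace_scale[OF C(1)] that)
    also have "u ((-1) *\<^sub>R y) = (-1) *\<^sub>R u y"
      by (intro scale that)
    finally show ?thesis by simp
  qed
  have "(\<bar>K\<bar>)-lipschitz_on C u"
  proof (rule lipschitz_onI)
    fix x y assume xy: "x \<in> C" "y \<in> C"
    have "dist (u x) (u y) \<le> K * norm (x - y)"
      using bound[OF subspace_diff[OF C(1) xy]] by (simp add: dist_norm diff xy)
    also have "\<dots> \<le> \<bar>K\<bar> * dist x y"
      by (simp add: dist_norm mult_right_mono)
    finally show "dist (u x) (u y) \<le> \<bar>K\<bar> * dist x y" .
  qed simp
  then have "uniformly_continuous_on C u"
    by (rule lipschitz_on_uniformly_continuous)
  then obtain T where T: "uniformly_continuous_on (closure C) T" "\<And>x. x \<in> C \<Longrightarrow> u x = T x"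
    by (rule uniformly_continuous_on_extension_on_closure) blast
  have cont: "isCont T x" for x
    using uniformly_continuous_imp_continuous[OF T(1)] by (simp add: C(2) continuous_on_eq_continuous_at)
  have approx: "\<exists>X. (\<forall>n. X n \<in> C) \<and> X \<longlonglongrightarrow> x" for x
    using C(2) by (simp add: closure_sequential[symmetric])
  have lim: "(\<lambda>n. T (X n)) \<longlonglongrightarrow> T x" if "X \<longlonglongrightarrow> x" for X x
    using cont that by (rule isCont_tendsto_compose)
  have Tadd: "T (x + y) = T x + T y" for x y
  proof -
    obtain X Y where X: "\<And>n. X n \<in> C" "X \<longlonglongrightarrow> x" and Y: "\<And>n. Y n \<in> C" "Y \<longlonglongrightarrow> y"
      using approx by metis
    have "(\<lambda>n. T (X n + Y n)) \<longlonglongrightarrow> T (x + y)"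
      by (intro lim tendsto_add X Y)
    moreover have "(\<lambda>n. T (X n) + T (Y n)) \<longlonglongrightarrow> T x + T y"
      by (intro lim tendsto_add X Y)
    moreover have "T (X n + Y n) = T (X n) + T (Y n)" for n
      using add[OF X(1) Y(1)] T(2)[OF subspace_add[OF C(1) X(1) Y(1)]] T(2)[OF X(1)] T(2)[OF Y(1)] by simp
    ultimately show ?thesis using LIMSEQ_unique by simp
  qed
  have Tscale: "T (c *\<^sub>R x) = c *\<^sub>R T x" for c x
  proof -
    obtain X where X: "\<And>n. X n \<in> C" "X \<longlonglongrightarrow> x"
      using approx by metis
    have "(\<lambda>n. T (c *\<^sub>R X n)) \<longlonglongrightarrow> T (c *\<^sub>R x)"
      by (intro lim tendsto_scaleR tendsto_const X)
    moreover have "(\<lambda>n. c *\<^sub>R T (X n)) \<longlonglongrightarrow> c *\<^sub>R T x"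
      by (intro lim tendsto_scaleR tendsto_const X)
    moreover have "T (c *\<^sub>R X n) = c *\<^sub>R T (X n)" for n
      using scale[OF X(1)] T(2)[OF subspace_scale[OF C(1) X(1)]] T(2)[OF X(1)] by simp
    ultimately show ?thesis using LIMSEQ_unique by simp
  qed
  have Tbound: "norm (T x) \<le> K * norm x" for x
  proof -
    obtain X where X: "\<And>n. X n \<in> C" "X \<longlonglongrightarrow> x"
      using approx by metis
    have 1: "(\<lambda>n. norm (T (X n))) \<longlonglongrightarrow> norm (T x)"
      by (intro tendsto_norm lim X)
    have 2: "(\<lambda>n. K * norm (X n)) \<longlonglongrightarrow> K * norm x"
      by (intro tendsto_mult tendsto_const tendsto_norm X)
    have "norm (T (X n)) \<le> K * norm (X n)" for n
      using bound[OF X(1)] T(2)[OF X(1)] by simp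
    then show ?thesis
      using LIMSEQ_le[OF 1 2] by blast
  qed
  have "bounded_linear T"
    by (rule bounded_linear_intro[where K=K]) (auto simp: Tadd Tscale Tbound mult.commute)
  then show ?thesis
    using T(2) Tbound by auto
qed

text \<open>The norm bound also ensures that \<open>V\<close> respects equality almost everywhere, and hence acts on classes.\<close>

lemma L2_extension:
  fixes V :: "(real^'n \<Rightarrow> complex) \<Rightarrow> real^'n \<Rightarrow> complex"
  assumes VS: "\<And>\<phi>. \<phi> \<in> schwartz \<Longrightarrow> V \<phi> \<in> schwartz"
    and add: "\<And>\<phi> \<psi>. \<phi> \<in> schwartz \<Longrightarrow> \<psi> \<in> schwartz \<Longrightarrow> V (\<lambda>x. \<phi> x + \<psi> x) = (\<lambda>x. V \<phi> x + V \<psi> x)"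
    and cmult: "\<And>c \<phi>. \<phi> \<in> schwartz \<Longrightarrow> V (\<lambda>x. c * \<phi> x) = (\<lambda>x. c * V \<phi> x)"
    and bound: "\<And>\<phi>. \<phi> \<in> schwartz \<Longrightarrow> norm (L2_of (V \<phi>)) \<le> K * norm (L2_of \<phi>)"
  shows "\<exists>T. bounded_linear T \<and> (\<forall>c F. T (c *\<^sub>C F) = c *\<^sub>C T F) \<and> (\<forall>\<phi>\<in>schwartz. T (L2_of \<phi>) = L2_of (V \<phi>)) \<and> (\<forall>F. norm (T F) \<le> K * norm F)"
proof -
  define u where "u F = L2_of (V (SOME \<phi>. \<phi> \<in> schwartz \<and> L2_of \<phi> = F))" for F
  note sq = square_integrable_schwartz
  have u: "u (L2_of \<phi>) = L2_of (V \<phi>)" if S: "\<phi> \<in> schwartz" for \<phi>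
  proof -
    define \<psi> where "\<psi> = (SOME \<psi>. \<psi> \<in> schwartz \<and> L2_of \<psi> = L2_of \<phi>)"
    have \<psi>: "\<psi> \<in> schwartz \<and> L2_of \<psi> = L2_of \<phi>"
      unfolding \<psi>_def by (rule someI[of _ \<phi>]) (use S in simp)
    have mS: "(\<lambda>x. -1 * \<phi> x) \<in> schwartz" using S by (rule schwartz_cmult)
    have dS: "(\<lambda>x. \<psi> x + -1 * \<phi> x) \<in> schwartz"
      using \<psi> mS by (intro schwartz_add) auto
    have "L2_of (V \<psi>) - L2_of (V \<phi>) = L2_of (V (\<lambda>x. \<psi> x + -1 * \<phi> x))"
      using \<psi> S mS by (simp only: add cmult L2_of_diff sq VS) simp
    moreover have "L2_of (\<lambda>x. \<psi> x + -1 * \<phi> x) = 0"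
      using L2_of_diff[OF sq sq, of \<psi> \<phi>] \<psi> S by simp
    then have "norm (L2_of (V (\<lambda>x. \<psi> x + -1 * \<phi> x))) \<le> 0"
      using bound[OF dS] \<psi> by simp
    ultimately have "L2_of (V \<psi>) = L2_of (V \<phi>)" by simp
    then show ?thesis by (simp add: u_def \<psi>_def)
  qed
  have "\<exists>T. bounded_linear T \<and> (\<forall>x\<in>L2_of ` schwartz. T x = u x) \<and> (\<forall>x. norm (T x) \<le> K * norm x)"
  proof (rule bounded_linear_extension_dense[OF subspace_schwartz_L2 schwartz_dense_L2])
    fix F G assume "F \<in> L2_of ` (schwartz :: (real^'n \<Rightarrow> complex) set)" "G \<in> L2_of ` (schwartz :: (real^'n \<Rightarrow> complex) set)"
    then show "u (F + G) = u F + u G"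
      by (auto simp: L2_of_add sq u schwartz_add add VS)
  next
    fix c F assume "F \<in> L2_of ` (schwartz :: (real^'n \<Rightarrow> complex) set)"
    then show "u (c *\<^sub>R F) = c *\<^sub>R u F"
      by (auto simp: scaleR_eq_scaleC_L2 L2_of_scaleC sq u schwartz_cmult cmult VS)
  next
    fix F assume "F \<in> L2_of ` (schwartz :: (real^'n \<Rightarrow> complex) set)"
    then show "norm (u F) \<le> K * norm F"
      using bound by (auto simp: u)
  qed
  then obtain T where T: "bounded_linear T" "\<And>\<phi>. \<phi> \<in> schwartz \<Longrightarrow> T (L2_of \<phi>) = L2_of (V \<phi>)" "\<And>F. norm (T F) \<le> K * norm F"
    by (auto simp: u)
  have contT: "continuous_on UNIV T"
    using T(1) by (rule linear_continuous_on)
  have contC: "continuous_on UNIV (\<lambda>F. c *\<^sub>C F)" for c and F :: "(real^'n) L2"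
    by (rule continuous_at_imp_continuous_on) (auto simp: isCont_def intro: tendsto_scaleC_L2)
  have "T (c *\<^sub>C F) = c *\<^sub>C T F" for c F
  proof (rule continuous_eq_on_dense[of "\<lambda>F. T (c *\<^sub>C F)" "\<lambda>F. c *\<^sub>C T F", OF _ _ schwartz_dense_L2])
    show "continuous_on UNIV (\<lambda>F. T (c *\<^sub>C F))"
      by (rule continuous_on_compose2[OF contT contC]) simp
    show "continuous_on UNIV (\<lambda>F. c *\<^sub>C T F)"
      by (rule continuous_on_compose2[OF contC contT]) simp
    fix F assume "F \<in> L2_of ` (schwartz :: (real^'n \<Rightarrow> complex) set)"
    then show "T (c *\<^sub>C F) = c *\<^sub>C T F"
      by (auto simp: L2_of_scaleC sq T(2) schwartz_cmult cmult VS)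
  qed
  with T show ?thesis by blast
qed

text \<open>Both signs of \<open>s - t\<close> are reduced to an operator at the smaller time applied to an increment
  from time zero, since the family is not defined for negative times.\<close>

lemma semigroup_increment:
  fixes T :: "real \<Rightarrow> 'a::real_normed_vector \<Rightarrow> 'a"
  assumes lin: "\<And>t. 0 \<le> t \<Longrightarrow> bounded_linear (T t)"
    and law: "\<And>s t. 0 \<le> s \<Longrightarrow> 0 \<le> t \<Longrightarrow> T (s + t) = T s \<circ> T t"
    and "0 \<le> s" "0 \<le> t"
  shows "T s f - T t f = (if t \<le> s then T t (T (s - t) f - f) else - T s (T (t - s) f - f))"
proof (cases "t \<le> s")
  case True
  then have "T s f = T t (T (s - t) f)"
    using law[of t "s - t"] assms by simp
  with True show ?thesis
    using linear_diff[OF bounded_linear.linear[OF lin[OF \<open>0 \<le> t\<close>]]] by simp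
next
  case False
  then have "T t f = T s (T (t - s) f)"
    using law[of s "t - s"] assms by simp
  with False show ?thesis
    using linear_diff[OF bounded_linear.linear[OF lin[OF \<open>0 \<le> s\<close>]]] by simp
qed

text \<open>An increment between any two times is bounded by a constant times \<open>\<bar>T h f - f\<bar>\<close> with \<open>h\<close> the
  distance of the times.  This tends to zero for \<open>f \<in> C\<close>, and by uniform boundedness for all \<open>f\<close>.\<close>

lemma semigroup_strongly_continuous:
  fixes T :: "real \<Rightarrow> 'a::real_normed_vector \<Rightarrow> 'a"
  assumes lin: "\<And>t. 0 \<le> t \<Longrightarrow> bounded_linear (T t)"
    and zero: "T 0 = id"
    and law: "\<And>s t. 0 \<le> s \<Longrightarrow> 0 \<le> t \<Longrightarrow> T (s + t) = T s \<circ> T t"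
    and bounded: "\<And>b. \<exists>K>0. \<forall>t\<in>{0..b}. \<forall>f. norm (T t f) \<le> K * norm f"
    and dense: "closure C = UNIV"
    and lim: "\<And>f. f \<in> C \<Longrightarrow> ((\<lambda>t. T t f) \<longlongrightarrow> f) (at_right 0)"
  shows "continuous_on {0..} (\<lambda>t. T t f)"
proof -
  obtain K1 where K1: "K1 > 0" "\<And>t f. 0 \<le> t \<Longrightarrow> t \<le> 1 \<Longrightarrow> norm (T t f) \<le> K1 * norm f"
    using bounded[of 1] by auto
  have small: "\<exists>d>0. \<forall>h. 0 \<le> h \<and> h < d \<longrightarrow> norm (T h f - f) < e" if "e > 0" for e
  proof -
    have "f \<in> closure C" by (simp add: dense)
    moreover have "e / (2 * (K1 + 1)) > 0" using \<open>e > 0\<close> K1(1) by simp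
    ultimately obtain g where g: "g \<in> C" "dist g f < e / (2 * (K1 + 1))"
      unfolding closure_approachable by blast
    obtain d where d: "d > 0" "\<And>h. 0 < h \<Longrightarrow> h < d \<Longrightarrow> dist (T h g) g < e / 2"
      using tendstoD[OF lim[OF g(1)], of "e / 2"] \<open>e > 0\<close> by (auto simp: eventually_at dist_real_def)
    have "norm (T h f - f) < e" if h: "0 \<le> h" "h < min d 1" for h
    proof -
      have "T h f - f = T h (f - g) + (T h g - g) + (g - f)"
        using linear_diff[OF bounded_linear.linear[OF lin[OF h(1)]]] by simp
      also have "norm \<dots> \<le> norm (T h (f - g)) + norm (T h g - g) + norm (g - f)"
        by (intro norm_triangle_le add_mono) auto
      also have "norm (T h (f - g)) \<le> K1 * norm (g - f)"
        using K1(2)[of h "f - g"] h by (simp add: norm_minus_commute)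
      also have "norm (T h g - g) < e / 2"
        using d(2)[of h] h zero \<open>e > 0\<close> by (cases "h = 0") (auto simp: dist_norm)
      finally have "norm (T h f - f) < K1 * norm (g - f) + e / 2 + norm (g - f)" by simp
      also have "\<dots> = (K1 + 1) * norm (g - f) + e / 2" by (simp add: algebra_simps)
      also have "(K1 + 1) * norm (g - f) \<le> (K1 + 1) * (e / (2 * (K1 + 1)))"
        using g(2) K1(1) by (intro mult_left_mono) (auto simp: dist_norm)
      also have "\<dots> = e / 2" using K1(1) by (simp add: field_simps)
      finally show ?thesis by simp
    qed
    then show ?thesis using d(1) by (intro exI[of _ "min d 1"]) auto
  qed
  show ?thesis
    unfolding continuous_on_iff
  proof (intro ballI allI impI)
    fix t e :: real assume t: "t \<in> {0..}" and e: "e > 0"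
    obtain K where K: "K > 0" "\<And>s f. 0 \<le> s \<Longrightarrow> s \<le> t \<Longrightarrow> norm (T s f) \<le> K * norm f"
      using bounded[of t] by auto
    obtain d where d: "d > 0" "\<And>h. 0 \<le> h \<Longrightarrow> h < d \<Longrightarrow> norm (T h f - f) < e / K"
      using small[of "e / K"] e K(1) by auto
    show "\<exists>d>0. \<forall>s\<in>{0..}. dist s t < d \<longrightarrow> dist (T s f) (T t f) < e"
    proof (intro exI[of _ d] conjI ballI impI d(1))
      fix s assume s: "s \<in> {0..}" "dist s t < d"
      have "norm (T s f - T t f) \<le> K * norm (T \<bar>s - t\<bar> f - f)"
        using semigroup_increment[OF lin law, of s t f] s t K(2)[of t "T (s - t) f - f"] K(2)[of s "T (t - s) f - f"]
        by (auto simp: abs_if)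
      also have "\<dots> < K * (e / K)"
        using d(2)[of "\<bar>s - t\<bar>"] s(2) K(1) by (intro mult_strict_left_mono) (auto simp: dist_real_def)
      finally show "dist (T s f) (T t f) < e"
        using K(1) by (simp add: dist_norm)
    qed
  qed
qed

text \<open>The Riemann sums lie in the subspace.\<close>

lemma integral_in_closed_subspace:
  fixes c :: "real \<Rightarrow> 'a::banach"
  assumes M: "subspace M" "closed M" and c: "\<And>r. r \<in> {a..b} \<Longrightarrow> c r \<in> M"
    and int: "(c has_integral I) {a..b}"
  shows "I \<in> M"
proof -
  have "I \<in> closure M"
    unfolding closure_approachable
  proof (intro allI impI)
    fix e :: real assume "e > 0"
    then obtain \<gamma> where \<gamma>: "gauge \<gamma>" "\<And>D. D tagged_division_of cbox a b \<Longrightarrow> \<gamma> fine D \<Longrightarrow> norm ((\<Sum>(x, k)\<in>D. measure lborel k *\<^sub>R c x) - I) < e"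
      using int[unfolded box_real[symmetric] has_integral] by metis
    obtain D where D: "D tagged_division_of cbox a b" "\<gamma> fine D"
      using fine_division_exists[OF \<gamma>(1)] by blast
    have "measure lborel k *\<^sub>R c x \<in> M" if "(x, k) \<in> D" for x k
    proof -
      have "x \<in> cbox a b" using tagged_division_ofD(2,3)[OF D(1) that] by blast
      then show ?thesis using c M(1) by (intro subspace_scale) auto
    qed
    then have "(\<Sum>(x, k)\<in>D. measure lborel k *\<^sub>R c x) \<in> M"
      by (intro subspace_sum[OF M(1)]) auto
    then show "\<exists>y\<in>M. dist y I < e"
      using \<gamma>(2)[OF D] by (auto simp: dist_norm)
  qed
  with M(2) show ?thesis by simp
qed

lemma has_integral_pair:
  fixes f :: "real \<Rightarrow> 'a::real_normed_vector" and g :: "real \<Rightarrow> 'b::real_normed_vector"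
  assumes "(f has_integral x) S" "(g has_integral y) S"
  shows "((\<lambda>r. (f r, g r)) has_integral (x, y)) S"
proof -
  have "bounded_linear (\<lambda>x. (x, 0 :: 'b))" "bounded_linear (\<lambda>y. (0 :: 'a, y))"
    by (intro bounded_linear_Pair bounded_linear_ident bounded_linear_zero)+
  from has_integral_add[OF has_integral_linear[OF assms(1) this(1)] has_integral_linear[OF assms(2) this(2)]]
  show ?thesis by (simp add: o_def)
qed

lemma generator_tendsto:
  assumes "f \<in> generator_domain T"
  shows "((\<lambda>t. (T t f - f) /\<^sub>R t) \<longlongrightarrow> generator T f) (at_right 0)"
proof -
  obtain g where g: "((\<lambda>t. (T t f - f) /\<^sub>R t) \<longlongrightarrow> g) (at_right 0)"
    using assms by (auto simp: generator_domain_def)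
  then have "generator T f = g"
    unfolding generator_def by (intro tendsto_Lim) auto
  with g show ?thesis by simp
qed

lemma generatorI:
  assumes "((\<lambda>t. (T t f - f) /\<^sub>R t) \<longlongrightarrow> g) (at_right 0)"
  shows "f \<in> generator_domain T" "generator T f = g"
  using assms unfolding generator_domain_def generator_def by (auto intro!: tendsto_Lim)

text \<open>The closure of the graph of the generator restricted to \<open>C\<close> contains the pairs of
  \<open>\<integral>\<^sub>0\<^sup>s T(r) f dr\<close> and \<open>T(s) f - f\<close>: for \<open>f \<in> C\<close> because this closed subspace contains the curve
  \<open>(T(r) f, T(r) A f)\<close>, and for all \<open>f\<close> by density.  If \<open>f\<close> lies in the domain of the generator,
  division by \<open>s\<close> and letting \<open>s\<close> tend to zero gives \<open>(f, A f)\<close>.\<close>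

lemma invariant_dense_subspace_is_core:
  fixes T :: "real \<Rightarrow> 'a::banach \<Rightarrow> 'a"
  assumes lin: "\<And>t. 0 \<le> t \<Longrightarrow> bounded_linear (T t)"
    and zero: "T 0 = id"
    and law: "\<And>s t. 0 \<le> s \<Longrightarrow> 0 \<le> t \<Longrightarrow> T (s + t) = T s \<circ> T t"
    and bounded: "\<And>b. \<exists>K>0. \<forall>t\<in>{0..b}. \<forall>f. norm (T t f) \<le> K * norm f"
    and cont: "\<And>f. continuous_on {0..} (\<lambda>t. T t f)"
    and C: "subspace C" "closure C = UNIV" "C \<subseteq> generator_domain T"
    and invariant: "\<And>t f. 0 \<le> t \<Longrightarrow> f \<in> C \<Longrightarrow> T t f \<in> C"
    and f: "f \<in> generator_domain T" and "\<epsilon> > 0"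
  shows "\<exists>g\<in>C. norm (f - g) + norm (generator T f - generator T g) < \<epsilon>"
proof -
  let ?A = "generator T"
  obtain K where K: "K > 0" "\<And>t f. 0 \<le> t \<Longrightarrow> t \<le> 1 \<Longrightarrow> norm (T t f) \<le> K * norm f"
    using bounded[of 1] by auto
  have A: "((\<lambda>t. (T t g - g) /\<^sub>R t) \<longlongrightarrow> ?A g) (at_right 0)" if "g \<in> C" for g
    using that C(3) by (intro generator_tendsto) auto
  have TA: "?A (T s g) = T s (?A g)" if "g \<in> C" "0 \<le> s" for g s
  proof -
    have "((\<lambda>t. T s ((T t g - g) /\<^sub>R t)) \<longlongrightarrow> T s (?A g)) (at_right 0)"
      by (rule bounded_linear.tendsto[OF lin[OF that(2)] A[OF that(1)]])
    moreover have "\<forall>\<^sub>F t in at_right 0. T s ((T t g - g) /\<^sub>R t) = (T t (T s g) - T s g) /\<^sub>R t"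
      unfolding eventually_at
    proof (intro exI[of _ 1] conjI ballI impI)
      fix t :: real assume "t \<in> {0<..}"
      then have "T s (T t g) = T t (T s g)"
        using law[of s t] law[of t s] that(2) by (metis add.commute comp_apply greaterThan_iff less_imp_le)
      then show "T s ((T t g - g) /\<^sub>R t) = (T t (T s g) - T s g) /\<^sub>R t"
        using bounded_linear.linear[OF lin[OF that(2)]] by (simp add: linear_diff linear_cmul)
    qed simp
    ultimately show ?thesis
      by (intro generatorI(2)) (rule Lim_transform_eventually)
  qed
  have A_add: "?A (g + h) = ?A g + ?A h" if "g \<in> C" "h \<in> C" for g h
  proof (rule generatorI(2))
    have "((\<lambda>t. (T t g - g) /\<^sub>R t + (T t h - h) /\<^sub>R t) \<longlongrightarrow> ?A g + ?A h) (at_right 0)"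
      by (intro tendsto_add A that)
    then show "((\<lambda>t. (T t (g + h) - (g + h)) /\<^sub>R t) \<longlongrightarrow> ?A g + ?A h) (at_right 0)"
    proof (rule Lim_transform_eventually)
      show "\<forall>\<^sub>F t in at_right 0. (T t g - g) /\<^sub>R t + (T t h - h) /\<^sub>R t = (T t (g + h) - (g + h)) /\<^sub>R t"
        unfolding eventually_at
        by (intro exI[of _ 1]) (auto simp: linear_add[OF bounded_linear.linear[OF lin]] algebra_simps)
    qed
  qed
  have A_scale: "?A (c *\<^sub>R g) = c *\<^sub>R ?A g" if "g \<in> C" for g c
  proof (rule generatorI(2))
    have "((\<lambda>t. c *\<^sub>R ((T t g - g) /\<^sub>R t)) \<longlongrightarrow> c *\<^sub>R ?A g) (at_right 0)"
      by (intro tendsto_scaleR tendsto_const A that)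
    then show "((\<lambda>t. (T t (c *\<^sub>R g) - c *\<^sub>R g) /\<^sub>R t) \<longlongrightarrow> c *\<^sub>R ?A g) (at_right 0)"
    proof (rule Lim_transform_eventually)
      show "\<forall>\<^sub>F t in at_right 0. c *\<^sub>R ((T t g - g) /\<^sub>R t) = (T t (c *\<^sub>R g) - c *\<^sub>R g) /\<^sub>R t"
        unfolding eventually_at
        by (intro exI[of _ 1]) (auto simp: linear_cmul[OF bounded_linear.linear[OF lin]] algebra_simps)
    qed
  qed
  define M where "M = closure ((\<lambda>g. (g, ?A g)) ` C)"
  have M: "subspace M"
    unfolding M_def
  proof (rule subspace_closure_normed)
    have "?A 0 = 0" using A_scale[of 0 0] subspace_0[OF C(1)] by simp
    then show "subspace ((\<lambda>g. (g, ?A g)) ` C)"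
      unfolding subspace_def zero_prod_def
      using A_add A_scale subspace_0[OF C(1)] subspace_add[OF C(1)] subspace_scale[OF C(1)]
      by (auto simp: image_iff)
  qed
  have clM: "closed M" by (simp add: M_def)
  have inM: "(g, ?A g) \<in> M" if "g \<in> C" for g
    unfolding M_def using that by (intro subsetD[OF closure_subset] imageI)
  have cont': "continuous_on {0..s} (\<lambda>r. T r g)" for s g
    by (rule continuous_on_subset[OF cont]) auto
  have deriv: "((\<lambda>r. T r g) has_vector_derivative T t (?A g)) (at t within {0..1})" if g: "g \<in> C" and t: "t \<in> {0..1}" for g t
    unfolding has_vector_derivative_def has_derivative_within_alt2
  proof (intro conjI bounded_linear_scaleR_left allI impI)
    fix e :: real assume e: "e > 0"
    obtain d1 where d1: "d1 > 0" "\<And>h. 0 < h \<Longrightarrow> h < d1 \<Longrightarrow> dist ((T h g - g) /\<^sub>R h) (?A g) < e / (2 * K)"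
      using tendstoD[OF A[OF g], of "e / (2 * K)"] e K(1) by (auto simp: eventually_at dist_real_def)
    obtain d2 where d2: "d2 > 0" "\<And>r. r \<in> {0..} \<Longrightarrow> dist r t < d2 \<Longrightarrow> dist (T r (?A g)) (T t (?A g)) < e / 2"
      using cont[of "?A g", unfolded continuous_on_iff, rule_format, of t "e / 2"] t e by auto
    have est: "norm (T r g - T t g - (r - t) *\<^sub>R T t (?A g)) \<le> e * norm (r - t)"
      if r: "r \<in> {0..1}" "r \<noteq> t" "dist r t < min d1 d2" for r
    proof -
      define m h where "m = min r t" and "h = \<bar>r - t\<bar>"
      have "\<bar>r - t\<bar> < d1" "\<bar>r - t\<bar> < d2"
        using r(3) by (simp_all add: dist_real_def)
      then have mh: "0 \<le> m" "m \<le> 1" "0 < h" "h < d1" "dist m t < d2"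
        using r(1,2) t d2(1) by (auto simp: m_def h_def dist_real_def min_def)
      note linm = bounded_linear.linear[OF lin[OF mh(1)]]
      have sgn: "(r - t) / h = (if t \<le> r then 1 else -1)"
        using r(2) by (auto simp: h_def abs_if divide_eq_eq)
      have "T r g - T t g = ((r - t) / h) *\<^sub>R T m (T h g - g)"
        unfolding sgn using semigroup_increment[OF lin law, of r t g] r t by (auto simp: m_def h_def min_def abs_if)
      also have "T m (T h g - g) = h *\<^sub>R T m ((T h g - g) /\<^sub>R h)"
        using mh(3) by (simp add: linear_cmul[OF linm])
      finally have E: "T r g - T t g = (r - t) *\<^sub>R T m ((T h g - g) /\<^sub>R h)"
        using mh(3) by (simp only: scaleR_scaleR) simp
      have "T r g - T t g - (r - t) *\<^sub>R T t (?A g) = (r - t) *\<^sub>R (T m ((T h g - g) /\<^sub>R h - ?A g) + (T m (?A g) - T t (?A g)))"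
        unfolding E linear_diff[OF linm, of "(T h g - g) /\<^sub>R h"] by (simp add: scaleR_right_diff_distrib)
      then have "norm (T r g - T t g - (r - t) *\<^sub>R T t (?A g)) = norm (r - t) * norm (T m ((T h g - g) /\<^sub>R h - ?A g) + (T m (?A g) - T t (?A g)))"
        by simp
      moreover have "norm (T m ((T h g - g) /\<^sub>R h - ?A g) + (T m (?A g) - T t (?A g))) \<le> K * (e / (2 * K)) + e / 2"
      proof (rule norm_triangle_le, rule add_mono)
        have "norm (T m ((T h g - g) /\<^sub>R h - ?A g)) \<le> K * norm ((T h g - g) /\<^sub>R h - ?A g)"
          by (rule K(2)) (use mh in auto)
        also have "\<dots> \<le> K * (e / (2 * K))"
          using d1(2)[OF mh(3,4)] K(1) by (intro mult_left_mono) (auto simp: dist_norm)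
        finally show "norm (T m ((T h g - g) /\<^sub>R h - ?A g)) \<le> K * (e / (2 * K))" .
        show "norm (T m (?A g) - T t (?A g)) \<le> e / 2"
          using d2(2)[of m] mh by (auto simp: dist_norm)
      qed
      moreover have "K * (e / (2 * K)) + e / 2 = e" using K(1) by (simp add: field_simps)
      ultimately show ?thesis
        using mult_left_mono[OF _ norm_ge_zero[of "r - t"]] by (simp only: mult.commute[of e])
    qed
    show "\<forall>\<^sub>F r in at t within {0..1}. norm (T r g - T t g - (r - t) *\<^sub>R T t (?A g)) \<le> e * norm (r - t)"
      unfolding eventually_at using d1(1) d2(1) est by (intro exI[of _ "min d1 d2"]) auto
  qed
  have pair_C: "(integral {0..s} (\<lambda>r. T r g), T s g - g) \<in> M" if g: "g \<in> C" and s: "0 \<le> s" "s \<le> 1" for g s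
  proof (rule integral_in_closed_subspace[OF M clM])
    show "(T r g, T r (?A g)) \<in> M" if "r \<in> {0..s}" for r
      using inM[OF invariant[OF _ g, of r]] TA[OF g, of r] that by simp
    have "((\<lambda>r. T r (?A g)) has_integral (T s g - T 0 g)) {0..s}"
      by (rule fundamental_theorem_of_calculus[OF s(1)])
        (rule has_vector_derivative_within_subset[OF deriv[OF g]], use s in auto)
    then show "((\<lambda>r. (T r g, T r (?A g))) has_integral (integral {0..s} (\<lambda>r. T r g), T s g - g)) {0..s}"
      using integrable_continuous_real[OF cont'[of s g]] by (intro has_integral_pair) (auto simp: zero integrable_integral)
  qed
  have pair: "(integral {0..s} (\<lambda>r. T r g), T s g - g) \<in> M" if s: "0 \<le> s" "s \<le> 1" for g s
  proof -
    have "g \<in> closure C" by (simp add: C(2))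
    then obtain X where X: "\<And>n. X n \<in> C" "X \<longlonglongrightarrow> g"
      unfolding closure_sequential by blast
    have Xg: "(\<lambda>n. norm (X n - g)) \<longlonglongrightarrow> 0"
      using X(2) by (simp add: LIM_zero tendsto_norm_zero)
    have int: "(\<lambda>r. T r h) integrable_on {0..s}" for h
      by (rule integrable_continuous_real[OF cont'])
    have est: "norm (integral {0..s} (\<lambda>r. T r (X n)) - integral {0..s} (\<lambda>r. T r g)) \<le> (K * norm (X n - g)) * (s - 0)" for n
    proof -
      have "norm (integral {0..s} (\<lambda>r. T r (X n) - T r g)) \<le> (K * norm (X n - g)) * (s - 0)"
      proof (rule integral_bound)
        show "continuous_on {0..s} (\<lambda>r. T r (X n) - T r g)"
          by (intro continuous_on_diff cont')
        show "norm (T r (X n) - T r g) \<le> K * norm (X n - g)" if "r \<in> {0..s}" for r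
          using K(2)[of r "X n - g"] s that linear_diff[OF bounded_linear.linear[OF lin[of r]]] by simp
      qed (use s in simp)
      then show ?thesis
        by (simp add: Henstock_Kurzweil_Integration.integral_diff[OF int int])
    qed
    have null: "(\<lambda>n. (K * norm (X n - g)) * (s - 0)) \<longlonglongrightarrow> (K * 0) * (s - 0)"
      by (intro tendsto_mult tendsto_const Xg)
    have "(\<lambda>n. integral {0..s} (\<lambda>r. T r (X n)) - integral {0..s} (\<lambda>r. T r g)) \<longlonglongrightarrow> 0"
    proof (rule Lim_null_comparison)
      show "\<forall>\<^sub>F n in sequentially. norm (integral {0..s} (\<lambda>r. T r (X n)) - integral {0..s} (\<lambda>r. T r g)) \<le> (K * norm (X n - g)) * (s - 0)"
        by (intro always_eventually allI est)
      show "(\<lambda>n. (K * norm (X n - g)) * (s - 0)) \<longlonglongrightarrow> 0"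
        using null by simp
    qed
    then have lim1: "(\<lambda>n. integral {0..s} (\<lambda>r. T r (X n))) \<longlonglongrightarrow> integral {0..s} (\<lambda>r. T r g)"
      by (simp add: LIM_zero_iff)
    have lim2: "(\<lambda>n. T s (X n) - X n) \<longlonglongrightarrow> T s g - g"
      by (intro tendsto_diff bounded_linear.tendsto[OF lin[OF s(1)]] X)
    show ?thesis
      by (rule closed_sequentially[OF clM pair_C[OF X(1) s] tendsto_Pair[OF lim1 lim2]])
  qed
  have "(f, ?A f) \<in> M"
  proof (rule Lim_in_closed_set[OF clM])
    have "((\<lambda>s. integral {0..s} (\<lambda>r. T r f) /\<^sub>R s) \<longlongrightarrow> T 0 f) (at_right 0)"
      by (rule integral_average_tendsto[OF cont'])
    then have "((\<lambda>s. integral {0..s} (\<lambda>r. T r f) /\<^sub>R s) \<longlongrightarrow> f) (at_right 0)"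
      by (simp add: zero)
    then show "((\<lambda>s. (integral {0..s} (\<lambda>r. T r f) /\<^sub>R s, (T s f - f) /\<^sub>R s)) \<longlongrightarrow> (f, ?A f)) (at_right 0)"
      by (intro tendsto_Pair generator_tendsto f)
    show "\<forall>\<^sub>F s in at_right 0. (integral {0..s} (\<lambda>r. T r f) /\<^sub>R s, (T s f - f) /\<^sub>R s) \<in> M"
      unfolding eventually_at
    proof (intro exI[of _ 1] conjI ballI impI)
      fix s :: real assume "s \<in> {0<..}" "s \<noteq> 0 \<and> dist s 0 < 1"
      then have "(integral {0..s} (\<lambda>r. T r f), T s f - f) \<in> M"
        by (intro pair) (auto simp: dist_real_def)
      from subspace_scale[OF M this, of "inverse s"]
      show "(integral {0..s} (\<lambda>r. T r f) /\<^sub>R s, (T s f - f) /\<^sub>R s) \<in> M"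
        by simp
    qed simp
  qed simp
  then have "\<exists>y\<in>(\<lambda>g. (g, ?A g)) ` C. dist y (f, ?A f) < \<epsilon> / 2"
    unfolding M_def closure_approachable using half_gt_zero[OF \<open>\<epsilon> > 0\<close>] by blast
  then obtain g where g: "g \<in> C" "dist (g, ?A g) (f, ?A f) < \<epsilon> / 2"
    by blast
  have "norm (f - g) \<le> dist (g, ?A g) (f, ?A f)" "norm (?A f - ?A g) \<le> dist (g, ?A g) (f, ?A f)"
    using dist_fst_le[of "(g, ?A g)" "(f, ?A f)"] dist_snd_le[of "(g, ?A g)" "(f, ?A f)"]
    by (simp_all add: dist_norm norm_minus_commute)
  then show ?thesis
    using g by (intro bexI[of _ g]) auto
qed

section \<open>The Schroedinger operators on Schwartz functions\<close>

definition oscillation :: "real^'n^'n \<Rightarrow> real^'n \<Rightarrow> complex"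
  where "oscillation P \<xi> = exp (- \<i> * of_real ((P *v \<xi>) \<bullet> \<xi>))"

lemma norm_oscillation [simp]: "norm (oscillation P \<xi>) = 1"
  by (simp add: oscillation_def)

lemma oscillation_mult_schwartz: "\<phi> \<in> schwartz \<Longrightarrow> (\<lambda>\<xi>. oscillation P \<xi> * \<phi> \<xi>) \<in> schwartz"
  using schwartz_quadratic_exp_mult[of \<phi> \<i> P 0] by (simp add: oscillation_def)

text \<open>The principal square root of \<open>\<i>\<close> is the source of the phase \<open>e\<^bsup>-i\<pi>m/4\<^esup>\<close>.\<close>

lemma kernel_constant:
  "complex_of_real (1 / (2 * pi) ^ m) * (of_real (sqrt pi) / csqrt \<i>) ^ m =
    of_real ((4 * pi) powr (- real m / 2)) * exp (- (\<i> * of_real pi * of_nat m / 4))"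
proof -
  have "csqrt \<i> = exp (\<i> * of_real (pi / 4))"
  proof (rule csqrt_unique)
    have "exp (\<i> * of_real (pi / 4)) ^ 2 = exp (\<i> * of_real (pi / 2))"
      by (simp add: power2_eq_square exp_add[symmetric] field_simps)
    also have "\<dots> = \<i>" by (simp add: complex_eq_iff Re_exp Im_exp)
    finally show "exp (\<i> * of_real (pi / 4)) ^ 2 = \<i>" .
    show "0 < Re (exp (\<i> * of_real (pi / 4))) \<or> Re (exp (\<i> * of_real (pi / 4))) = 0 \<and> 0 \<le> Im (exp (\<i> * of_real (pi / 4)))"
      by (simp add: Re_exp cos_45)
  qed
  then have "(1 / csqrt \<i>) ^ m = exp (- (\<i> * of_real (pi / 4))) ^ m"
    by (simp add: exp_minus inverse_eq_divide)
  also have "\<dots> = exp (of_nat m * - (\<i> * of_real (pi / 4)))"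
    by (rule exp_of_nat_mult[symmetric])
  also have "of_nat m * - (\<i> * of_real (pi / 4)) = - (\<i> * of_real pi * of_nat m / 4)"
    by simp
  finally have 1: "(1 / csqrt \<i>) ^ m = exp (- (\<i> * of_real pi * of_nat m / 4))" .
  have "(4 * pi) powr (- real m / 2) = 1 / ((4 * pi) powr (1 / 2)) ^ m"
    by (simp add: powr_minus_divide powr_powr flip: powr_realpow)
  also have "(4 * pi) powr (1 / 2) = 2 * sqrt pi"
    by (simp add: powr_half_sqrt real_sqrt_mult)
  also have "1 / (2 * sqrt pi) ^ m = 1 / (2 * pi) ^ m * sqrt pi ^ m"
  proof -
    have "2 * pi = 2 * sqrt pi * sqrt pi" by simp
    then have "(2 * pi) ^ m = (2 * sqrt pi) ^ m * sqrt pi ^ m"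
      by (simp only: power_mult_distrib)
    then show ?thesis by simp
  qed
  finally have 2: "(4 * pi) powr (- real m / 2) = 1 / (2 * pi) ^ m * sqrt pi ^ m" .
  have "(of_real (sqrt pi) / csqrt \<i>) ^ m = of_real (sqrt pi ^ m) * (1 / csqrt \<i>) ^ m"
    by (simp only: power_mult_distrib[symmetric] of_real_power times_divide_eq_right mult_1_right)
  then show ?thesis
    unfolding 1 2 by (simp only: of_real_mult mult.assoc)
qed

text \<open>The factorisation \<open>Q(t) = M\<^sup>T M\<close> brings the multiplier into the form to which \<open>oscillating_inversion\<close>
  applies.  At \<open>t = 0\<close> the multiplier is \<open>1\<close> and the formula is Fourier inversion.\<close>

lemma schroedinger_op_fourier:
  fixes Q B :: "real^'n^'n"
  assumes P: "\<forall>t>0. pos_definite (Qt Q B t)" and t: "0 \<le> t" and S: "\<phi> \<in> schwartz"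
  shows "schroedinger_op Q B t \<phi> x = fourier (\<lambda>\<xi>. oscillation (Qt Q B t) \<xi> * fourier \<phi> \<xi>) (- (matrix_exp (t *\<^sub>R B) *v x))"
proof (cases "t = 0")
  case True
  then show ?thesis
    by (simp add: schroedinger_op_def oscillation_def fourier_inversion[OF S])
next
  case False
  define z where "z = matrix_exp (t *\<^sub>R B) *v x"
  let ?c = "complex_of_real ((2 * pi) powr (- real CARD('n) / 2))"
  have "pos_definite (Qt Q B t)" using P t False by simp
  then obtain M M' where M: "M' ** M = mat 1" "Qt Q B t = transpose M ** M" "matrix_inv (Qt Q B t) = M' ** transpose M'"
    and det: "\<bar>det M\<bar> = sqrt (det (Qt Q B t))"
    by (rule pos_definite_factorization)
  have q: "(Qt Q B t *v \<xi>) \<bullet> \<xi> = (M *v \<xi>) \<bullet> (M *v \<xi>)" for \<xi>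
    unfolding M(2) matrix_vector_mul_assoc[symmetric] inner_transpose[of "M *v \<xi>" M \<xi>]
    by (rule refl)
  have k: "(matrix_inv (Qt Q B t) *v w) \<bullet> w = (transpose M' *v w) \<bullet> (transpose M' *v w)" for w
    unfolding M(3) matrix_vector_mul_assoc[symmetric] inner_commute[of "M' *v _" w] inner_transpose[of w M'] ..
  have "fourier (\<lambda>\<xi>. oscillation (Qt Q B t) \<xi> * fourier \<phi> \<xi>) (- z) =
      (?c * ?c) * (LINT \<xi>|lborel. exp (- \<i> * of_real ((M *v \<xi>) \<bullet> (M *v \<xi>))) * (exp (- \<i> * of_real (z \<bullet> \<xi>)) *
      (LINT y|lborel. exp (\<i> * of_real (\<xi> \<bullet> y)) * \<phi> y)))"
    (is "_ = (?c * ?c) * ?J")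
  proof -
    have "exp (\<i> * of_real (- z \<bullet> \<xi>)) * (oscillation (Qt Q B t) \<xi> * fourier \<phi> \<xi>) =
      ?c * (exp (- \<i> * of_real ((M *v \<xi>) \<bullet> (M *v \<xi>))) * (exp (- \<i> * of_real (z \<bullet> \<xi>)) *
      (LINT y|lborel. exp (\<i> * of_real (\<xi> \<bullet> y)) * \<phi> y)))" for \<xi>
      unfolding oscillation_def q fourier_def[of \<phi>] by (simp add: mult_ac)
    then show ?thesis
      unfolding fourier_def[of "\<lambda>\<xi>. oscillation (Qt Q B t) \<xi> * fourier \<phi> \<xi>"]
      by (simp only: integral_mult_right_zero mult.assoc)
  qed
  also have "?c * ?c = of_real (1 / (2 * pi) ^ CARD('n))"
    unfolding fourier_const_power2[symmetric] by (simp only: power2_eq_square of_real_mult)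
  also have "?J = (of_real (sqrt pi) / csqrt \<i>) ^ CARD('n) / of_real \<bar>det M\<bar> *
      (LINT y|lborel. exp (\<i> * of_real ((matrix_inv (Qt Q B t) *v (y - z)) \<bullet> (y - z)) / 4) * \<phi> y)"
    unfolding k by (rule oscillating_inversion[OF M(1) S])
  also have "complex_of_real (1 / (2 * pi) ^ CARD('n)) * ((of_real (sqrt pi) / csqrt \<i>) ^ CARD('n) / of_real \<bar>det M\<bar> *
      (LINT y|lborel. exp (\<i> * of_real ((matrix_inv (Qt Q B t) *v (y - z)) \<bullet> (y - z)) / 4) * \<phi> y)) =
    (complex_of_real (1 / (2 * pi) ^ CARD('n)) * (of_real (sqrt pi) / csqrt \<i>) ^ CARD('n)) / of_real \<bar>det M\<bar> *
      (LINT y|lborel. exp (\<i> * of_real ((matrix_inv (Qt Q B t) *v (y - z)) \<bullet> (y - z)) / 4) * \<phi> y)"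
    by (simp only: mult.assoc times_divide_eq_right times_divide_eq_left)
  also have "\<dots> = schroedinger_op Q B t \<phi> x"
    unfolding kernel_constant det using False by (simp add: schroedinger_op_def z_def)
  finally show ?thesis by (simp add: z_def)
qed

lemma invertible_neg: "invertible A \<Longrightarrow> invertible (- A)" for A :: "real^'n^'n"
proof -
  assume "invertible A"
  then obtain A' where "A ** A' = mat 1" "A' ** A = mat 1"
    by (auto simp: invertible_def)
  then have "(- A) ** (- A') = mat 1" "(- A') ** (- A) = mat 1"
    by (simp_all add: matrix_mult_minus_left bounded_bilinear.minus_right[OF bounded_bilinear_matrix_mult])
  then show ?thesis unfolding invertible_def by blast
qed

lemma det_neg_matrix_exp: "det (- matrix_exp (t *\<^sub>R B)) \<noteq> 0" for B :: "real^'n^'n"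
  using invertible_neg[OF invertible_matrix_exp] by (simp add: invertible_det_nz)

lemma minus_matrix_vector_mult: "- (A *v x) = (- A) *v x" for A :: "real^'n^'n"
  by (simp add: matrix_vector_mult_def vec_eq_iff sum_negf)

lemma norm_L2_compose_linear:
  fixes A :: "real^'n^'n"
  assumes "det A \<noteq> 0" "\<phi> \<in> schwartz"
  shows "norm (L2_of (\<lambda>x. \<phi> (A *v x))) = norm (L2_of \<phi>) / sqrt \<bar>det A\<bar>"
proof -
  have "(LINT x|lborel. (norm (\<phi> (A *v x)))\<^sup>2) = (LINT x|lborel. (norm (\<phi> x))\<^sup>2) /\<^sub>R \<bar>det A\<bar>"
    using assms by (intro lborel_integral_linear[of A "\<lambda>x. (norm (\<phi> x))\<^sup>2"]) auto
  moreover have "(\<lambda>x. \<phi> (A *v x)) \<in> schwartz"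
    using assms by (intro schwartz_compose_linear) (auto simp: invertible_det_nz)
  ultimately show ?thesis
    using assms by (simp add: norm_L2_of square_integrable_schwartz divide_inverse real_sqrt_mult real_sqrt_inverse mult.commute)
qed

lemma fourier_compose_linear:
  fixes A A' :: "real^'n^'n"
  assumes A: "A' ** A = mat 1" and S: "\<phi> \<in> schwartz"
  shows "fourier (\<lambda>x. \<phi> (A *v x)) \<xi> = fourier \<phi> (transpose A' *v \<xi>) / of_real \<bar>det A\<bar>"
proof -
  note [measurable] = schwartz_measurable[OF S]
  have "det A' * det A = 1"
    using arg_cong[OF A, of det] by (simp add: det_mul)
  then have det: "det A \<noteq> 0" by auto
  have "\<xi> \<bullet> x = (transpose A' *v \<xi>) \<bullet> (A *v x)" for x
    using A inner_transpose[of \<xi> A' "A *v x"] by (simp add: matrix_vector_mul_assoc)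
  then have "(LINT x|lborel. exp (\<i> * of_real (\<xi> \<bullet> x)) * \<phi> (A *v x)) =
      (LINT x|lborel. exp (\<i> * of_real ((transpose A' *v \<xi>) \<bullet> (A *v x))) * \<phi> (A *v x))"
    by (simp only:)
  also have "\<dots> = (LINT x|lborel. exp (\<i> * of_real ((transpose A' *v \<xi>) \<bullet> x)) * \<phi> x) /\<^sub>R \<bar>det A\<bar>"
    by (rule lborel_integral_linear[OF det]) measurable
  finally show ?thesis
    unfolding fourier_def scaleR_conv_of_real[where 'a=complex] of_real_inverse
    by (simp only: divide_inverse mult.assoc mult.commute[of "inverse _"])
qed

section \<open>The generator on the Fourier side\<close>

definition drift :: "real^'n^'n \<Rightarrow> (real^'n \<Rightarrow> complex) \<Rightarrow> real^'n \<Rightarrow> complex"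
  where "drift B \<phi> x = (\<Sum>j\<in>UNIV. of_real ((B *v x) $ j) * partial_deriv j \<phi> x)"

definition second_order :: "real^'n^'n \<Rightarrow> (real^'n \<Rightarrow> complex) \<Rightarrow> real^'n \<Rightarrow> complex"
  where "second_order Q \<phi> x = \<i> * (\<Sum>i\<in>UNIV. \<Sum>j\<in>UNIV. of_real (Q $ i $ j) * partial_deriv j (partial_deriv i \<phi>) x)"

lemma schroedinger_diff_op_eq: "schroedinger_diff_op Q B \<phi> = (\<lambda>x. second_order Q \<phi> x + drift B \<phi> x)"
  by (simp add: fun_eq_iff schroedinger_diff_op_def second_order_def drift_def trace_def matrix_matrix_mult_def
      map_matrix_def hessian_def gradient_def)

lemma second_order_schwartz: "\<phi> \<in> schwartz \<Longrightarrow> second_order Q \<phi> \<in> schwartz"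
  unfolding second_order_def[abs_def] by (intro schwartz_cmult schwartz_sum schwartz_partial_deriv)

lemma fourier_second_order:
  assumes "\<phi> \<in> schwartz"
  shows "fourier (second_order Q \<phi>) \<xi> = - \<i> * of_real ((Q *v \<xi>) \<bullet> \<xi>) * fourier \<phi> \<xi>"
proof -
  note S2 = schwartz_cmult[OF schwartz_partial_deriv[OF schwartz_partial_deriv[OF assms]]]
  have "fourier (second_order Q \<phi>) \<xi> = \<i> * (\<Sum>i\<in>UNIV. \<Sum>j\<in>UNIV. of_real (Q $ i $ j) * fourier (partial_deriv j (partial_deriv i \<phi>)) \<xi>)"
    unfolding second_order_def[abs_def] fourier_cmult
    by (subst fourier_sum, intro schwartz_sum S2, subst fourier_sum, rule S2, simp only: fourier_cmult)
  also have "\<dots> = \<i> * (\<Sum>i\<in>UNIV. \<Sum>j\<in>UNIV. - (of_real (Q $ i $ j * \<xi> $ j * \<xi> $ i) * fourier \<phi> \<xi>))"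
    unfolding fourier_partial_deriv[OF schwartz_partial_deriv[OF assms]] fourier_partial_deriv[OF assms]
    by (simp add: mult_ac)
  also have "\<dots> = - \<i> * of_real ((Q *v \<xi>) \<bullet> \<xi>) * fourier \<phi> \<xi>"
    by (simp add: matrix_vector_mult_def inner_vec_def sum_negf sum_distrib_left sum_distrib_right mult_ac)
  finally show ?thesis .
qed

text \<open>The Fourier transform of the difference quotient of the multiplier, minus that of its limit; the flow
  is treated separately.\<close>

definition quotient_defect :: "real^'n^'n \<Rightarrow> real^'n^'n \<Rightarrow> (real^'n \<Rightarrow> complex) \<Rightarrow> real \<Rightarrow> real^'n \<Rightarrow> complex"
  where "quotient_defect Q B \<phi> t \<xi> = ((oscillation (Qt Q B t) \<xi> - 1) / of_real t + \<i> * of_real ((Q *v \<xi>) \<bullet> \<xi>)) * fourier \<phi> \<xi>"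

lemma quotient_defect_eq:
  assumes "\<phi> \<in> schwartz"
  shows "quotient_defect Q B \<phi> t = (\<lambda>\<xi>. (1 / of_real t) * (oscillation (Qt Q B t) \<xi> * fourier \<phi> \<xi> - fourier \<phi> \<xi>) - fourier (second_order Q \<phi>) \<xi>)"
  by (simp add: fun_eq_iff quotient_defect_def fourier_second_order[OF assms] algebra_simps diff_divide_distrib)

lemma quotient_defect_schwartz:
  assumes "\<phi> \<in> schwartz" shows "quotient_defect Q B \<phi> t \<in> schwartz"
  unfolding quotient_defect_eq[OF assms]
  by (intro schwartz_diff schwartz_cmult oscillation_mult_schwartz fourier_schwartz second_order_schwartz assms)

text \<open>Put \<open>r n \<xi> = \<langle>Q(X n)\<xi>, \<xi>\<rangle> / X n\<close>, which tends to \<open>\<langle>Q\<xi>, \<xi>\<rangle>\<close>.  The bound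
  \<open>\<bar>exp (- i \<theta>) - 1\<bar> \<le> \<bar>\<theta>\<bar>\<close> at \<open>\<theta> = X n \<cdot> r n \<xi>\<close> yields a majorant of the form \<open>C \<bar>\<xi>\<bar>\<^sup>2 \<bar>\<F>\<phi>(\<xi>)\<bar>\<close>, and
  \<open>\<bar>exp (- i \<theta>) - 1 + i \<theta>\<bar> \<le> \<theta>\<^sup>2\<close> yields pointwise convergence.\<close>

lemma L2_quotient_defect_tendsto:
  fixes Q B :: "real^'n^'n" and \<phi> :: "real^'n \<Rightarrow> complex"
  assumes S: "\<phi> \<in> schwartz" and X: "\<And>n. X n \<in> {0<..<1}" "X \<longlonglongrightarrow> 0"
  shows "(\<lambda>n. L2_of (quotient_defect Q B \<phi> (X n))) \<longlonglongrightarrow> 0"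
proof -
  note F = fourier_schwartz[OF S]
  have pos: "X n > 0" for n using X(1)[of n] by auto
  obtain K where K: "\<And>(A :: real^'n^'n) x. norm (A *v x) \<le> norm A * norm x * K" "K > 0"
    using bounded_bilinear.pos_bounded[OF bounded_bilinear_matrix_vector_mult] by blast
  have form: "\<bar>(A *v \<xi>) \<bullet> \<xi>\<bar> \<le> norm A * K * (\<xi> \<bullet> \<xi>)" for A :: "real^'n^'n" and \<xi>
  proof -
    have "\<bar>(A *v \<xi>) \<bullet> \<xi>\<bar> \<le> norm (A *v \<xi>) * norm \<xi>"
      by (rule Cauchy_Schwarz_ineq2)
    also have "\<dots> \<le> (norm A * norm \<xi> * K) * norm \<xi>"
      by (intro mult_right_mono K) auto
    also have "\<dots> = norm A * K * (norm \<xi> * norm \<xi>)" by simp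
    finally show ?thesis by (simp add: power2_eq_square[symmetric] power2_norm_eq_inner)
  qed
  define R where "R n = Qt Q B (X n) /\<^sub>R X n" for n
  define r where "r n \<xi> = (R n *v \<xi>) \<bullet> \<xi>" for n \<xi>
  have "X n \<noteq> 0" for n using pos[of n] by simp
  then have "filterlim X (at_right 0) sequentially"
    using X(2) pos by (simp add: filterlim_at)
  then have R: "R \<longlonglongrightarrow> Q"
    unfolding R_def[abs_def] by (rule filterlim_compose[OF Qt_quotient])
  have q: "(Qt Q B (X n) *v \<xi>) \<bullet> \<xi> = X n * r n \<xi>" for n \<xi>
    using pos[of n] by (simp add: r_def R_def scaleR_matrix_vector_assoc[symmetric])
  obtain b where b: "\<And>n. norm (R n) \<le> b"
    using convergent_imp_Bseq[OF convergentI[OF R]] unfolding Bseq_def by blast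
  define C where "C = (b + norm Q) * K"
  have "(\<lambda>n. L2_of (quotient_defect Q B \<phi> (X n))) \<longlonglongrightarrow> L2_of (\<lambda>\<xi>. 0)"
  proof (rule L2_dominated_convergence(3)[where w="\<lambda>\<xi>. C * norm (of_real (\<xi> \<bullet> \<xi>) * fourier \<phi> \<xi>)"])
    show "quotient_defect Q B \<phi> (X n) \<in> borel_measurable borel" for n
      by (intro schwartz_measurable quotient_defect_schwartz S)
    have "(\<lambda>\<xi>. of_real (\<xi> \<bullet> \<xi>) * fourier \<phi> \<xi>) = (\<lambda>\<xi>. \<Sum>i\<in>UNIV. of_real (\<xi> $ i) * (of_real (\<xi> $ i) * fourier \<phi> \<xi>))"
      by (simp add: fun_eq_iff inner_vec_def sum_distrib_right mult.assoc)
    then have "(\<lambda>\<xi>. of_real (\<xi> \<bullet> \<xi>) * fourier \<phi> \<xi>) \<in> schwartz"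
      using F by (simp only:) (intro schwartz_sum schwartz_coord_mult)
    then have "integrable lborel (\<lambda>\<xi>. (norm (of_real (\<xi> \<bullet> \<xi>) * fourier \<phi> \<xi>))\<^sup>2)"
      using square_integrable_schwartz unfolding square_integrable_def by blast
    then show "integrable lborel (\<lambda>\<xi>. (C * norm (of_real (\<xi> \<bullet> \<xi>) * fourier \<phi> \<xi>))\<^sup>2)"
      unfolding power_mult_distrib[of C] by (rule integrable_mult_right)
    show "AE \<xi> in lborel. norm (quotient_defect Q B \<phi> (X n) \<xi>) \<le> C * norm (of_real (\<xi> \<bullet> \<xi>) * fourier \<phi> \<xi>)" for n
    proof (rule AE_I2)
      fix \<xi>
      have "norm (oscillation (Qt Q B (X n)) \<xi> - 1) \<le> \<bar>X n * r n \<xi>\<bar>"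
        using iexp_approx1[of "- (X n * r n \<xi>)" 0] by (simp add: oscillation_def q)
      then have "norm ((oscillation (Qt Q B (X n)) \<xi> - 1) / of_real (X n)) \<le> \<bar>r n \<xi>\<bar>"
        using pos[of n] by (simp add: norm_divide pos_divide_le_eq abs_mult mult.commute)
      also have "\<bar>r n \<xi>\<bar> \<le> b * K * (\<xi> \<bullet> \<xi>)"
        unfolding r_def by (rule order_trans[OF form]) (intro mult_right_mono b, use K(2) in auto)
      finally have 1: "norm ((oscillation (Qt Q B (X n)) \<xi> - 1) / of_real (X n)) \<le> b * K * (\<xi> \<bullet> \<xi>)" .
      have 2: "norm (\<i> * complex_of_real ((Q *v \<xi>) \<bullet> \<xi>)) \<le> norm Q * K * (\<xi> \<bullet> \<xi>)"
        using form[of Q \<xi>] by (simp add: norm_mult)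
      have "norm (quotient_defect Q B \<phi> (X n) \<xi>) \<le> (b * K * (\<xi> \<bullet> \<xi>) + norm Q * K * (\<xi> \<bullet> \<xi>)) * norm (fourier \<phi> \<xi>)"
        unfolding quotient_defect_def norm_mult[of _ "fourier \<phi> \<xi>"]
        by (intro mult_right_mono norm_triangle_le add_mono 1 2) auto
      also have "\<dots> = C * norm (of_real (\<xi> \<bullet> \<xi>) * fourier \<phi> \<xi>)"
        by (simp add: C_def norm_mult algebra_simps)
      finally show "norm (quotient_defect Q B \<phi> (X n) \<xi>) \<le> C * norm (of_real (\<xi> \<bullet> \<xi>) * fourier \<phi> \<xi>)" .
    qed
    show "AE \<xi> in lborel. (\<lambda>n. quotient_defect Q B \<phi> (X n) \<xi>) \<longlonglongrightarrow> 0"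
    proof (rule AE_I2)
      fix \<xi>
      have r_lim: "(\<lambda>n. r n \<xi>) \<longlonglongrightarrow> (Q *v \<xi>) \<bullet> \<xi>"
        unfolding r_def by (intro tendsto_inner bounded_bilinear.tendsto[OF bounded_bilinear_matrix_vector_mult] R tendsto_const)
      have "(\<lambda>n. (oscillation (Qt Q B (X n)) \<xi> - 1) / of_real (X n) + \<i> * of_real (r n \<xi>)) \<longlonglongrightarrow> 0"
      proof (rule Lim_null_comparison)
        show "\<forall>\<^sub>F n in sequentially. norm ((oscillation (Qt Q B (X n)) \<xi> - 1) / of_real (X n) + \<i> * of_real (r n \<xi>)) \<le> X n * (r n \<xi>)\<^sup>2"
        proof (intro always_eventually allI)
          fix n
          have "norm (oscillation (Qt Q B (X n)) \<xi> - (1 - \<i> * of_real (X n * r n \<xi>))) \<le> (X n * r n \<xi>)\<^sup>2 / 2"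
            using iexp_approx1[of "- (X n * r n \<xi>)" 1] by (simp add: oscillation_def q numeral_2_eq_2 power2_eq_square)
          also have "\<dots> \<le> (X n * r n \<xi>)\<^sup>2" by simp
          finally have "norm (oscillation (Qt Q B (X n)) \<xi> - (1 - \<i> * of_real (X n * r n \<xi>))) / X n \<le> (X n * r n \<xi>)\<^sup>2 / X n"
            using pos[of n] by (intro divide_right_mono) auto
          moreover have "(oscillation (Qt Q B (X n)) \<xi> - 1) / of_real (X n) + \<i> * of_real (r n \<xi>) =
              (oscillation (Qt Q B (X n)) \<xi> - (1 - \<i> * of_real (X n * r n \<xi>))) / of_real (X n)"
            using pos[of n] by (simp add: field_simps)
          moreover have "(X n * r n \<xi>)\<^sup>2 / X n = X n * (r n \<xi>)\<^sup>2"
            using pos[of n] by (simp add: power2_eq_square)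
          ultimately show "norm ((oscillation (Qt Q B (X n)) \<xi> - 1) / of_real (X n) + \<i> * of_real (r n \<xi>)) \<le> X n * (r n \<xi>)\<^sup>2"
            using pos[of n] by (simp add: norm_divide)
        qed
        have "(\<lambda>n. X n * (r n \<xi>)\<^sup>2) \<longlonglongrightarrow> 0 * ((Q *v \<xi>) \<bullet> \<xi>)\<^sup>2"
          by (intro tendsto_mult tendsto_power X r_lim)
        then show "(\<lambda>n. X n * (r n \<xi>)\<^sup>2) \<longlonglongrightarrow> 0" by simp
      qed
      then have "(\<lambda>n. (((oscillation (Qt Q B (X n)) \<xi> - 1) / of_real (X n) + \<i> * of_real (r n \<xi>))
          - \<i> * of_real (r n \<xi>) + \<i> * of_real ((Q *v \<xi>) \<bullet> \<xi>)) * fourier \<phi> \<xi>)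
        \<longlonglongrightarrow> (0 - \<i> * of_real ((Q *v \<xi>) \<bullet> \<xi>) + \<i> * of_real ((Q *v \<xi>) \<bullet> \<xi>)) * fourier \<phi> \<xi>"
        by (intro tendsto_mult tendsto_add tendsto_diff tendsto_of_real r_lim tendsto_const)
      then show "(\<lambda>n. quotient_defect Q B \<phi> (X n) \<xi>) \<longlonglongrightarrow> 0"
        by (simp add: quotient_defect_def)
    qed
  qed simp
  then show ?thesis by (simp add: zero_L2.abs_eq)
qed

section \<open>The linear flow and its transport operator\<close>

lemma continuous_on_det:
  fixes f :: "'a::topological_space \<Rightarrow> real^'k^'k"
  assumes "continuous_on X f" shows "continuous_on X (\<lambda>x. det (f x))"
  unfolding det_def using assms by (intro continuous_intros)

context
  fixes B :: "real^'n^'n"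
begin

private abbreviation "U t \<equiv> matrix_exp (t *\<^sub>R B)"

lemma continuous_on_norm_factor: "continuous_on X (\<lambda>t. 1 / sqrt \<bar>det (- U t)\<bar>)"
  using det_neg_matrix_exp[of _ B]
  by (intro continuous_on_divide continuous_on_real_sqrt continuous_on_rabs continuous_on_det continuous_on_minus
      continuous_on_matrix_exp continuous_on_const) auto

lemma norm_factor_bounded: "\<exists>K>0. \<forall>t\<in>{0..b}. 1 / sqrt \<bar>det (- U t)\<bar> \<le> K"
proof -
  have "bounded ((\<lambda>t. 1 / sqrt \<bar>det (- U t)\<bar>) ` {0..b})"
    by (intro compact_imp_bounded compact_continuous_image continuous_on_norm_factor) simp
  then obtain K where "K > 0" "\<And>t. t \<in> {0..b} \<Longrightarrow> norm (1 / sqrt \<bar>det (- U t)\<bar>) \<le> K"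
    unfolding bounded_pos by auto
  then show ?thesis
    by (intro exI[of _ K]) (auto simp: abs_le_iff)
qed

lemma matrix_exp_expansion: "\<exists>\<kappa>\<ge>1. \<forall>t\<in>{0..1}. \<forall>x. norm x \<le> \<kappa> * norm (U t *v x)"
proof -
  obtain K where K: "\<And>(A :: real^'n^'n) x. norm (A *v x) \<le> norm A * norm x * K" "K > 0"
    using bounded_bilinear.pos_bounded[OF bounded_bilinear_matrix_vector_mult] by blast
  have "bounded ((\<lambda>t. U t) ` {-1..0})"
    by (intro compact_imp_bounded compact_continuous_image continuous_on_matrix_exp) simp
  then obtain b where b: "b > 0" "\<And>t. t \<in> {-1..0} \<Longrightarrow> norm (U t) \<le> b"
    unfolding bounded_pos by auto
  have "norm x \<le> max 1 (b * K) * norm (U t *v x)" if "t \<in> {0..1}" for t x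
  proof -
    have "norm x = norm (U (- t) *v (U t *v x))"
      using matrix_exp_neg(1)[of t B] by (simp add: matrix_vector_mul_assoc)
    also have "\<dots> \<le> norm (U (- t)) * norm (U t *v x) * K"
      by (rule K(1))
    also have "\<dots> \<le> b * norm (U t *v x) * K"
      using b(2)[of "- t"] that K(2) by (intro mult_right_mono) auto
    also have "\<dots> = (b * K) * norm (U t *v x)" by simp
    also have "\<dots> \<le> max 1 (b * K) * norm (U t *v x)"
      by (intro mult_right_mono) auto
    finally show ?thesis .
  qed
  then show ?thesis by (intro exI[of _ "max 1 (b * K)"]) auto
qed

text \<open>The inverse flow stretches vectors by a bounded factor for \<open>0 \<le> t \<le> 1\<close>, so rapid decay survives
  composition with the flow uniformly in \<open>t\<close>.\<close>

lemma schwartz_flow_decay: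
  assumes "\<phi> \<in> schwartz"
  shows "\<exists>M\<ge>0. \<forall>t\<in>{0..1}. \<forall>x. norm (\<phi> (U t *v x)) \<le> M / (1 + norm x) ^ k"
proof -
  obtain M where M: "M > 0" "\<And>x. norm (\<phi> x) \<le> M / (1 + norm x) ^ k"
    using schwartz_decay[OF assms] by metis
  obtain \<kappa> where \<kappa>: "\<kappa> \<ge> 1" "\<And>t x. t \<in> {0..1} \<Longrightarrow> norm x \<le> \<kappa> * norm (U t *v x)"
    using matrix_exp_expansion by blast
  have "norm (\<phi> (U t *v x)) \<le> (\<kappa> ^ k * M) / (1 + norm x) ^ k" if "t \<in> {0..1}" for t x
  proof -
    have "1 + norm x \<le> \<kappa> * (1 + norm (U t *v x))"
      using \<kappa>(1) \<kappa>(2)[OF that, of x] by (simp add: distrib_left)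
    then have "(1 + norm x) ^ k \<le> (\<kappa> * (1 + norm (U t *v x))) ^ k"
      by (intro power_mono) auto
    then have "M * (1 + norm x) ^ k \<le> M * (\<kappa> ^ k * (1 + norm (U t *v x)) ^ k)"
      using M(1) by (simp add: power_mult_distrib)
    moreover have "0 < (1 + norm x) ^ k" "0 < (1 + norm (U t *v x)) ^ k"
      by (auto intro!: zero_less_power add_pos_nonneg)
    ultimately have "M / (1 + norm (U t *v x)) ^ k \<le> (\<kappa> ^ k * M) / (1 + norm x) ^ k"
      by (simp add: field_simps)
    with M(2)[of "U t *v x"] show ?thesis by linarith
  qed
  moreover have "\<kappa> ^ k * M \<ge> 0" using M(1) \<kappa>(1) by simp
  ultimately show ?thesis by blast
qed

lemma flow_tendsto: "X \<longlonglongrightarrow> 0 \<Longrightarrow> (\<lambda>n. U (X n) *v x) \<longlonglongrightarrow> x"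
proof -
  assume "X \<longlonglongrightarrow> 0"
  have "continuous_on UNIV (\<lambda>t. U t *v x)"
    by (intro bounded_bilinear.continuous_on[OF bounded_bilinear_matrix_vector_mult] continuous_on_matrix_exp continuous_on_const)
  then have "(\<lambda>n. U (X n) *v x) \<longlonglongrightarrow> U 0 *v x"
    using \<open>X \<longlonglongrightarrow> 0\<close> by (rule continuous_on_tendsto_compose) auto
  then show ?thesis by simp
qed

lemma L2_flow_tendsto:
  assumes S: "\<phi> \<in> schwartz" and X: "\<And>n. X n \<in> {0<..<1}" "X \<longlonglongrightarrow> 0"
  shows "(\<lambda>n. L2_of (\<lambda>x. \<phi> (U (X n) *v x))) \<longlonglongrightarrow> L2_of \<phi>"
proof -
  note [measurable] = schwartz_measurable[OF S]
  obtain M where M: "M \<ge> 0" "\<And>t x. t \<in> {0..1} \<Longrightarrow> norm (\<phi> (U t *v x)) \<le> M / (1 + norm x) ^ (CARD('n) + 2)"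
    using schwartz_flow_decay[OF S] by blast
  show ?thesis
  proof (rule L2_dominated_convergence(3)[where w="\<lambda>x. M / (1 + norm x) ^ (CARD('n) + 2)"])
    show "integrable lborel (\<lambda>x::real^'n. (M / (1 + norm x) ^ (CARD('n) + 2))\<^sup>2)"
      using integrable_decay_square[OF M(1), where 'a="real^'n"] by simp
    show "AE x in lborel. (\<lambda>n. \<phi> (U (X n) *v x)) \<longlonglongrightarrow> \<phi> x"
      using continuous_on_tendsto_compose[OF schwartz_continuous_on[OF S, of UNIV] flow_tendsto[OF X(2)]] by simp
    show "AE x in lborel. norm (\<phi> (U (X n) *v x)) \<le> M / (1 + norm x) ^ (CARD('n) + 2)" for n
      using M(2)[of "X n"] X(1)[of n] by simp
  qed measurable
qed

lemma drift_schwartz: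
  assumes "\<phi> \<in> schwartz" shows "drift B \<phi> \<in> schwartz"
proof -
  have "(B *v x) $ j = row j B \<bullet> x" for x j
    by (simp add: matrix_vector_mult_def row_def inner_vec_def)
  then show ?thesis
    unfolding drift_def[abs_def] using assms
    by (simp only:) (intro schwartz_sum schwartz_linear_form_mult schwartz_partial_deriv)
qed

text \<open>The derivative of \<open>\<phi>(exp(tB) x)\<close> with respect to \<open>t\<close> is the drift of \<open>\<phi>\<close> at \<open>exp(tB) x\<close>, again a Schwartz
  function along the flow; its uniform decay bounds the difference quotients.\<close>

lemma L2_drift_tendsto:
  assumes S: "\<phi> \<in> schwartz" and X: "\<And>n. X n \<in> {0<..<1}" "X \<longlonglongrightarrow> 0"
  shows "\<And>n. square_integrable (\<lambda>x. (\<phi> (U (X n) *v x) - \<phi> x) / of_real (X n))"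
    and "(\<lambda>n. L2_of (\<lambda>x. (\<phi> (U (X n) *v x) - \<phi> x) / of_real (X n))) \<longlonglongrightarrow> L2_of (drift B \<phi>)"
proof -
  note [measurable] = schwartz_measurable[OF S] schwartz_measurable[OF drift_schwartz[OF S]]
  have pos: "X n > 0" "X n \<le> 1" for n using X(1)[of n] by auto
  obtain M where M: "M \<ge> 0" "\<And>t x. t \<in> {0..1} \<Longrightarrow> norm (drift B \<phi> (U t *v x)) \<le> M / (1 + norm x) ^ (CARD('n) + 2)"
    using schwartz_flow_decay[OF drift_schwartz[OF S]] by blast
  have deriv: "((\<lambda>t. \<phi> (U t *v x)) has_vector_derivative drift B \<phi> (U t *v x)) (at t)" for x t
  proof -
    have "((\<lambda>t. U t *v x) has_vector_derivative (B ** U t) *v x) (at t)"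
      using bounded_bilinear.has_vector_derivative[OF bounded_bilinear_matrix_vector_mult matrix_exp_has_vector_derivative[of B t] has_vector_derivative_const[of x]]
      by (simp add: bounded_bilinear.zero_right[OF bounded_bilinear_matrix_vector_mult])
    from schwartz_has_vector_derivative_line[OF S this]
    show ?thesis by (simp only: drift_def matrix_vector_mul_assoc)
  qed
  have meas: "(\<lambda>x. (\<phi> (U (X n) *v x) - \<phi> x) / of_real (X n)) \<in> borel_measurable borel" for n
    by measurable
  have int: "integrable lborel (\<lambda>x::real^'n. (M / (1 + norm x) ^ (CARD('n) + 2))\<^sup>2)"
    using integrable_decay_square[OF M(1), where 'a="real^'n"] by simp
  have lim: "AE x in lborel. (\<lambda>n. (\<phi> (U (X n) *v x) - \<phi> x) / of_real (X n)) \<longlonglongrightarrow> drift B \<phi> x"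
  proof (rule AE_I2)
    fix x
    have "((\<lambda>t. (\<phi> (U t *v x) - \<phi> x) /\<^sub>R t) \<longlongrightarrow> drift B \<phi> x) (at 0)"
      using has_vector_derivative_quotient[OF deriv[of x 0]] by simp
    moreover have "filterlim X (at 0) sequentially"
      using X(2) pos(1) by (simp add: filterlim_at less_imp_neq[symmetric] always_eventually)
    ultimately have "(\<lambda>n. (\<phi> (U (X n) *v x) - \<phi> x) /\<^sub>R X n) \<longlonglongrightarrow> drift B \<phi> x"
      by (rule filterlim_compose)
    then show "(\<lambda>n. (\<phi> (U (X n) *v x) - \<phi> x) / of_real (X n)) \<longlonglongrightarrow> drift B \<phi> x"
      by (simp add: scaleR_conv_of_real divide_inverse mult.commute)
  qed
  have bound: "AE x in lborel. norm ((\<phi> (U (X n) *v x) - \<phi> x) / of_real (X n)) \<le> M / (1 + norm x) ^ (CARD('n) + 2)" for n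
  proof (rule AE_I2)
    fix x
    have "norm (\<phi> (U (X n) *v x) - \<phi> (U 0 *v x)) \<le> X n * (M / (1 + norm x) ^ (CARD('n) + 2))"
      by (rule norm_increment_le[OF _ deriv]) (use pos[of n] M(2) in auto)
    then show "norm ((\<phi> (U (X n) *v x) - \<phi> x) / of_real (X n)) \<le> M / (1 + norm x) ^ (CARD('n) + 2)"
      using pos(1)[of n] by (simp add: norm_divide pos_divide_le_eq mult.commute)
  qed
  show "\<And>n. square_integrable (\<lambda>x. (\<phi> (U (X n) *v x) - \<phi> x) / of_real (X n))"
    by (rule L2_dominated_convergence(1)[OF meas schwartz_measurable[OF drift_schwartz[OF S]] int lim bound])
  show "(\<lambda>n. L2_of (\<lambda>x. (\<phi> (U (X n) *v x) - \<phi> x) / of_real (X n))) \<longlonglongrightarrow> L2_of (drift B \<phi>)"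
    by (rule L2_dominated_convergence(3)[OF meas schwartz_measurable[OF drift_schwartz[OF S]] int lim bound])
qed

section \<open>The semigroup law and the derivative at time zero\<close>

context
  fixes Q :: "real^'n^'n"
  assumes Qt_pos: "\<forall>t>0. pos_definite (Qt Q B t)"
begin

text \<open>The square of the Fourier transform is the reflection; this is where the minus sign in front of
  the flow comes from.\<close>

lemma schroedinger_op_eq:
  assumes "0 \<le> t" "\<phi> \<in> schwartz"
  shows "schroedinger_op Q B t \<phi> = (\<lambda>x. fourier (\<lambda>\<xi>. oscillation (Qt Q B t) \<xi> * fourier \<phi> \<xi>) ((- U t) *v x))"
  using schroedinger_op_fourier[OF Qt_pos assms] by (simp add: fun_eq_iff minus_matrix_vector_mult)

lemma schroedinger_op_schwartz:
  assumes "0 \<le> t" "\<phi> \<in> schwartz"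
  shows "schroedinger_op Q B t \<phi> \<in> schwartz"
  unfolding schroedinger_op_eq[OF assms]
  by (intro schwartz_compose_linear fourier_schwartz oscillation_mult_schwartz invertible_neg invertible_matrix_exp assms)

lemma schroedinger_op_add:
  assumes "0 \<le> t" "\<phi> \<in> schwartz" "\<psi> \<in> schwartz"
  shows "schroedinger_op Q B t (\<lambda>x. \<phi> x + \<psi> x) = (\<lambda>x. schroedinger_op Q B t \<phi> x + schroedinger_op Q B t \<psi> x)"
  using assms
  by (simp add: schroedinger_op_eq schwartz_add fourier_add distrib_left fourier_schwartz oscillation_mult_schwartz)

lemma schroedinger_op_cmult:
  assumes "0 \<le> t" "\<phi> \<in> schwartz"
  shows "schroedinger_op Q B t (\<lambda>x. c * \<phi> x) = (\<lambda>x. c * schroedinger_op Q B t \<phi> x)"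
  using assms
  by (simp add: schroedinger_op_eq schwartz_cmult fourier_cmult mult.left_commute[of _ c])

text \<open>The multiplier has modulus one and the transform is isometric, so only the substitution changes
  the norm.\<close>

lemma norm_schroedinger_op:
  assumes "0 \<le> t" "\<phi> \<in> schwartz"
  shows "norm (L2_of (schroedinger_op Q B t \<phi>)) = 1 / sqrt \<bar>det (- U t)\<bar> * norm (L2_of \<phi>)"
proof -
  have "norm (L2_of (\<lambda>\<xi>. oscillation (Qt Q B t) \<xi> * fourier \<phi> \<xi>)) = norm (L2_of (fourier \<phi>))"
    using assms by (simp add: norm_L2_of square_integrable_schwartz oscillation_mult_schwartz fourier_schwartz norm_mult)
  then show ?thesis
    unfolding schroedinger_op_eq[OF assms]
    using assms
    by (simp add: norm_L2_compose_linear[OF det_neg_matrix_exp] norm_L2_of_fourier fourier_schwartz oscillation_mult_schwartz)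
qed

text \<open>On the Fourier side, composition with \<open>exp(tB)\<close> is composition with the transposed inverse matrix.
  Undoing it by the substitution \<open>\<xi> = exp(tB)\<^sup>T \<zeta>\<close> turns \<open>\<langle>Q(s)\<xi>, \<xi>\<rangle> + \<langle>Q(t)\<zeta>, \<zeta>\<rangle>\<close> into
  \<open>\<langle>Q(s+t)\<zeta>, \<zeta>\<rangle>\<close> by \<open>Qt_add\<close>.\<close>

lemma schroedinger_op_semigroup:
  assumes s: "0 \<le> s" and t: "0 \<le> t" and S: "\<phi> \<in> schwartz"
  shows "schroedinger_op Q B s (schroedinger_op Q B t \<phi>) = schroedinger_op Q B (s + t) \<phi>"
proof
  fix x
  let ?W = "U (- t)"
  let ?\<psi> = "fourier (\<lambda>\<xi>. oscillation (Qt Q B t) \<xi> * fourier \<phi> \<xi>)"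
  let ?c = "complex_of_real ((2 * pi) powr (- real CARD('n) / 2))"
  note FS = fourier_schwartz[OF S]
  note [measurable] = schwartz_measurable[OF FS]
  have inv: "(- ?W) ** (- U t) = mat 1"
    using matrix_exp_neg(1)[of t B]
    by (simp add: matrix_mult_minus_left bounded_bilinear.minus_right[OF bounded_bilinear_matrix_mult])
  have F_op: "fourier (schroedinger_op Q B t \<phi>) \<xi> =
      oscillation (Qt Q B t) (transpose ?W *v \<xi>) * fourier \<phi> (transpose ?W *v \<xi>) / of_real \<bar>det (- U t)\<bar>" for \<xi>
  proof -
    have neg: "- (transpose (- ?W) *v \<xi>) = transpose ?W *v \<xi>"
      by (simp add: matrix_vector_mult_def transpose_def vec_eq_iff sum_negf)
    show ?thesis
      unfolding schroedinger_op_eq[OF t S]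
      by (subst fourier_compose_linear[OF inv fourier_schwartz[OF oscillation_mult_schwartz[OF FS]]])
        (simp only: fourier_inversion[OF oscillation_mult_schwartz[OF FS]] neg)
  qed
  \<comment> \<open>The integrand of \<open>T(s+t)\<phi>\<close>, to be compared with that of \<open>T(s)T(t)\<phi>\<close> at \<open>\<zeta> = transpose ?W *v \<xi>\<close>.\<close>
  define h where "h \<zeta> = exp (\<i> * of_real (((- U (s + t)) *v x) \<bullet> \<zeta>)) * (oscillation (Qt Q B (s + t)) \<zeta> * fourier \<phi> \<zeta>)" for \<zeta>
  have [measurable]: "h \<in> borel_measurable borel"
    unfolding h_def[abs_def] oscillation_def by measurable
  have h: "h (transpose ?W *v \<xi>) = exp (\<i> * of_real (((- U s) *v x) \<bullet> \<xi>)) *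
      (oscillation (Qt Q B s) \<xi> * (oscillation (Qt Q B t) (transpose ?W *v \<xi>) * fourier \<phi> (transpose ?W *v \<xi>)))" for \<xi>
  proof -
    let ?\<zeta> = "transpose ?W *v \<xi>"
    have WU: "?W ** U t = mat 1" "U t ** ?W = mat 1"
      using matrix_exp_neg[of t B] by simp_all
    have \<xi>: "transpose (U t) *v ?\<zeta> = \<xi>"
    proof -
      have "transpose (U t) *v ?\<zeta> = (transpose (U t) ** transpose ?W) *v \<xi>"
        by (rule matrix_vector_mul_assoc)
      also have "transpose (U t) ** transpose ?W = transpose (?W ** U t)"
        by (rule matrix_transpose_mul[symmetric])
      finally show ?thesis
        by (simp only: WU transpose_mat matrix_vector_mul_lid)
    qed
    have st: "s + t = t + s" by simp
    have 1: "((- U (s + t)) *v x) \<bullet> ?\<zeta> = ((- U s) *v x) \<bullet> \<xi>"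
    proof -
      have "((- U (s + t)) *v x) = U t *v ((- U s) *v x)"
        unfolding st matrix_exp_add minus_matrix_vector_mult[symmetric] matrix_vector_mul_assoc[symmetric]
        by (simp add: linear_neg[OF matrix_vector_mul_linear])
      then have "((- U (s + t)) *v x) \<bullet> ?\<zeta> = ?\<zeta> \<bullet> (U t *v ((- U s) *v x))"
        by (simp only: inner_commute)
      also have "\<dots> = \<xi> \<bullet> ((- U s) *v x)"
        unfolding inner_transpose[of ?\<zeta> "U t"] \<xi> ..
      finally show ?thesis by (simp only: inner_commute)
    qed
    have 2: "(Qt Q B (s + t) *v ?\<zeta>) \<bullet> ?\<zeta> = (Qt Q B s *v \<xi>) \<bullet> \<xi> + (Qt Q B t *v ?\<zeta>) \<bullet> ?\<zeta>"
    proof -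
      have "Qt Q B (s + t) *v ?\<zeta> = Qt Q B t *v ?\<zeta> + U t *v (Qt Q B s *v (transpose (U t) *v ?\<zeta>))"
      proof -
        have "(A + X ** Y ** Z) *v v = A *v v + X *v (Y *v (Z *v v))" for A X Y Z :: "real^'n^'n" and v
          by (simp only: matrix_vector_mult_add_rdistrib matrix_vector_mul_assoc matrix_mul_assoc)
        then show ?thesis
          unfolding st Qt_add[OF s t] .
      qed
      also have "\<dots> = Qt Q B t *v ?\<zeta> + U t *v (Qt Q B s *v \<xi>)"
        by (simp only: \<xi>)
      finally have "(Qt Q B (s + t) *v ?\<zeta>) \<bullet> ?\<zeta> = (Qt Q B t *v ?\<zeta>) \<bullet> ?\<zeta> + ?\<zeta> \<bullet> (U t *v (Qt Q B s *v \<xi>))"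
        by (simp only: inner_add_left inner_add_right inner_commute)
      also have "?\<zeta> \<bullet> (U t *v (Qt Q B s *v \<xi>)) = \<xi> \<bullet> (Qt Q B s *v \<xi>)"
        unfolding inner_transpose[of ?\<zeta> "U t"] \<xi> ..
      finally show ?thesis by (simp only: inner_commute add.commute)
    qed
    have "oscillation (Qt Q B (s + t)) ?\<zeta> = oscillation (Qt Q B s) \<xi> * oscillation (Qt Q B t) ?\<zeta>"
      unfolding oscillation_def 2 by (simp only: of_real_add distrib_left exp_add)
    then show ?thesis
      unfolding h_def 1 by (simp only: mult.assoc)
  qed
  have "det (- ?W) * det (- U t) = 1"
    using arg_cong[OF inv, of det] by (simp only: det_mul det_I)
  have detW: "\<bar>det (transpose ?W)\<bar> * \<bar>det (- U t)\<bar> = 1"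
  proof -
    have "- U t = (- mat 1) ** U t" by (simp add: matrix_mult_minus_left)
    then have "det (- U t) = det (- mat 1 :: real^'n^'n) * det (U t)" by (simp only: det_mul)
    moreover have "\<bar>det (- mat 1 :: real^'n^'n)\<bar> = 1"
    proof -
      have "(- mat 1) ** (- mat 1) = (mat 1 :: real^'n^'n)"
        by (simp add: matrix_mult_minus_left)
      then have "det ((- mat 1) ** (- mat 1) :: real^'n^'n) = det (mat 1 :: real^'n^'n)" by (rule arg_cong)
      then have "det (- mat 1 :: real^'n^'n) * det (- mat 1 :: real^'n^'n) = 1" by (simp only: det_mul det_I)
      then show ?thesis by (simp add: power2_eq_square flip: abs_square_eq_1)
    qed
    moreover have "det ?W * det (U t) = 1"
      using arg_cong[OF matrix_exp_neg(1)[of t B], of det] by (simp add: det_mul)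
    ultimately show ?thesis
      by (simp add: det_transpose abs_mult[symmetric] abs_mult)
  qed
  have "schroedinger_op Q B s (schroedinger_op Q B t \<phi>) x =
      ?c * (LINT \<xi>|lborel. exp (\<i> * of_real (((- U s) *v x) \<bullet> \<xi>)) * (oscillation (Qt Q B s) \<xi> * fourier (schroedinger_op Q B t \<phi>) \<xi>))"
    unfolding schroedinger_op_eq[OF s schroedinger_op_schwartz[OF t S]]
    by (simp only: fourier_def[of "\<lambda>\<xi>. oscillation (Qt Q B s) \<xi> * fourier (schroedinger_op Q B t \<phi>) \<xi>"])
  also have "\<dots> = ?c * (LINT \<xi>|lborel. h (transpose ?W *v \<xi>) / of_real \<bar>det (- U t)\<bar>)"
    unfolding F_op h by (simp only: times_divide_eq_right)
  also have "(LINT \<xi>|lborel. h (transpose ?W *v \<xi>) / of_real \<bar>det (- U t)\<bar>) = (LINT \<xi>|lborel. h (transpose ?W *v \<xi>)) / of_real \<bar>det (- U t)\<bar>"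
    by simp
  also have "(LINT \<xi>|lborel. h (transpose ?W *v \<xi>)) = (LINT \<xi>|lborel. h \<xi>) /\<^sub>R \<bar>det (transpose ?W)\<bar>"
    using detW by (intro lborel_integral_linear) auto
  also have "\<dots> / of_real \<bar>det (- U t)\<bar> = (LINT \<xi>|lborel. h \<xi>)"
  proof -
    have "inverse \<bar>det (transpose ?W)\<bar> = \<bar>det (- U t)\<bar>"
      using detW by (metis inverse_unique)
    then show ?thesis
      using det_neg_matrix_exp[of t B] by (simp only: scaleR_conv_of_real) simp
  qed
  also have "?c * (LINT \<xi>|lborel. h \<xi>) = schroedinger_op Q B (s + t) \<phi> x"
    using s t by (simp only: schroedinger_op_eq[OF _ S] add_nonneg_nonneg fourier_def[of "\<lambda>\<xi>. oscillation (Qt Q B (s + t)) \<xi> * fourier \<phi> \<xi>"] h_def)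
  finally show "schroedinger_op Q B s (schroedinger_op Q B t \<phi>) x = schroedinger_op Q B (s + t) \<phi> x" .
qed

text \<open>The three terms are the error of the multiplier, the second-order part transported by the flow, and
  the difference quotient along the flow.\<close>

lemma difference_quotient_eq:
  assumes "0 < t" and S: "\<phi> \<in> schwartz"
  shows "(schroedinger_op Q B t \<phi> x - \<phi> x) / of_real t =
    fourier (quotient_defect Q B \<phi> t) ((- U t) *v x) + second_order Q \<phi> (U t *v x) + (\<phi> (U t *v x) - \<phi> x) / of_real t"
proof -
  note F = fourier_schwartz[OF S]
  have *: "- ((- U t) *v x) = U t *v x"
    by (simp add: minus_matrix_vector_mult[symmetric])
  have "fourier (quotient_defect Q B \<phi> t) ((- U t) *v x) =
      (1 / of_real t) * (fourier (\<lambda>\<xi>. oscillation (Qt Q B t) \<xi> * fourier \<phi> \<xi>) ((- U t) *v x) - fourier (fourier \<phi>) ((- U t) *v x)) -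
      fourier (fourier (second_order Q \<phi>)) ((- U t) *v x)"
    unfolding quotient_defect_eq[OF S]
    by (subst fourier_diff, intro schwartz_diff schwartz_cmult oscillation_mult_schwartz F,
        intro fourier_schwartz second_order_schwartz S,
        subst fourier_cmult, subst fourier_diff[OF oscillation_mult_schwartz[OF F] F], rule refl)
  also have "\<dots> = (1 / of_real t) * (schroedinger_op Q B t \<phi> x - \<phi> (U t *v x)) - second_order Q \<phi> (U t *v x)"
    using assms(1) by (simp only: schroedinger_op_eq[OF less_imp_le[OF assms(1)] S] fourier_inversion[OF S] fourier_inversion[OF second_order_schwartz[OF S]] *)
  finally show ?thesis
    using assms(1) by (simp add: field_simps)
qed

lemma schroedinger_op_difference_quotient:
  assumes S: "\<phi> \<in> schwartz"
  shows "((\<lambda>t. (L2_of (schroedinger_op Q B t \<phi>) - L2_of \<phi>) /\<^sub>R t) \<longlongrightarrow> L2_of (schroedinger_diff_op Q B \<phi>)) (at_right 0)"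
proof -
  note sq = square_integrable_schwartz
  have "((\<lambda>t. (L2_of (schroedinger_op Q B t \<phi>) - L2_of \<phi>) /\<^sub>R t) \<longlongrightarrow> L2_of (schroedinger_diff_op Q B \<phi>)) (at 0 within {0<..<1})"
    unfolding tendsto_at_iff_sequentially
  proof (intro allI impI)
    fix X :: "nat \<Rightarrow> real" assume "\<forall>n. X n \<in> {0<..<1} - {0}" and lim: "X \<longlonglongrightarrow> 0"
    then have X: "X n \<in> {0<..<1}" for n by auto
    then have pos: "0 < X n" for n by auto
    let ?k = "\<lambda>n x. fourier (quotient_defect Q B \<phi> (X n)) ((- U (X n)) *v x)"
    have kS: "?k n \<in> schwartz" for n
      by (intro schwartz_compose_linear fourier_schwartz quotient_defect_schwartz invertible_neg invertible_matrix_exp S)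
    have AS: "(\<lambda>x. second_order Q \<phi> (U (X n) *v x)) \<in> schwartz" for n
      by (intro schwartz_compose_linear second_order_schwartz invertible_matrix_exp S)
    have eq: "(L2_of (schroedinger_op Q B (X n) \<phi>) - L2_of \<phi>) /\<^sub>R X n =
       L2_of (?k n) + L2_of (\<lambda>x. second_order Q \<phi> (U (X n) *v x)) + L2_of (\<lambda>x. (\<phi> (U (X n) *v x) - \<phi> x) / of_real (X n))" for n
    proof -
      note opS = schroedinger_op_schwartz[OF less_imp_le[OF pos[of n]] S]
      have "(L2_of (schroedinger_op Q B (X n) \<phi>) - L2_of \<phi>) /\<^sub>R X n = L2_of (\<lambda>x. (schroedinger_op Q B (X n) \<phi> x - \<phi> x) / of_real (X n))"
        by (simp add: L2_of_diff L2_of_scaleR sq opS S square_integrable_diff scaleR_conv_of_real divide_inverse mult.commute)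
      then show ?thesis
        unfolding difference_quotient_eq[OF pos S]
        using kS AS L2_drift_tendsto(1)[OF S X lim]
        by (simp add: L2_of_add sq square_integrable_add)
    qed
    have "(\<lambda>n. norm (L2_of (?k n))) \<longlonglongrightarrow> 0"
    proof -
      have n: "norm (L2_of (?k n)) = norm (L2_of (quotient_defect Q B \<phi> (X n))) * (1 / sqrt \<bar>det (- U (X n))\<bar>)" for n
        using quotient_defect_schwartz[OF S]
        by (simp add: norm_L2_compose_linear[OF det_neg_matrix_exp] fourier_schwartz norm_L2_of_fourier)
      have "(\<lambda>n. 1 / sqrt \<bar>det (- U (X n))\<bar>) \<longlonglongrightarrow> 1 / sqrt \<bar>det (- U 0)\<bar>"
        by (rule continuous_on_tendsto_compose[OF continuous_on_norm_factor[of UNIV] lim]) auto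
      from tendsto_mult[OF tendsto_norm_zero[OF L2_quotient_defect_tendsto[OF S X lim]] this]
      show ?thesis unfolding n by simp
    qed
    then have "(\<lambda>n. L2_of (?k n)) \<longlonglongrightarrow> 0"
      by (simp add: tendsto_norm_zero_iff)
    then have "(\<lambda>n. L2_of (?k n) + L2_of (\<lambda>x. second_order Q \<phi> (U (X n) *v x)) + L2_of (\<lambda>x. (\<phi> (U (X n) *v x) - \<phi> x) / of_real (X n)))
      \<longlonglongrightarrow> 0 + L2_of (second_order Q \<phi>) + L2_of (drift B \<phi>)"
      by (intro tendsto_add L2_flow_tendsto L2_drift_tendsto(2) second_order_schwartz S X lim)
    also have "0 + L2_of (second_order Q \<phi>) + L2_of (drift B \<phi>) = L2_of (schroedinger_diff_op Q B \<phi>)"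
      by (simp add: schroedinger_diff_op_eq L2_of_add sq second_order_schwartz drift_schwartz S)
    finally show "((\<lambda>t. (L2_of (schroedinger_op Q B t \<phi>) - L2_of \<phi>) /\<^sub>R t) \<circ> X) \<longlonglongrightarrow> L2_of (schroedinger_diff_op Q B \<phi>)"
      unfolding o_def eq .
  qed
  moreover have "at 0 within {0<..<1} = (at_right 0 :: real filter)"
    by (rule at_within_nhd[of _ "{..<1}"]) auto
  ultimately show ?thesis by simp
qed

end

end

section \<open>The semigroup and its generator\<close>

theorem theorem3p1:
  fixes Q B :: "real^'n^'n"
  assumes "pos_semidefinite Q"
    and "\<forall>t>0. pos_definite (Qt Q B t)"
  shows "(\<forall>t\<ge>0. \<forall>\<phi>\<in>schwartz. schroedinger_op Q B t \<phi> \<in> schwartz) \<and>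
    (\<exists>T. C0_semigroup T \<and> extends_to_L2 (schroedinger_op Q B) T \<and>
      (\<forall>T'. C0_semigroup T' \<and> extends_to_L2 (schroedinger_op Q B) T' \<longrightarrow> (\<forall>t\<ge>0. T' t = T t)) \<and>
      is_core (L2_of ` schwartz) (generator_domain T) (generator T) \<and>
      (\<forall>\<phi>\<in>schwartz. generator T (L2_of \<phi>) = L2_of (schroedinger_diff_op Q B \<phi>)))"
proof -
  note P = assms(2)
  let ?S = "L2_of ` schwartz :: (real^'n) L2 set"
  let ?K = "\<lambda>t. 1 / sqrt \<bar>det (- matrix_exp (t *\<^sub>R B))\<bar>"
  have "\<exists>T. 0 \<le> t \<longrightarrow> bounded_linear T \<and> (\<forall>c F. T (c *\<^sub>C F) = c *\<^sub>C T F) \<and>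
      (\<forall>\<phi>\<in>schwartz. T (L2_of \<phi>) = L2_of (schroedinger_op Q B t \<phi>)) \<and> (\<forall>F. norm (T F) \<le> ?K t * norm F)" for t
  proof (cases "0 \<le> t")
    case True
    show ?thesis
      using L2_extension[of "schroedinger_op Q B t" "?K t", OF schroedinger_op_schwartz[OF P True] schroedinger_op_add[OF P True]
          schroedinger_op_cmult[OF P True] eq_refl[OF norm_schroedinger_op[OF P True]]]
      by blast
  qed simp
  then obtain T where T: "\<And>t. 0 \<le> t \<Longrightarrow> bounded_linear (T t)" "\<And>t c F. 0 \<le> t \<Longrightarrow> T t (c *\<^sub>C F) = c *\<^sub>C T t F"
    and T_op: "\<And>t \<phi>. 0 \<le> t \<Longrightarrow> \<phi> \<in> schwartz \<Longrightarrow> T t (L2_of \<phi>) = L2_of (schroedinger_op Q B t \<phi>)"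
    and T_norm: "\<And>t F. 0 \<le> t \<Longrightarrow> norm (T t F) \<le> ?K t * norm F"
    by metis
  have agree: "T1 = T2" if "bounded_linear T1" "bounded_linear T2" "\<And>\<phi>. \<phi> \<in> schwartz \<Longrightarrow> T1 (L2_of \<phi>) = T2 (L2_of \<phi>)"
    for T1 T2 :: "(real^'n) L2 \<Rightarrow> (real^'n) L2"
    using continuous_eq_on_dense[OF linear_continuous_on[OF that(1)] linear_continuous_on[OF that(2)] schwartz_dense_L2] that(3)
    by (intro ext) blast
  have zero: "T 0 = id"
    by (rule agree) (auto simp: T T_op schroedinger_op_def id_def bounded_linear_ident)
  have law: "T (s + t) = T s \<circ> T t" if "0 \<le> s" "0 \<le> t" for s t
  proof (rule agree)
    show "bounded_linear (T s \<circ> T t)"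
      unfolding o_def by (rule bounded_linear_compose[OF T(1)[OF that(1)] T(1)[OF that(2)]])
    show "T (s + t) (L2_of \<phi>) = (T s \<circ> T t) (L2_of \<phi>)" if "\<phi> \<in> schwartz" for \<phi>
      using \<open>0 \<le> s\<close> \<open>0 \<le> t\<close> that
      by (simp add: T_op schroedinger_op_schwartz[OF P] schroedinger_op_semigroup[OF P])
  qed (use that in \<open>simp add: T\<close>)
  have bounded: "\<exists>K>0. \<forall>t\<in>{0..b}. \<forall>F. norm (T t F) \<le> K * norm F" for b
  proof -
    obtain K where K: "K > 0" "\<And>t. t \<in> {0..b} \<Longrightarrow> ?K t \<le> K"
      using norm_factor_bounded by blast
    have "norm (T t F) \<le> K * norm F" if "t \<in> {0..b}" for t F
      using that by (intro order_trans[OF T_norm mult_right_mono[OF K(2)]]) auto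
    with K(1) show ?thesis by blast
  qed
  have quotient: "((\<lambda>t. (T t (L2_of \<phi>) - L2_of \<phi>) /\<^sub>R t) \<longlongrightarrow> L2_of (schroedinger_diff_op Q B \<phi>)) (at_right 0)"
    if "\<phi> \<in> schwartz" for \<phi>
  proof (rule Lim_transform_eventually[OF schroedinger_op_difference_quotient[OF P that]])
    show "\<forall>\<^sub>F t in at_right 0. (L2_of (schroedinger_op Q B t \<phi>) - L2_of \<phi>) /\<^sub>R t = (T t (L2_of \<phi>) - L2_of \<phi>) /\<^sub>R t"
      unfolding eventually_at by (intro exI[of _ 1]) (auto simp: T_op that)
  qed
  have cont: "continuous_on {0..} (\<lambda>t. T t F)" for F
  proof (rule semigroup_strongly_continuous[OF T(1) zero law bounded schwartz_dense_L2])
    fix F assume "F \<in> ?S"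
    then obtain \<phi> where \<phi>: "\<phi> \<in> schwartz" "F = L2_of \<phi>" by blast
    have "((\<lambda>t. t *\<^sub>R ((T t F - F) /\<^sub>R t) + F) \<longlongrightarrow> 0 *\<^sub>R L2_of (schroedinger_diff_op Q B \<phi>) + F) (at_right 0)"
      unfolding \<phi>(2) by (intro tendsto_add tendsto_scaleR quotient \<phi>(1) tendsto_const tendsto_ident_at)
    then have "((\<lambda>t. t *\<^sub>R ((T t F - F) /\<^sub>R t) + F) \<longlongrightarrow> F) (at_right 0)"
      by (simp only: scaleR_zero_left add_0)
    then show "((\<lambda>t. T t F) \<longlongrightarrow> F) (at_right 0)"
    proof (rule Lim_transform_eventually)
      show "\<forall>\<^sub>F t in at_right 0. t *\<^sub>R ((T t F - F) /\<^sub>R t) + F = T t F"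
        unfolding eventually_at by (intro exI[of _ 1]) auto
    qed
  qed
  have gen: "L2_of \<phi> \<in> generator_domain T" "generator T (L2_of \<phi>) = L2_of (schroedinger_diff_op Q B \<phi>)"
    if "\<phi> \<in> schwartz" for \<phi>
    using generatorI[where T=T and f="L2_of \<phi>", OF quotient[OF that]] by auto
  have C0: "C0_semigroup T"
    unfolding C0_semigroup_def using T zero law cont by auto
  have ext: "extends_to_L2 (schroedinger_op Q B) T"
    unfolding extends_to_L2_def using T_op by auto
  have unique: "T' t = T t" if "C0_semigroup T'" "extends_to_L2 (schroedinger_op Q B) T'" "0 \<le> t" for T' t
    using that T_op by (intro agree) (auto simp: C0_semigroup_def extends_to_L2_def T)
  have core: "is_core ?S (generator_domain T) (generator T)"
    unfolding is_core_def
  proof (intro conjI ballI allI impI)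
    show "\<exists>g\<in>?S. norm (f - g) + norm (generator T f - generator T g) < \<epsilon>" if "f \<in> generator_domain T" "\<epsilon> > 0" for f \<epsilon>
      using gen(1) T_op schroedinger_op_schwartz[OF P]
      by (intro invariant_dense_subspace_is_core[OF T(1) zero law bounded cont subspace_schwartz_L2 schwartz_dense_L2 _ _ that]) auto
  qed (auto intro!: gen(1) scaleC_schwartz_L2 subspace_schwartz_L2)
  show ?thesis
    using schroedinger_op_schwartz[OF P] C0 ext unique core gen(2) by blast
qed

end
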